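(* Suppose that $A$ is stable, the matrix pair $\left(\begin{bmatrix} C & Q\end{bmatrix},\begin{bmatrix} A & P\\ 0 & S\end{bmatrix}\right)$ is detectable, and there exist an open set $W^o\subset W$ containing $0$ and $C^2$ maps $\pi:W^o\to X$ and $\gamma:W^o\to U$, with $\pi(0)=0$ and $\gamma(0)=0$, that satisfy the nonlinear regulator equations $$\frac{\partial \pi}{\partial w}\,s(w)=f(\pi(w),\gamma(w),w),\qquad h(\pi(w),\gamma(w),w)=0\qquad\forall\, w\in W^o.$$ Then there exists $B_c\in\mathbb{R}^p$ such that the controller $$\dot\xi=s(\xi)+B_c e,\qquad u=\gamma(\xi)$$ solves the local error feedback regulator problem for the plant, the exosystem and the error. Moreover, this controller is minimal, i.e. it is of the lowest possible order among all controllers $\dot\xi=\eta(\xi,e)$, $u=\theta(\xi)$ (of the general form described in the context) that solve this local error feedback regulator problem.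
   Context: **Plant, exosystem, error.** The plant is $\dot x=f(x,u,w)$, $y=g(x,u,w)$, with state $x(t)\in X\subset\mathbb{R}^n$, control input $u(t)\in U\subset\mathbb{R}$, output $y(t)\in Y\subset\mathbb{R}$, where $X,U,Y$ are open sets containing the origin. The exosystem is $\dot w=s(w)$, with $w(t)\in W\subset\mathbb{R}^p$, $W$ open, $0\in W$. The reference signal is $y_r=q(w)$. The maps $f:X\times U\times W\to\mathbb{R}^n$, $g:X\times U\times W\to Y$, $s:W\to\mathbb{R}^p$, $q:W\to Y$ are of class $C^2$ and vanish at the origin. The tracking error is $e=h(x,u,w)=g(x,u,w)-q(w)$, with $h:X\times U\times W\to Y_e$, where $Y_e\subset\mathbb{R}$ is open and $Y\subset Y_e$. **Standing assumptions on the exosystem.** The origin is a Lyapunov stable equilibrium point of $\dot w=s(w)$, and every point $w_0\in W$ is nonwandering: with $\phi_t$ denoting the flow of $s$ on $W$, the trajectory $\phi_t(w_0)$ is defined for all $t>0$ and for every neighborhood $\mathcal{O}$ of $w_0$ and every $T>0$ there exists $\tau>T$ such that $\phi_\tau(\mathcal{O})\cap\mathcal{O}\neq\emptyset$ (equivalently, there are sequences $t_n\to\infty$ in $(0,\infty)$ and $w_n\to w_0$ in $W$ such that $\phi_{t_n}(w_n)$ exists and $\phi_{t_n}(w_n)\to w_0$). **Linearization.** $A=\left[\frac{\partial f}{\partial x}\right]_{(0,0,0)}$, $P=\left[\frac{\partial f}{\partial w}\right]_{(0,0,0)}$, $C=\left[\frac{\partial h}{\partial x}\right]_{(0,0,0)}$,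 $Q=\left[\frac{\partial h}{\partial w}\right]_{(0,0,0)}$, $S=\left[\frac{\partial s}{\partial w}\right]_{(0)}$. "$A$ is stable" means that all eigenvalues of $A$ have negative real part. A pair $(\Lambda,\Phi)$ of matrices ($\Phi$ square) is detectable if no $v\neq0$ satisfies $\Phi v=pv$, $\Lambda v=0$ for some $p\in\mathbb{C}$ with $\mathrm{Re}\,p\ge0$. **Controllers.** A controller (general form) is $\dot\xi=\eta(\xi,e)$, $u=\theta(\xi)$, with state $\xi(t)\in X_c\subset\mathbb{R}^{n_c}$, $X_c$ open, $0\in X_c$, where $\eta:X_c\times Y_e\to\mathbb{R}^{n_c}$ and $\theta:X_c\to U$ are $C^2$ with $\eta(0,0)=0$, $\theta(0)=0$. Its order is $n_c$. For the controller in the claim, the state set is $X_c=W^o$. **Local error feedback regulator problem.** The controller solves this problem for the plant, exosystem and error if: (1) the equilibrium $(x,\xi)=(0,0)$ of $\dot x=f(x,\theta(\xi),0)$, $\dot\xi=\eta(\xi,h(x,\theta(\xi),0))$ is locally exponentially stable; (2) for each initial condition $(x(0),\xi(0),w(0))$ in some fixed neighborhood of $(0,0,0)$ in $X\times X_c\times W$, the system $\dot x=f(x,\theta(\xi),w)$, $\dot w=s(w)$, $\dot\xi=\eta(\xi,h(x,\theta(\xi),w))$ has a unique global (in time $t\ge0$) solution, and $\lim_{t\to+\infty}h(x(t),\theta(\xi(t)),w(t))=0$. *)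

theory Defs
  imports "HOL-Analysis.Analysis"
begin

text \<open>
  The dimension \<open>n\<^sub>c\<close> of the state space of a controller may be any natural number, including zero
  (a static controller), whereas \<open>real ^ 'k\<close> and the class \<open>euclidean_space\<close> exclude dimension zero.
  The Euclidean space of dimension \<open>n\<^sub>c\<close> is therefore rendered as a type of class \<open>real_inner\<close> that is
  spanned by a finite set, with \<open>n\<^sub>c = dim UNIV\<close>. The following instance supplies dimension zero.
\<close>

instantiation unit :: real_inner
begin

definition zero_unit :: unit where "zero_unit = ()"
definition plus_unit :: "unit \<Rightarrow> unit \<Rightarrow> unit" where "plus_unit x y = ()"
definition minus_unit :: "unit \<Rightarrow> unit \<Rightarrow> unit" where "minus_unit x y = ()"
definition uminus_unit :: "unit \<Rightarrow> unit" where "uminus_unit x = ()"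
definition scaleR_unit :: "real \<Rightarrow> unit \<Rightarrow> unit" where "scaleR_unit r x = ()"
definition sgn_unit :: "unit \<Rightarrow> unit" where "sgn_unit x = ()"
definition norm_unit :: "unit \<Rightarrow> real" where "norm_unit x = 0"
definition dist_unit :: "unit \<Rightarrow> unit \<Rightarrow> real" where "dist_unit x y = 0"
definition inner_unit :: "unit \<Rightarrow> unit \<Rightarrow> real" where "inner_unit x y = 0"
definition uniformity_unit :: "(unit \<times> unit) filter" where
  "uniformity_unit = (INF e\<in>{0<..}. principal {(x, y). dist x y < e})"
definition open_unit :: "unit set \<Rightarrow> bool" where
  "open_unit S \<longleftrightarrow> (\<forall>x\<in>S. \<forall>\<^sub>F (x', y) in uniformity. x' = x \<longrightarrow> y \<in> S)"

instance
  by standard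
    (simp_all add: sgn_unit_def norm_unit_def dist_unit_def inner_unit_def
      uniformity_unit_def open_unit_def)

end

definition finite_dimensional :: "'z::real_vector itself \<Rightarrow> bool" where
  "finite_dimensional _ \<longleftrightarrow> (\<exists>B :: 'z set. finite B \<and> span B = UNIV)"

text \<open>Meant for open \<open>S\<close>.\<close>

definition C2_on :: "('a::real_normed_vector \<Rightarrow> 'b::real_normed_vector) \<Rightarrow> 'a set \<Rightarrow> bool" where
  "C2_on F S \<longleftrightarrow>
    (\<exists>(F' :: 'a \<Rightarrow> 'a \<Rightarrow>\<^sub>L 'b) (F'' :: 'a \<Rightarrow> 'a \<Rightarrow>\<^sub>L ('a \<Rightarrow>\<^sub>L 'b)).
      (\<forall>x\<in>S. (F has_derivative blinfun_apply (F' x)) (at x)) \<and>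
      (\<forall>x\<in>S. (F' has_derivative blinfun_apply (F'' x)) (at x)) \<and>
      continuous_on S F'')"

definition complex_matrix :: "real ^ 'n ^ 'm \<Rightarrow> complex ^ 'n ^ 'm" where
  "complex_matrix M = map_matrix complex_of_real M"

definition stable_matrix :: "real ^ 'n ^ 'n \<Rightarrow> bool" where
  "stable_matrix A \<longleftrightarrow>
    (\<forall>(\<mu> :: complex) v. v \<noteq> 0 \<and> complex_matrix A *v v = \<mu> *s v \<longrightarrow> Re \<mu> < 0)"

definition detectable :: "real ^ 'n ^ 'm \<Rightarrow> real ^ 'n ^ 'n \<Rightarrow> bool" where
  "detectable \<Lambda> \<Phi> \<longleftrightarrow>
    \<not> (\<exists>v (\<mu> :: complex). v \<noteq> 0 \<and> Re \<mu> \<ge> 0 \<and>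
         complex_matrix \<Phi> *v v = \<mu> *s v \<and> complex_matrix \<Lambda> *v v = 0)"

definition hblock :: "'a ^ 'n ^ 'm \<Rightarrow> 'a ^ 'p ^ 'm \<Rightarrow> 'a ^ ('n + 'p) ^ 'm" where
  "hblock M N = (\<chi> i j. case j of Inl k \<Rightarrow> M $ i $ k | Inr k \<Rightarrow> N $ i $ k)"

definition vblock :: "'a ^ 'k ^ 'm \<Rightarrow> 'a ^ 'k ^ 'l \<Rightarrow> 'a ^ 'k ^ ('m + 'l)" where
  "vblock M N = (\<chi> i. case i of Inl k \<Rightarrow> M $ k | Inr k \<Rightarrow> N $ k)"

text \<open>
  Solutions of \<open>z' = F z\<close> on a time interval \<open>T\<close> are required to stay in \<open>D\<close>, the domain of the
  vector field: \<open>F\<close> is a total function in HOL whose values outside \<open>D\<close> carry no meaning.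
\<close>

definition ode_solution ::
  "('a::real_normed_vector \<Rightarrow> 'a) \<Rightarrow> 'a set \<Rightarrow> real set \<Rightarrow> 'a \<Rightarrow> (real \<Rightarrow> 'a) \<Rightarrow> bool" where
  "ode_solution F D T a z \<longleftrightarrow>
    z 0 = a \<and>
    (\<forall>t\<in>T. z t \<in> D \<and> (z has_vector_derivative F (z t)) (at t within T))"

text \<open>The image of \<open>N\<close> under the time-\<open>\<tau>\<close> flow map, which in general is only partially defined.\<close>

definition flow_image ::
  "('a::real_normed_vector \<Rightarrow> 'a) \<Rightarrow> 'a set \<Rightarrow> real \<Rightarrow> 'a set \<Rightarrow> 'a set" where
  "flow_image F D \<tau> N = {z \<tau> |z. \<exists>a\<in>N. ode_solution F D {0..\<tau>} a z}"

definition nonwandering ::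
  "('a::real_normed_vector \<Rightarrow> 'a) \<Rightarrow> 'a set \<Rightarrow> 'a \<Rightarrow> bool" where
  "nonwandering F D a \<longleftrightarrow>
    (\<exists>z. ode_solution F D {0..} a z) \<and>
    (\<forall>N. open N \<and> a \<in> N \<longrightarrow> (\<forall>T>0. \<exists>\<tau>>T. flow_image F D \<tau> N \<inter> N \<noteq> {}))"

definition lyapunov_stable_origin ::
  "('a::real_normed_vector \<Rightarrow> 'a) \<Rightarrow> 'a set \<Rightarrow> bool" where
  "lyapunov_stable_origin F D \<longleftrightarrow>
    0 \<in> D \<and> F 0 = 0 \<and>
    (\<forall>\<epsilon>>0. \<exists>\<delta>>0. \<forall>a\<in>D. norm a < \<delta> \<longrightarrow>
      (\<exists>z. ode_solution F D {0..} a z) \<and>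
      (\<forall>z. ode_solution F D {0..} a z \<longrightarrow> (\<forall>t\<ge>0. norm (z t) < \<epsilon>)))"

definition locally_exp_stable_origin ::
  "('a::real_normed_vector \<Rightarrow> 'a) \<Rightarrow> 'a set \<Rightarrow> bool" where
  "locally_exp_stable_origin F D \<longleftrightarrow>
    0 \<in> D \<and> F 0 = 0 \<and>
    (\<exists>r>0. \<exists>M>0. \<exists>\<alpha>>0. \<forall>a\<in>D. norm a < r \<longrightarrow>
      (\<exists>z. ode_solution F D {0..} a z) \<and>
      (\<forall>z. ode_solution F D {0..} a z \<longrightarrow>
        (\<forall>t\<ge>0. norm (z t) \<le> M * exp (- \<alpha> * t) * norm a)))"

definition controller ::
  "real set \<Rightarrow> real set \<Rightarrow> 'z::real_inner set \<Rightarrow> ('z \<Rightarrow> real \<Rightarrow> 'z) \<Rightarrow> ('z \<Rightarrow> real) \<Rightarrow> bool" where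
  "controller U Ye Xc \<eta> \<theta> \<longleftrightarrow>
    finite_dimensional TYPE('z) \<and>
    open Xc \<and> 0 \<in> Xc \<and>
    C2_on (\<lambda>(\<xi>, e). \<eta> \<xi> e) (Xc \<times> Ye) \<and> \<eta> 0 0 = 0 \<and>
    C2_on \<theta> Xc \<and> \<theta> \<in> Xc \<rightarrow> U \<and> \<theta> 0 = 0"

text \<open>The order depends only on the space in which the state set (open and nonempty) lies.\<close>

definition controller_order :: "'z::real_vector set \<Rightarrow> nat" where
  "controller_order (Xc :: 'z set) = dim (UNIV :: 'z set)"

definition solves_regulator_problem ::
  "(real ^ 'n \<Rightarrow> real \<Rightarrow> real ^ 'p \<Rightarrow> real ^ 'n) \<Rightarrow>
   (real ^ 'n \<Rightarrow> real \<Rightarrow> real ^ 'p \<Rightarrow> real) \<Rightarrow>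
   (real ^ 'p \<Rightarrow> real ^ 'p) \<Rightarrow> (real ^ 'n) set \<Rightarrow> (real ^ 'p) set \<Rightarrow>
   'z::real_inner set \<Rightarrow> ('z \<Rightarrow> real \<Rightarrow> 'z) \<Rightarrow> ('z \<Rightarrow> real) \<Rightarrow> bool" where
  "solves_regulator_problem f h s X W Xc \<eta> \<theta> \<longleftrightarrow>
    locally_exp_stable_origin
      (\<lambda>(x, \<xi>). (f x (\<theta> \<xi>) 0, \<eta> \<xi> (h x (\<theta> \<xi>) 0))) (X \<times> Xc) \<and>
    (\<exists>N. open N \<and> 0 \<in> N \<and> N \<subseteq> X \<times> Xc \<times> W \<and>
      (\<forall>a\<in>N. \<exists>z.
        let sol = ode_solution
          (\<lambda>(x, \<xi>, w). (f x (\<theta> \<xi>) w, \<eta> \<xi> (h x (\<theta> \<xi>) w), s w)) (X \<times> Xc \<times> W) {0..} a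
        in sol z \<and> (\<forall>z'. sol z' \<longrightarrow> (\<forall>t\<ge>0. z' t = z t)) \<and>
           ((\<lambda>t. case z t of (x, \<xi>, w) \<Rightarrow> h x (\<theta> \<xi>) w) \<longlongrightarrow> 0) at_top))"

end

theory Submission
  imports Defs "HOL-Analysis.Analysis" "HOL-Computational_Algebra.Fundamental_Theorem_Algebra"
begin

text \<open>
  \<open>Existence.\<close> Lyapunov stability and the nonwandering property force the spectrum of \<open>S\<close> onto the imaginary
  axis (\<open>exosystem_spectrum_nonneg\<close>, \<open>exosystem_spectrum_nonpos\<close>): an eigenvalue off the axis gives a quadratic
  form that grows or decays exponentially along all trajectories near the origin. Consider now the deviation
  \<open>(x - \<pi> w, \<xi> - w)\<close> of the closed loop from the graph on which the regulator equations hold. This graph is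
  invariant and the error is zero on it, so the deviation satisfies a differential equation whose field vanishes
  at zero, and it decays exponentially, uniformly in the driving exosystem trajectory, as soon as its linear part
  at the origin is stable (\<open>driven_exponential_stability\<close>, \<open>driven_closed_loop\<close>). Regulation and, with the exosystem
  at rest, local exponential stability follow. It remains to choose \<open>Bc\<close> (\<open>stabilizing_output_injection\<close>).
  The linear part is an output injection into the pair of plant and exosystem in which \<open>Bc\<close> also acts on the
  plant. The plant is stable and the spectrum of \<open>S\<close> is imaginary, hence an arbitrarily small gain can
  stabilize the exosystem part (\<open>low_gain_lyapunov\<close>), and a small gain does not disturb the plant. Detectability enters as
  observability of the exosystem part.

  \<open>Minimality.\<close> Let a controller of order less than the dimension \<open>p\<close> of the exosystem solve the problem. The linear part \<open>J\<close>
  of its loop is stable (\<open>hurwitz_of_exp_stable\<close>), so there is a linear steady state response \<open>\<Pi>\<close> with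
  \<open>\<Pi> S = J \<Pi> + E\<close>, where \<open>E\<close> is the action of the exosystem on the loop. If the linear error vanishes in the
  steady state, then the controller component of \<open>\<Pi>\<close> intertwines \<open>S\<close> with the linearised controller; its kernel is
  nonzero and invariant under \<open>S\<close>, and an eigenvector in it contradicts detectability
  (\<open>minimal_controller_order\<close>). That the linear error does vanish is the content of \<open>steady_output_vanishes\<close>:
  the true trajectory follows the linear steady state up to a small fraction of the exosystem state
  (\<open>tracking_error_decay\<close>), and a combination of Baire's theorem with the nonwandering property
  yields trajectories that return close to any prescribed small exosystem state with an error that is as small
  as desired relative to it. No centre manifold is constructed.

  Lyapunov matrices, also the indefinite and the arbitrarily large ones, are obtained from one theorem of alternatives for
  linear matrix inequalities (\<open>lmi_duality\<close>) whose dual alternative is excluded by an eigenvector of a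
  quotient map (\<open>quotient_eigenvector\<close>).
\<close>

section \<open>Eigenvectors of quotient maps\<close>

definition complex_eigenvalue :: "complex ^ 'n ^ 'n \<Rightarrow> complex \<Rightarrow> bool" where
  "complex_eigenvalue T l \<longleftrightarrow> (\<exists>v. v \<noteq> 0 \<and> T *v v = l *s v)"

text \<open>
  A complex eigenvector is handled through its real and imaginary parts, on which a real matrix acts as
  a scaled rotation; all estimates below are then about real quadratic forms.
\<close>

definition Re_vec :: "complex ^ 'n \<Rightarrow> real ^ 'n" where "Re_vec u = (\<chi> i. Re (u $ i))"
definition Im_vec :: "complex ^ 'n \<Rightarrow> real ^ 'n" where "Im_vec u = (\<chi> i. Im (u $ i))"

lemma Re_Im_vec_simps [simp]:
  "Re_vec 0 = 0" "Im_vec 0 = 0"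
  "Re_vec (u - v) = Re_vec u - Re_vec v" "Im_vec (u - v) = Im_vec u - Im_vec v"
  "Re_vec (u + v) = Re_vec u + Re_vec v" "Im_vec (u + v) = Im_vec u + Im_vec v"
  "Re_vec (l *s u) = Re l *\<^sub>R Re_vec u - Im l *\<^sub>R Im_vec u"
  "Im_vec (l *s u) = Re l *\<^sub>R Im_vec u + Im l *\<^sub>R Re_vec u"
  "Re_vec (complex_matrix M *v u) = M *v Re_vec u"
  "Im_vec (complex_matrix M *v u) = M *v Im_vec u"
  by (simp_all add: Re_vec_def Im_vec_def vec_eq_iff complex_matrix_def map_matrix_def
      matrix_vector_mult_def)

lemma complex_vec_eq_iff: "u = v \<longleftrightarrow> Re_vec u = Re_vec v \<and> Im_vec u = Im_vec v"
  by (auto simp: Re_vec_def Im_vec_def vec_eq_iff complex_eq_iff)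

lemma obtain_complex_vec:
  obtains u where "Re_vec u = a" "Im_vec u = b"
  by (rule that[of "\<chi> i. Complex (a $ i) (b $ i)"]) (simp_all add: Re_vec_def Im_vec_def)

text \<open>
  The iterates of a vector under a matrix cannot all be independent; a linear relation between them is a
  polynomial that annihilates the vector.
\<close>

lemma annihilating_polynomial:
  fixes T :: "complex ^ 'n ^ 'n"
  shows "\<exists>p N. p \<noteq> 0 \<and> degree p < N \<and> (\<Sum>i<N. coeff p i *s (((*v) T ^^ i) u)) = 0"
proof (cases "inj (\<lambda>i. ((*v) T ^^ i) u)")
  \<comment> \<open>If two iterates coincide, their difference is already a relation.\<close>
  case False
  then obtain i j where ij: "i < j" "((*v) T ^^ i) u = ((*v) T ^^ j) u"
    unfolding inj_def by (metis linorder_neqE_nat)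
  define p where "p = monom (1::complex) j - monom 1 i"
  have c: "coeff p k = (if k = j then 1 else if k = i then -1 else 0)" for k
    using ij by (auto simp: p_def)
  have "p \<noteq> 0" using c[of j] by auto
  moreover have "degree p < Suc j" using c ij by (auto intro!: degree_le le_imp_less_Suc)
  moreover have "(\<Sum>k<Suc j. coeff p k *s (((*v) T ^^ k) u))
      = (\<Sum>k\<in>{i,j}. coeff p k *s (((*v) T ^^ k) u))"
    by (rule sum.mono_neutral_right) (use ij in \<open>auto simp: c\<close>)
  moreover have "\<dots> = 0" using ij by (simp add: c)
  ultimately have "p \<noteq> 0 \<and> degree p < Suc j \<and> (\<Sum>k<Suc j. coeff p k *s (((*v) T ^^ k) u)) = 0"
    by simp
  then show ?thesis by blast
next
  case True
  let ?f = "\<lambda>i. ((*v) T ^^ i) u"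
  define N where "N = Suc (vec.dim (UNIV :: (complex ^ 'n) set))"
  have fin: "finite (?f ` {..<N})" by simp
  have card: "card (?f ` {..<N}) = N" using True by (simp add: card_image inj_on_def inj_def)
  have "vec.dependent (?f ` {..<N})"
    using vec.independent_card_le_dim[of "?f ` {..<N}" UNIV] card N_def by auto
  then obtain c v where c: "v \<in> ?f ` {..<N}" "c v \<noteq> 0" "(\<Sum>v\<in>?f ` {..<N}. c v *s v) = 0"
    using vec.dependent_finite[OF fin] by auto
  define p where "p = (\<Sum>i<N. monom (c (?f i)) i)"
  have co: "coeff p i = (if i < N then c (?f i) else 0)" for i
    by (simp add: p_def coeff_sum)
  have pne: "p \<noteq> 0" using c(1,2) co by (metis (no_types, lifting) coeff_0 imageE lessThan_iff)
  moreover have "degree p < N"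
    using co[of "degree p"] pne by (metis leading_coeff_0_iff)
  moreover have "(\<Sum>i<N. coeff p i *s ?f i) = (\<Sum>v\<in>?f ` {..<N}. c v *s v)"
    using True by (subst sum.reindex) (auto simp: co inj_def inj_on_def)
  ultimately have "p \<noteq> 0 \<and> degree p < N \<and> (\<Sum>i<N. coeff p i *s ?f i) = 0" using c(3) by simp
  then show ?thesis by blast
qed

lemma mat_vector_mult: "mat l *v v = l *s (v :: 'a::comm_semiring_1 ^ 'n)"
  by (simp add: mat_def matrix_vector_mult_def vec_eq_iff if_distrib if_distribR cong: if_cong)

text \<open>
  The annihilating polynomial splits into linear factors over the complex numbers. The list of its roots
  is all that is needed in the sequel.
\<close>

lemma annihilating_factors:
  fixes T :: "complex ^ 'n ^ 'n"
  shows "\<exists>ls. fold (\<lambda>l v. T *v v - l *s v) ls u = 0"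
proof -
  have "p \<noteq> 0 \<Longrightarrow> degree p < N \<Longrightarrow> (\<Sum>i<N. coeff p i *s (((*v) T ^^ i) u)) = 0 \<Longrightarrow>
     \<exists>ls. fold (\<lambda>l v. T *v v - l *s v) ls u = 0" for p N
  proof (induction "degree p" arbitrary: p N u)
    case 0
    then obtain N' where N: "N = Suc N'" by (cases N) auto
    have "(\<Sum>i<N. coeff p i *s (((*v) T ^^ i) u)) = coeff p 0 *s u"
      unfolding N sum.lessThan_Suc_shift using 0(1)
      by (auto intro!: sum.neutral simp: coeff_eq_0)
    moreover have "coeff p 0 \<noteq> 0" using 0 by (metis leading_coeff_0_iff)
    ultimately have "u = 0" using 0(4) by simp
    then show ?case by (intro exI[of _ "[]"]) simp
  next
    case (Suc d)
    have "\<not> constant (poly p)" using Suc(2) by (simp add: constant_degree)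
    \<comment> \<open>Splitting off a root \<open>l\<close> of the annihilating polynomial leaves a polynomial of smaller degree that annihilates \<open>T u - l u\<close>.\<close>
    then obtain l where "poly p l = 0" using fundamental_theorem_of_algebra by blast
    then obtain q where q: "p = [:-l, 1:] * q" using poly_eq_0_iff_dvd by (metis dvdE)
    have q0: "q \<noteq> 0" using Suc(3) q by auto
    have dq: "degree q = d" using Suc(2) q0 unfolding q by (subst (asm) degree_mult_eq) auto
    obtain N' where N: "N = Suc N'" using Suc(4) by (cases N) auto
    have dN: "degree q < N'" using dq Suc(2,4) N by simp
    let ?w = "T *v u - l *s u"
    have it: "((*v) T ^^ i) ?w = ((*v) T ^^ Suc i) u - l *s ((*v) T ^^ i) u" for i
    proof (induction i)
      case (Suc i)
      then show ?case by (simp add: vec.diff vec.scale)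
    qed simp
    have "(\<Sum>i<N. coeff p i *s (((*v) T ^^ i) u))
       = (\<Sum>i<N. (case i of 0 \<Rightarrow> 0 | Suc j \<Rightarrow> coeff q j) *s (((*v) T ^^ i) u))
         - (\<Sum>i<N. (l * coeff q i) *s (((*v) T ^^ i) u))"
      unfolding sum_subtractf[symmetric] q
      by (rule sum.cong) (auto simp: coeff_pCons algebra_simps vec_eq_iff split: nat.splits)
    also have "(\<Sum>i<N. (case i of 0 \<Rightarrow> 0 | Suc j \<Rightarrow> coeff q j) *s (((*v) T ^^ i) u))
       = (\<Sum>i<N'. coeff q i *s (((*v) T ^^ Suc i) u))"
      unfolding N sum.lessThan_Suc_shift by simp
    also have "(\<Sum>i<N. (l * coeff q i) *s (((*v) T ^^ i) u))
        = (\<Sum>i<N'. (l * coeff q i) *s (((*v) T ^^ i) u))"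
      unfolding N using dN by (simp add: coeff_eq_0)
    finally have "(\<Sum>i<N'. coeff q i *s (((*v) T ^^ i) ?w)) = 0"
      using Suc(5) unfolding it
      by (simp add: sum_subtractf[symmetric] algebra_simps vec_eq_iff)
    then obtain ls where "fold (\<lambda>l v. T *v v - l *s v) ls ?w = 0"
      using Suc(1)[OF dq[symmetric] q0 dN] by blast
    then show ?case by (intro exI[of _ "l # ls"]) simp
  qed
  then show ?thesis using annihilating_polynomial by metis
qed

text \<open>
  An eigenvector of the map induced by \<open>T\<close> on the quotient of two invariant subspaces, together with
  the fact that its eigenvalue is also an eigenvalue of \<open>T\<close>. Every spectral argument of this theory
  is an application of this lemma: the kernel of a matrix that intertwines or dominates \<open>T\<close> plays
  the role of \<open>K\<close>.
\<close>

lemma quotient_eigenvector_complex: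
  fixes T :: "complex ^ 'n ^ 'n"
  assumes V: "vec.subspace V" "\<And>x. x \<in> V \<Longrightarrow> T *v x \<in> V"
    and K: "vec.subspace K" "\<And>x. x \<in> K \<Longrightarrow> T *v x \<in> K"
    and u0: "u0 \<in> V" "u0 \<notin> K"
  shows "\<exists>u l. u \<in> V \<and> u \<notin> K \<and> T *v u - l *s u \<in> K \<and> complex_eigenvalue T l"
proof -
  \<comment> \<open>Along the chain of factors the vector leaves the complement of \<open>K\<close> at some step; the last vector outside \<open>K\<close> is the required one.\<close>
  have descend: "\<exists>u l. u \<in> V \<and> u \<notin> K \<and> T *v u - l *s u \<in> K"
    if "fold (\<lambda>l v. T *v v - l *s v) ls u \<in> K" "u \<in> V" "u \<notin> K" for ls u
    using that
  proof (induction ls arbitrary: u)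
    case (Cons l ls)
    show ?case
    proof (cases "T *v u - l *s u \<in> K")
      case False
      moreover have "T *v u - l *s u \<in> V"
        using V Cons(3) by (simp add: vec.subspace_diff vec.subspace_scale)
      ultimately show ?thesis using Cons by auto
    qed (use Cons in auto)
  qed auto
  obtain ls where "fold (\<lambda>l v. T *v v - l *s v) ls u0 = 0"
    using annihilating_factors by blast
  then obtain u l where u: "u \<in> V" "u \<notin> K" "T *v u - l *s u \<in> K"
    using descend[of ls u0] u0 vec.subspace_0[OF K(1)] by auto
  \<comment> \<open>If \<open>T - l\<close> were injective it would map \<open>K\<close> onto \<open>K\<close>, and then \<open>u\<close> itself would lie in \<open>K\<close>.\<close>
  have "complex_eigenvalue T l"
  proof (rule ccontr)
    assume "\<not> complex_eigenvalue T l"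
    then have inj0: "v = 0" if "T *v v - l *s v = 0" for v
      using that by (auto simp: complex_eigenvalue_def)
    have mv: "(T - mat l) *v v = T *v v - l *s v" for v
      by (simp add: matrix_vector_mult_diff_rdistrib mat_vector_mult)
    have inj: "inj ((*v) (T - mat l))"
      by (rule injI) (metis eq_iff_diff_eq_0 inj0 mv vec.diff)
    have sub: "(*v) (T - mat l) ` K \<subseteq> K"
      using K by (auto simp: mv vec.subspace_diff vec.subspace_scale)
    have "vec.dim ((*v) (T - mat l) ` K) = vec.dim K"
      using inj by (intro vec.dim_image_eq) (auto simp: inj_on_def inj_def)
    then have "(*v) (T - mat l) ` K = K"
      using vec.subspace_dim_equal[OF vec.subspace_image[OF K(1)] K(1) sub] by simp
    then obtain k where "k \<in> K" "T *v u - l *s u = (T - mat l) *v k" using u(3) by blast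
    then show False using inj u(2) unfolding mv[symmetric] by (metis injD)
  qed
  then show ?thesis using u by blast
qed


lemma complex_eigenvalue_real:
  fixes T :: "real ^ 'n ^ 'n"
  shows "complex_eigenvalue (complex_matrix T) l \<longleftrightarrow>
    (\<exists>a b. (a \<noteq> 0 \<or> b \<noteq> 0) \<and> T *v a = Re l *\<^sub>R a - Im l *\<^sub>R b \<and> T *v b = Re l *\<^sub>R b + Im l *\<^sub>R a)"
  (is "?L = ?R")
proof
  assume ?L
  then obtain v where "v \<noteq> 0" "complex_matrix T *v v = l *s v" unfolding complex_eigenvalue_def by auto
  then show ?R
    by (intro exI[of _ "Re_vec v"] exI[of _ "Im_vec v"]) (auto simp: complex_vec_eq_iff)
next
  assume ?R
  then obtain a b where ab: "a \<noteq> 0 \<or> b \<noteq> 0" "T *v a = Re l *\<^sub>R a - Im l *\<^sub>R b"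
      "T *v b = Re l *\<^sub>R b + Im l *\<^sub>R a" by auto
  obtain v where v: "Re_vec v = a" "Im_vec v = b" by (rule obtain_complex_vec)
  show ?L unfolding complex_eigenvalue_def
    by (rule exI[of _ v]) (use ab v in \<open>auto simp: complex_vec_eq_iff\<close>)
qed

lemma quotient_eigenvector:
  fixes T :: "real ^ 'n ^ 'n"
  assumes V: "subspace V" "\<And>x. x \<in> V \<Longrightarrow> T *v x \<in> V"
    and K: "subspace K" "\<And>x. x \<in> K \<Longrightarrow> T *v x \<in> K"
    and "\<not> V \<subseteq> K"
  obtains a b l where "a \<in> V" "b \<in> V" "a \<notin> K \<or> b \<notin> K"
    "T *v a - (Re l *\<^sub>R a - Im l *\<^sub>R b) \<in> K" "T *v b - (Re l *\<^sub>R b + Im l *\<^sub>R a) \<in> K"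
    "complex_eigenvalue (complex_matrix T) l"
proof -
  define cx where "cx U = {u. Re_vec u \<in> U \<and> Im_vec u \<in> U}" for U :: "(real ^ 'n) set"
  have sub: "vec.subspace (cx U)" if "subspace U" for U
    using that by (auto simp: cx_def vec.subspace_def subspace_def
      intro!: subspace_diff[OF that] subspace_add[OF that])
  have inv: "complex_matrix T *v u \<in> cx U" if "\<And>x. x \<in> U \<Longrightarrow> T *v x \<in> U" "u \<in> cx U" for U u
    using that by (simp add: cx_def)
  obtain x where x: "x \<in> V" "x \<notin> K" using assms(5) by auto
  obtain u0 where "Re_vec u0 = x" "Im_vec u0 = 0" by (rule obtain_complex_vec)
  then have "u0 \<in> cx V" "u0 \<notin> cx K" using x subspace_0[OF V(1)] by (auto simp: cx_def)
  from quotient_eigenvector_complex[OF sub[OF V(1)] inv[of V] sub[OF K(1)] inv[of K] this]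
  obtain u l where "u \<in> cx V" "u \<notin> cx K" "complex_matrix T *v u - l *s u \<in> cx K"
    "complex_eigenvalue (complex_matrix T) l"
    using V(2) K(2) by blast
  then show ?thesis
    by (intro that[of "Re_vec u" "Im_vec u" l]) (auto simp: cx_def)
qed

text \<open>
  Every eigenvalue is a root of one of the polynomials that annihilate the basis vectors.
\<close>

lemma finite_complex_eigenvalues:
  fixes T :: "real ^ 'n ^ 'n"
  shows "finite {l. complex_eigenvalue (complex_matrix T) l}"
proof -
  let ?A = "transpose (complex_matrix T)"
  have "\<forall>j :: 'n. \<exists>ls. fold (\<lambda>l v. ?A *v v - l *s v) ls (axis j 1) = 0"
    using annihilating_factors by blast
  then obtain ls where ls: "\<And>j :: 'n. fold (\<lambda>l v. ?A *v v - l *s v) (ls j) (axis j 1) = 0"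
    by metis
  have "m \<in> (\<Union>j. set (ls j))" if "complex_eigenvalue (complex_matrix T) m" for m
  proof -
    obtain v where v: "v \<noteq> 0" "complex_matrix T *v v = m *s v"
      using \<open>complex_eigenvalue (complex_matrix T) m\<close> unfolding complex_eigenvalue_def by auto
    \<comment> \<open>The bilinear pairing with an eigenvector of \<open>T\<close> turns each factor \<open>A - l\<close> of the transpose into the scalar \<open>m - l\<close>.\<close>
    define d where "d x = (\<Sum>i\<in>UNIV. v $ i * x $ i)" for x :: "complex ^ 'n"
    have "d (?A *v x) = (\<Sum>i\<in>UNIV. (complex_matrix T *v v) $ i * x $ i)" for x
      unfolding d_def matrix_vector_mult_def transpose_def
      by (simp add: sum_distrib_left sum_distrib_right mult_ac) (subst sum.swap, simp add: mult_ac)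
    then have dA: "d (?A *v x) = m * d x" for x
      unfolding v(2) by (simp add: d_def sum_distrib_left mult_ac)
    have "d (x - l *s y) = d x - l * d y" for x y l
      by (simp add: d_def sum_subtractf sum_distrib_left algebra_simps)
    then have step: "d (?A *v x - l *s x) = (m - l) * d x" for x l
      by (simp add: dA algebra_simps del: transpose_matrix_vector)
    have "d (fold (\<lambda>l v. ?A *v v - l *s v) ms x) = (\<Prod>l\<leftarrow>ms. m - l) * d x" for ms x
      by (induction ms arbitrary: x) (simp_all add: step del: transpose_matrix_vector)
    note fold = this
    have d0: "d 0 = 0" and dax: "d (axis j 1) = v $ j" for j
      by (simp_all add: d_def axis_def if_distrib cong: if_cong)
    have "(\<Prod>l\<leftarrow>ls j. m - l) * v $ j = 0" for j
      using fold[of "ls j" "axis j 1"] unfolding ls d0 dax by simp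
    moreover obtain j where "v $ j \<noteq> 0" using v(1) by (auto simp: vec_eq_iff)
    ultimately have "(\<Prod>l\<leftarrow>ls j. m - l) = 0" using mult_eq_0_iff by blast
    then show ?thesis by (auto simp: prod_list_zero_iff)
  qed
  then have "{l. complex_eigenvalue (complex_matrix T) l} \<subseteq> (\<Union>j. set (ls j))" by auto
  then show ?thesis by (rule finite_subset) auto
qed

lemma complex_eigenvalue_transpose:
  fixes T :: "real ^ 'n ^ 'n"
  shows "complex_eigenvalue (complex_matrix (transpose T)) l \<longleftrightarrow> complex_eigenvalue (complex_matrix T) l"
proof -
  have "complex_eigenvalue M l \<longleftrightarrow> det (M - mat l) = 0" for M :: "complex ^ 'n ^ 'n"
  proof -
    have "complex_eigenvalue M l \<longleftrightarrow> \<not> (\<forall>x. (M - mat l) *v x = 0 \<longrightarrow> x = 0)"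
      by (auto simp: complex_eigenvalue_def matrix_vector_mult_diff_rdistrib mat_vector_mult)
    also have "\<dots> \<longleftrightarrow> \<not> invertible (M - mat l)"
      unfolding matrix_left_invertible_ker[symmetric] invertible_left_inverse ..
    finally show ?thesis by (simp add: invertible_det_nz)
  qed
  moreover have "complex_matrix (transpose T) - mat l = transpose (complex_matrix T - mat l)"
    by (simp add: vec_eq_iff transpose_def complex_matrix_def map_matrix_def mat_def)
  ultimately show ?thesis by (metis det_transpose)
qed

lemma complex_eigenvalue_uminus:
  "complex_eigenvalue (complex_matrix (- T)) l \<longleftrightarrow> complex_eigenvalue (complex_matrix T) (- l)"
proof -
  have "complex_matrix (- T) *v v = - (complex_matrix T *v v)" for v
    by (simp add: vec_eq_iff complex_matrix_def map_matrix_def matrix_vector_mult_def sum_negf)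
  then show ?thesis unfolding complex_eigenvalue_def
    by (metis (no_types, lifting) add.inverse_inverse vector_sneg_minus1 vector_smult_assoc mult_minus1
      vector_smult_lneg)
qed

lemma complex_eigenvalue_shift:
  "complex_eigenvalue (complex_matrix (T + mat c)) l \<longleftrightarrow>
    complex_eigenvalue (complex_matrix T) (l - of_real c)"
proof -
  have "complex_matrix (T + mat c) = complex_matrix T + mat (of_real c)"
    by (simp add: vec_eq_iff complex_matrix_def map_matrix_def mat_def)
  then have "complex_matrix (T + mat c) *v v = complex_matrix T *v v + of_real c *s v" for v
    by (simp add: matrix_vector_mult_add_rdistrib mat_vector_mult)
  then show ?thesis unfolding complex_eigenvalue_def
    by (auto simp: vec_eq_iff algebra_simps) 
qed

section \<open>Lyapunov matrices by convex duality\<close>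

text \<open>
  Products with transposed matrices stay in the form \<open>transpose A *v x\<close> instead of being turned into
  row vector products.
\<close>

declare transpose_matrix_vector [simp del] vector_transpose_matrix [simp del]

lemma inner_transpose_mult: "x \<bullet> (transpose A *v y) = (A *v x) \<bullet> (y :: real ^ 'm)"
  for x :: "real ^ 'n"
  by (metis dot_lmul_matrix inner_commute transpose_matrix_vector)

lemma symmetric_inner: "transpose M = M \<Longrightarrow> (M *v x) \<bullet> y = x \<bullet> (M *v y)"
  for M :: "real ^ 'n ^ 'n"
  by (metis inner_transpose_mult)

lemma inner_transpose_transpose: "transpose A \<bullet> transpose B = A \<bullet> (B :: real ^ 'n ^ 'm)"
  unfolding inner_vec_def transpose_def by simp (subst sum.swap, simp)

lemma inner_matrix_mult_left: "Y \<bullet> (A ** W) = (transpose A ** Y) \<bullet> W"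
  for Y :: "real ^ 'n ^ 'm" and A :: "real ^ 'k ^ 'm"
proof -
  have "Y \<bullet> (A ** W) = (\<Sum>i\<in>UNIV. \<Sum>j\<in>UNIV. \<Sum>k\<in>UNIV. Y $ i $ j * (A $ i $ k * W $ k $ j))"
    by (simp add: inner_vec_def matrix_matrix_mult_def sum_distrib_left)
  also have "\<dots> = (\<Sum>k\<in>UNIV. \<Sum>j\<in>UNIV. \<Sum>i\<in>UNIV. Y $ i $ j * (A $ i $ k * W $ k $ j))"
    by (subst sum.swap) (subst (2) sum.swap, subst sum.swap, rule refl)
  also have "\<dots> = (transpose A ** Y) \<bullet> W"
    by (simp add: inner_vec_def matrix_matrix_mult_def sum_distrib_left sum_distrib_right transpose_def mult_ac)
  finally show ?thesis .
qed

lemma inner_matrix_mult_right: "Y \<bullet> (W ** A) = (Y ** transpose A) \<bullet> W"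
  for Y :: "real ^ 'n ^ 'm" and A :: "real ^ 'n ^ 'k"
proof -
  have "Y \<bullet> (W ** A) = transpose Y \<bullet> (transpose A ** transpose W)"
    by (metis inner_transpose_transpose matrix_transpose_mul)
  also have "\<dots> = transpose (Y ** transpose A) \<bullet> transpose W"
    by (simp add: inner_matrix_mult_left matrix_transpose_mul)
  finally show ?thesis by (simp add: inner_transpose_transpose)
qed

definition outer :: "real ^ 'n \<Rightarrow> real ^ 'n ^ 'n" where
  "outer x = (\<chi> i j. x $ i * x $ j)"

lemma inner_outer: "Y \<bullet> outer x = x \<bullet> (Y *v x)"
  by (simp add: outer_def inner_vec_def matrix_vector_mult_def sum_distrib_left mult_ac)

lemma outer_form: "y \<bullet> (outer x *v y) = (x \<bullet> y)\<^sup>2"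
  unfolding power2_eq_square
  by (simp add: outer_def inner_vec_def matrix_vector_mult_def sum_distrib_left sum_distrib_right
      sum_product mult_ac)

lemma quadratic_form_lower_bound:
  fixes R :: "real ^ 'n ^ 'n"
  assumes "\<And>x. x \<noteq> 0 \<Longrightarrow> 0 < x \<bullet> (R *v x)"
  obtains m where "m > 0" "\<And>x. m * (x \<bullet> x) \<le> x \<bullet> (R *v x)"
proof -
  have "continuous_on (sphere 0 1) (\<lambda>x. x \<bullet> (R *v x))"
    by (intro continuous_intros)
  moreover have "sphere (0 :: real ^ 'n) 1 \<noteq> {}" by simp
  ultimately obtain u where u: "u \<in> sphere 0 1" "\<And>x. x \<in> sphere 0 1 \<Longrightarrow> u \<bullet> (R *v u) \<le> x \<bullet> (R *v x)"
    using continuous_attains_inf[OF compact_sphere, of 0 1 "\<lambda>x. x \<bullet> (R *v x)"] by blast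
  have "(u \<bullet> (R *v u)) * (x \<bullet> x) \<le> x \<bullet> (R *v x)" for x
  proof (cases "x = 0")
    case False
    define y where "y = x /\<^sub>R norm x"
    have "x = norm x *\<^sub>R y" "y \<in> sphere 0 1" using False by (simp_all add: y_def)
    then have "x \<bullet> (R *v x) = (norm x)\<^sup>2 * (y \<bullet> (R *v y))"
      by (metis (no_types, lifting) inner_scaleR_left inner_scaleR_right matrix_vector_mult_scaleR
          mult.assoc power2_eq_square)
    then show ?thesis
      using mult_left_mono[OF u(2)[OF \<open>y \<in> sphere 0 1\<close>], of "(norm x)\<^sup>2"]
      by (simp add: power2_norm_eq_inner mult.commute)
  qed simp
  moreover have "u \<noteq> 0" using u(1) by auto
  ultimately show ?thesis using that[of "u \<bullet> (R *v u)"] assms[of u] by blast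
qed

text \<open>
  Letting \<open>t\<close> tend to infinity and to zero isolates the two coefficients; this reads off the
  components of a functional that is nonnegative on a cone.
\<close>

lemma affine_nonneg:
  fixes p q :: real
  assumes "\<And>t. t > 0 \<Longrightarrow> 0 \<le> t * p + q"
  shows "0 \<le> p" "0 \<le> q"
proof -
  show "0 \<le> p"
  proof (rule ccontr)
    assume p: "\<not> 0 \<le> p"
    then have "0 < (\<bar>q\<bar> + 1) / - p" by (intro divide_pos_pos) auto
    from assms[OF this] p have "0 \<le> - (\<bar>q\<bar> + 1) + q" by simp
    then show False by linarith
  qed
  show "0 \<le> q"
  proof (rule ccontr)
    assume q: "\<not> 0 \<le> q"
    define t where "t = - q / (2 * (\<bar>p\<bar> + 1))"
    have "0 < t" unfolding t_def using q by (intro divide_pos_pos) (auto simp: not_le)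
    moreover from assms[OF this] have "0 \<le> t * p + q" .
    moreover have "t * p \<le> t * (\<bar>p\<bar> + 1)"
      using \<open>0 < t\<close> by (intro mult_left_mono) auto
    moreover have "t * (\<bar>p\<bar> + 1) = - q / 2" by (simp add: t_def field_simps)
    ultimately show False using q by linarith
  qed
qed

lemma affine_zero:
  fixes p q :: real
  assumes "\<And>t. 0 \<le> t * p + q"
  shows "p = 0"
proof -
  have "0 \<le> p" by (rule affine_nonneg(1)[of p q]) (rule assms)
  moreover have "0 \<le> - p"
  proof (rule affine_nonneg(1)[of "- p" q])
    show "0 \<le> t * - p + q" for t using assms[of "- t"] by simp
  qed
  ultimately show ?thesis by simp
qed

text \<open>
  A vector at which a positive semidefinite form vanishes minimises it, so the gradient \<open>Y x\<close> is zero.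
\<close>

lemma psd_null:
  fixes Y :: "real ^ 'n ^ 'n"
  assumes "transpose Y = Y" "\<And>x. 0 \<le> x \<bullet> (Y *v x)" "x \<bullet> (Y *v x) = 0"
  shows "Y *v x = 0"
proof -
  let ?y = "Y *v x"
  have "0 \<le> - 2 * (?y \<bullet> ?y)"
  proof (rule affine_nonneg(2)[of "?y \<bullet> (Y *v ?y)"])
    fix t :: real
    assume t: "t > 0"
    have "0 \<le> (x - t *\<^sub>R ?y) \<bullet> (Y *v (x - t *\<^sub>R ?y))" by (rule assms(2))
    also have "\<dots> = t * (t * (?y \<bullet> (Y *v ?y)) + - 2 * (?y \<bullet> ?y))"
      using assms(3) symmetric_inner[OF assms(1), of x ?y]
      by (simp add: matrix_vector_mult_diff_distrib matrix_vector_mult_scaleR inner_diff_left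
          inner_diff_right power2_eq_square algebra_simps inner_commute)
    finally show "0 \<le> t * (?y \<bullet> (Y *v ?y)) + - 2 * (?y \<bullet> ?y)"
      using t by (simp add: zero_le_mult_iff)
  qed
  then have "?y \<bullet> ?y = 0" using inner_ge_zero[of ?y] by linarith
  then show ?thesis by simp
qed

text \<open>
  Theorem of alternatives for two linear matrix inequalities in one symmetric unknown \<open>W\<close>. The matrices
  that can be written as left minus right sides minus positive definite matrices form a convex set; the
  inequalities are solvable exactly if it contains zero, and otherwise a separating hyperplane consists of
  two positive semidefinite matrices \<open>Y\<close>, \<open>Z\<close>, linked by the adjoint of the Lyapunov operator. All
  Lyapunov matrices below come from excluding the second alternative, so neither matrix exponentials nor
  normal forms are involved.
\<close>

lemma lmi_duality:
  fixes S G :: "real ^ 'n ^ 'n" and c K :: real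
  obtains (primal) W where "transpose W = W"
      "\<And>x. x \<noteq> 0 \<Longrightarrow> 2 * ((W *v x) \<bullet> (S *v x)) < x \<bullet> (G *v x)"
      "\<And>x. x \<noteq> 0 \<Longrightarrow> K * (x \<bullet> x) < c * (x \<bullet> (W *v x))"
  | (dual) Y Z where "transpose Y = Y" "transpose Z = Z"
      "\<And>x. 0 \<le> x \<bullet> (Y *v x)" "\<And>x. 0 \<le> x \<bullet> (Z *v x)"
      "S ** Y + Y ** transpose S = c *\<^sub>R Z" "Y \<bullet> G \<le> K * (Z \<bullet> mat 1)" "Y \<noteq> 0 \<or> Z \<noteq> 0"
proof -
  define P where "P = {R :: real ^ 'n ^ 'n. \<forall>x. x \<noteq> 0 \<longrightarrow> 0 < x \<bullet> (R *v x)}"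
  define \<Lambda> where "\<Lambda> = (\<lambda>(W, R1, R2). (- (W ** S + transpose S ** W) - R1, c *\<^sub>R W - R2 :: real ^ 'n ^ 'n))"
  define \<S> where "\<S> = (+) (G, - K *\<^sub>R mat 1) ` \<Lambda> ` (UNIV \<times> P \<times> P)"
  have "convex P"
  proof (rule convexI)
    fix R R' :: "real ^ 'n ^ 'n" and u v :: real
    assume R: "R \<in> P" "R' \<in> P" and uv: "0 \<le> u" "0 \<le> v" "u + v = 1"
    have "0 < x \<bullet> ((u *\<^sub>R R + v *\<^sub>R R') *v x)" if "x \<noteq> 0" for x
    proof -
      have pos: "0 < x \<bullet> (R *v x)" "0 < x \<bullet> (R' *v x)" using R that by (auto simp: P_def)
      have "0 < u * (x \<bullet> (R *v x)) + v * (x \<bullet> (R' *v x))"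
      proof (cases "u = 0")
        case False
        then have "0 < u * (x \<bullet> (R *v x))" "0 \<le> v * (x \<bullet> (R' *v x))"
          using pos uv by simp_all
        then show ?thesis by linarith
      qed (use pos uv in simp)
      then show ?thesis
        by (simp add: matrix_vector_mult_add_rdistrib scaleR_matrix_vector_assoc[symmetric] inner_add_right)
    qed
    then show "u *\<^sub>R R + v *\<^sub>R R' \<in> P" by (simp add: P_def)
  qed
  moreover have "linear \<Lambda>"
  proof -
    have "(r *\<^sub>R W) ** V = r *\<^sub>R (W ** V)" "V ** (r *\<^sub>R W) = r *\<^sub>R (V ** W)"
      "(W + W') ** V = W ** V + W' ** V" for r and V W W' :: "real ^ 'n ^ 'n"
      by (simp_all add: vec_eq_iff matrix_matrix_mult_def sum_distrib_left sum.distrib algebra_simps)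
    then show ?thesis
      unfolding \<Lambda>_def
      by (intro linearI) (auto simp: matrix_add_ldistrib scaleR_add_right scaleR_diff_right)
  qed
  ultimately have "convex \<S>"
    unfolding \<S>_def by (intro convex_translation convex_linear_image convex_Times) auto
  show ?thesis
  proof (cases "0 \<in> \<S>")
    case True
    then obtain W R1 R2 where R: "R1 \<in> P" "R2 \<in> P"
      and "0 = (G, - K *\<^sub>R mat 1) + \<Lambda> (W, R1, R2)" unfolding \<S>_def by auto
    then have R1: "R1 = G - (W ** S + transpose S ** W)" and R2: "R2 = c *\<^sub>R W - K *\<^sub>R mat 1"
      by (simp_all add: \<Lambda>_def zero_prod_def algebra_simps eq_neg_iff_add_eq_0)
    \<comment> \<open>Only the symmetric part of \<open>W\<close> enters the two quadratic forms.\<close>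
    define W' where "W' = (1/2) *\<^sub>R (W + transpose W)"
    have "transpose W' = W'" by (simp add: W'_def transpose_def vec_eq_iff)
    moreover have W'x: "2 *\<^sub>R (W' *v x) = W *v x + transpose W *v x" for x
      by (simp add: W'_def matrix_vector_mult_add_rdistrib scaleR_matrix_vector_assoc[symmetric])
    have "2 * ((W' *v x) \<bullet> (S *v x)) = x \<bullet> ((W ** S + transpose S ** W) *v x)" for x
    proof -
      have "2 * ((W' *v x) \<bullet> (S *v x)) = (2 *\<^sub>R (W' *v x)) \<bullet> (S *v x)" by simp
      also have "\<dots> = x \<bullet> ((W ** S + transpose S ** W) *v x)"
      proof -
        have "(transpose W *v x) \<bullet> (S *v x) = x \<bullet> ((W ** S) *v x)"
          unfolding matrix_vector_mul_assoc[symmetric] by (metis inner_commute inner_transpose_mult)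
        moreover have "(W *v x) \<bullet> (S *v x) = x \<bullet> ((transpose S ** W) *v x)"
          unfolding matrix_vector_mul_assoc[symmetric] inner_transpose_mult by (rule inner_commute)
        ultimately show ?thesis
          unfolding W'x by (simp add: inner_add_left inner_add_right matrix_vector_mult_add_rdistrib)
      qed
      finally show ?thesis .
    qed
    then have "2 * ((W' *v x) \<bullet> (S *v x)) < x \<bullet> (G *v x)" if "x \<noteq> 0" for x
      using R(1) that unfolding P_def R1 by (simp add: matrix_vector_mult_diff_rdistrib inner_diff_right)
    moreover have "x \<bullet> (W' *v x) = x \<bullet> (W *v x)" for x
    proof -
      have "2 * (x \<bullet> (W' *v x)) = x \<bullet> (2 *\<^sub>R (W' *v x))" by simp
      also have "\<dots> = 2 * (x \<bullet> (W *v x))"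
        unfolding W'x by (simp add: inner_add_right inner_transpose_mult inner_commute)
      finally show ?thesis by simp
    qed
    then have "K * (x \<bullet> x) < c * (x \<bullet> (W' *v x))" if "x \<noteq> 0" for x
      using R(2) that unfolding P_def R2
      by (simp add: matrix_vector_mult_diff_rdistrib inner_diff_right scaleR_matrix_vector_assoc[symmetric])
    ultimately show ?thesis by (rule primal)
  next
    case False
    from separating_hyperplane_set_0[OF \<open>convex \<S>\<close> this]
    obtain a where a: "a \<noteq> 0" "\<And>x. x \<in> \<S> \<Longrightarrow> 0 \<le> a \<bullet> x" by auto
    define Y where "Y = - fst a"
    define Z where "Z = - snd a"
    have main: "0 \<le> Y \<bullet> (W ** S + transpose S ** W) - c * (Z \<bullet> W) + Y \<bullet> R1 + Z \<bullet> R2 - Y \<bullet> G + K * (Z \<bullet> mat 1)"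
      if "R1 \<in> P" "R2 \<in> P" for W R1 R2
    proof -
      have "0 \<le> a \<bullet> ((G, - K *\<^sub>R mat 1) + \<Lambda> (W, R1, R2))"
        using that by (intro a(2)) (auto simp: \<S>_def)
      then show ?thesis
        by (simp add: \<Lambda>_def Y_def Z_def inner_prod_def inner_add_right inner_diff_right algebra_simps)
    qed
    have one: "mat 1 \<in> P" by (simp add: P_def)
    have scale: "t *\<^sub>R R \<in> P" if "t > 0" "R \<in> P" for t R
      using that by (simp add: P_def scaleR_matrix_vector_assoc[symmetric])
    have Ypos: "0 \<le> Y \<bullet> R" if "R \<in> P" for R
      using affine_nonneg(1)[of "Y \<bullet> R" "Z \<bullet> mat 1 - Y \<bullet> G + K * (Z \<bullet> mat 1)"]
        main[OF scale[OF _ that] one, of _ 0] by (simp add: algebra_simps)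
    have Zpos: "0 \<le> Z \<bullet> R" if "R \<in> P" for R
      using affine_nonneg(1)[of "Z \<bullet> R" "Y \<bullet> mat 1 - Y \<bullet> G + K * (Z \<bullet> mat 1)"]
        main[OF one scale[OF _ that], of _ 0] by (simp add: algebra_simps)
    \<comment> \<open>Adding a skew matrix, or a rank one matrix plus a small multiple of the identity, does not leave \<open>P\<close>; the first kills the skew part of the separating functional, the second makes it positive semidefinite.\<close>
    have sympsd: "transpose V = V \<and> (\<forall>x. 0 \<le> x \<bullet> (V *v x))" if V: "\<And>R. R \<in> P \<Longrightarrow> 0 \<le> V \<bullet> R" for V
    proof
      have "V \<bullet> (E - transpose E) = 0" for E
      proof -
        have "mat 1 + t *\<^sub>R (E - transpose E) \<in> P" for t
          by (simp add: P_def matrix_vector_mult_add_rdistrib matrix_vector_mult_diff_rdistrib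
              scaleR_matrix_vector_assoc[symmetric] inner_add_right inner_diff_right inner_transpose_mult inner_commute)
        from V[OF this] show ?thesis
          by (intro affine_zero[of _ "V \<bullet> mat 1"]) (simp add: inner_add_right add.commute)
      qed
      then have "(V - transpose V) \<bullet> E = 0" for E
        using inner_transpose_transpose[of V "transpose E"] by (simp add: inner_diff_left inner_diff_right)
      then show "transpose V = V" by (metis eq_iff_diff_eq_0 inner_eq_zero_iff)
      show "\<forall>x. 0 \<le> x \<bullet> (V *v x)"
      proof
        fix x
        have "outer x + t *\<^sub>R mat 1 \<in> P" if "t > 0" for t
          unfolding P_def
        proof clarify
          fix y :: "real ^ 'n"
          assume "y \<noteq> 0"
          then have "0 < (x \<bullet> y)\<^sup>2 + t * (y \<bullet> y)" using that by (intro add_nonneg_pos mult_pos_pos) auto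
          then show "0 < y \<bullet> ((outer x + t *\<^sub>R mat 1) *v y)"
            by (simp add: matrix_vector_mult_add_rdistrib scaleR_matrix_vector_assoc[symmetric]
              inner_add_right outer_form)
        qed
        from V[OF this] have "\<And>t. t > 0 \<Longrightarrow> 0 \<le> t * (V \<bullet> mat 1) + x \<bullet> (V *v x)"
          by (simp add: inner_add_right inner_outer add.commute)
        then show "0 \<le> x \<bullet> (V *v x)" by (rule affine_nonneg(2))
      qed
    qed
    have "(Y ** transpose S + S ** Y - c *\<^sub>R Z) \<bullet> W = 0" for W
    proof (rule affine_zero)
      fix t
      have "0 \<le> Y \<bullet> ((t *\<^sub>R W) ** S + transpose S ** (t *\<^sub>R W)) - c * (Z \<bullet> (t *\<^sub>R W)) + Y \<bullet> mat 1 + Z \<bullet> mat 1 - Y \<bullet> G + K * (Z \<bullet> mat 1)"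
        by (rule main[OF one one])
      moreover have "Y \<bullet> ((t *\<^sub>R W) ** S) = t * ((Y ** transpose S) \<bullet> W)"
        by (subst inner_matrix_mult_right) simp
      moreover have "Y \<bullet> (transpose S ** (t *\<^sub>R W)) = t * ((S ** Y) \<bullet> W)"
        by (subst inner_matrix_mult_left) simp
      ultimately show "0 \<le> t * ((Y ** transpose S + S ** Y - c *\<^sub>R Z) \<bullet> W) + (Y \<bullet> mat 1 + Z \<bullet> mat 1 - Y \<bullet> G + K * (Z \<bullet> mat 1))"
        by (simp add: inner_add_right inner_add_left inner_diff_left algebra_simps)
    qed
    then have "Y ** transpose S + S ** Y - c *\<^sub>R Z = 0" by (metis inner_eq_zero_iff)
    then have "S ** Y + Y ** transpose S = c *\<^sub>R Z" by (simp add: algebra_simps)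
    moreover have "Y \<bullet> G \<le> K * (Z \<bullet> mat 1)"
      using affine_nonneg(2)[of "Y \<bullet> mat 1 + Z \<bullet> mat 1" "- (Y \<bullet> G) + K * (Z \<bullet> mat 1)"]
        main[OF scale[OF _ one] scale[OF _ one], of _ _ 0] by (simp add: algebra_simps)
    moreover have "Y \<noteq> 0 \<or> Z \<noteq> 0" using a(1) by (auto simp: Y_def Z_def prod_eq_iff)
    ultimately show ?thesis
      by (rule_tac dual[of Y Z]) (use sympsd[OF Ypos] sympsd[OF Zpos] in auto)
  qed
qed


lemma trace_psd_zero:
  fixes Z :: "real ^ 'n ^ 'n"
  assumes "transpose Z = Z" "\<And>x. 0 \<le> x \<bullet> (Z *v x)"
  shows "0 \<le> Z \<bullet> mat 1" "Z \<bullet> mat 1 = 0 \<Longrightarrow> Z = 0"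
proof -
  have e: "axis i 1 \<bullet> (Z *v axis i 1) = Z $ i $ i" for i
    by (simp add: inner_axis' matrix_vector_mult_basis column_def)
  have tr: "Z \<bullet> mat 1 = (\<Sum>i\<in>UNIV. Z $ i $ i)"
    by (simp add: inner_vec_def mat_def if_distrib if_distribR cong: if_cong)
  have pos: "0 \<le> Z $ i $ i" for i using assms(2)[of "axis i 1"] unfolding e .
  show "0 \<le> Z \<bullet> mat 1" unfolding tr by (intro sum_nonneg pos)
  assume "Z \<bullet> mat 1 = 0"
  then have "Z $ i $ i = 0" for i
    unfolding tr using sum_nonneg_eq_0_iff[of UNIV "\<lambda>i. Z $ i $ i"] pos by simp
  then have "Z *v axis i 1 = 0" for i
    by (intro psd_null assms) (simp add: e)
  then have "column i Z = 0" for i by (simp add: matrix_vector_mult_basis)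
  then show "Z = 0" by (simp add: column_def vec_eq_iff)
qed

text \<open>
  On the kernel of \<open>Y\<close> the form of \<open>Z\<close> vanishes, hence so does \<open>Z\<close>, and the equation shows that the
  kernel is invariant.
\<close>

lemma kernel_psd_lyapunov:
  fixes S Y Z :: "real ^ 'n ^ 'n"
  assumes Y: "transpose Y = Y" and Z: "transpose Z = Z" "\<And>x. 0 \<le> x \<bullet> (Z *v x)"
    and eq: "S ** Y + Y ** transpose S = Z" and x: "Y *v x = 0"
  shows "Z *v x = 0" "Y *v (transpose S *v x) = 0"
proof -
  have Zx: "Z *v x = Y *v (transpose S *v x)"
    unfolding eq[symmetric] using x
    by (simp add: matrix_vector_mult_add_rdistrib matrix_vector_mul_assoc[symmetric])
  have "x \<bullet> (Z *v x) = (Y *v x) \<bullet> (transpose S *v x)"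
    unfolding Zx by (simp add: symmetric_inner[OF Y])
  then show "Z *v x = 0" using x by (intro psd_null Z) simp
  then show "Y *v (transpose S *v x) = 0" by (simp add: Zx)
qed

lemma lyapunov_rotation_form:
  fixes S Y Z :: "real ^ 'n ^ 'n"
  assumes Y: "transpose Y = Y" and eq: "S ** Y + Y ** transpose S = Z"
    and a: "Y *v (transpose S *v a) = Y *v (r *\<^sub>R a - t *\<^sub>R b)"
    and b: "Y *v (transpose S *v b) = Y *v (r *\<^sub>R b + t *\<^sub>R a)"
  shows "a \<bullet> (Z *v a) + b \<bullet> (Z *v b) = 2 * r * (a \<bullet> (Y *v a) + b \<bullet> (Y *v b))"
proof -
  have form: "x \<bullet> (Z *v x) = 2 * (x \<bullet> (Y *v (transpose S *v x)))" for x
  proof -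
    have "x \<bullet> (S *v (Y *v x)) = x \<bullet> (Y *v (transpose S *v x))"
      by (metis Y inner_transpose_mult symmetric_inner inner_commute)
    then show ?thesis unfolding eq[symmetric]
      by (simp add: matrix_vector_mult_add_rdistrib matrix_vector_mul_assoc[symmetric] inner_add_right)
  qed
  have "a \<bullet> (Y *v b) = b \<bullet> (Y *v a)" by (metis Y symmetric_inner inner_commute)
  then show ?thesis unfolding form a b
    by (simp add: matrix_vector_mult_diff_distrib matrix_vector_right_distrib matrix_vector_mult_scaleR
        inner_add_right inner_diff_right algebra_simps)
qed

lemma subspace_kernel: "subspace {x. Y *v x = 0}" for Y :: "real ^ 'n ^ 'm"
  by (auto simp: subspace_def matrix_vector_right_distrib matrix_vector_mult_scaleR)

text \<open>
  Modulo the kernel of \<open>Y\<close>, the matrix \<open>Y\<close> is an inner product for which the transpose of \<open>S\<close> has the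
  symmetric part \<open>Z / 2\<close>. An eigenvector of the induced map therefore has an eigenvalue with nonnegative
  real part, and with zero real part only if \<open>Z\<close> vanishes on it.
\<close>

lemma psd_lyapunov_eigenvector:
  fixes S Y Z :: "real ^ 'n ^ 'n"
  assumes Y: "transpose Y = Y" "\<And>x. 0 \<le> x \<bullet> (Y *v x)"
    and Z: "transpose Z = Z" "\<And>x. 0 \<le> x \<bullet> (Z *v x)"
    and eq: "S ** Y + Y ** transpose S = Z" and V: "subspace V" "\<And>x. x \<in> V \<Longrightarrow> transpose S *v x \<in> V"
    and nz: "\<not> V \<subseteq> {x. Y *v x = 0}"
  obtains a b l where "a \<in> V" "b \<in> V" "Y *v a \<noteq> 0 \<or> Y *v b \<noteq> 0"
    "Y *v (transpose S *v a) = Y *v (Re l *\<^sub>R a - Im l *\<^sub>R b)"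
    "Y *v (transpose S *v b) = Y *v (Re l *\<^sub>R b + Im l *\<^sub>R a)"
    "complex_eigenvalue (complex_matrix S) l"
    "a \<bullet> (Z *v a) + b \<bullet> (Z *v b) = 2 * Re l * (a \<bullet> (Y *v a) + b \<bullet> (Y *v b))"
    "0 < a \<bullet> (Y *v a) + b \<bullet> (Y *v b)" "0 \<le> Re l"
proof -
  let ?K = "{x. Y *v x = 0}"
  have inv: "transpose S *v x \<in> ?K" if "x \<in> ?K" for x
    using kernel_psd_lyapunov(2)[OF Y(1) Z eq] that by simp
  obtain a b l where abl: "a \<in> V" "b \<in> V" "a \<notin> ?K \<or> b \<notin> ?K"
    "transpose S *v a - (Re l *\<^sub>R a - Im l *\<^sub>R b) \<in> ?K"
    "transpose S *v b - (Re l *\<^sub>R b + Im l *\<^sub>R a) \<in> ?K"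
    "complex_eigenvalue (complex_matrix (transpose S)) l"
    by (rule quotient_eigenvector[OF V(1) V(2) subspace_kernel[of Y] inv nz])
  have e: "Y *v (transpose S *v a) = Y *v (Re l *\<^sub>R a - Im l *\<^sub>R b)"
    "Y *v (transpose S *v b) = Y *v (Re l *\<^sub>R b + Im l *\<^sub>R a)"
    using abl(4,5) by (simp_all add: matrix_vector_mult_diff_distrib)
  have f: "a \<bullet> (Z *v a) + b \<bullet> (Z *v b) = 2 * Re l * (a \<bullet> (Y *v a) + b \<bullet> (Y *v b))"
    by (rule lyapunov_rotation_form[OF Y(1) eq e])
  have "a \<bullet> (Y *v a) \<noteq> 0 \<or> b \<bullet> (Y *v b) \<noteq> 0" using abl(3) psd_null[OF Y] by auto
  then have pos: "0 < a \<bullet> (Y *v a) + b \<bullet> (Y *v b)"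
    using Y(2)[of a] Y(2)[of b] by linarith
  have "0 \<le> 2 * Re l * (a \<bullet> (Y *v a) + b \<bullet> (Y *v b))"
    unfolding f[symmetric] using Z(2)[of a] Z(2)[of b] by linarith
  then have "0 \<le> Re l" using pos by (simp add: zero_le_mult_iff)
  then show ?thesis
    using that[of a b l] abl e f pos by (simp add: complex_eigenvalue_transpose)
qed

definition hurwitz :: "real ^ 'n ^ 'n \<Rightarrow> bool" where
  "hurwitz J \<longleftrightarrow> (\<forall>l. complex_eigenvalue (complex_matrix J) l \<longrightarrow> Re l < 0)"

lemma not_UNIV_subset_kernel: "Y \<noteq> 0 \<Longrightarrow> \<not> UNIV \<subseteq> {x. Y *v x = 0}" for Y :: "real ^ 'n ^ 'm"
  using matrix_eq[of Y 0] by auto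

text \<open>
  Lyapunov's theorem. In the dual alternative the eigenvector lemma would produce an eigenvalue with
  nonnegative real part.
\<close>

lemma hurwitz_lyapunov:
  fixes J :: "real ^ 'n ^ 'n"
  assumes "hurwitz J"
  obtains M m c where "transpose M = M" "m > 0" "c > 0"
    "\<And>x. m * (x \<bullet> x) \<le> x \<bullet> (M *v x)" "\<And>x. 2 * ((M *v x) \<bullet> (J *v x)) \<le> - c * (x \<bullet> x)"
proof (cases rule: lmi_duality[where S = J and G = 0 and c = 1 and K = 0])
  case (primal W)
  obtain m where m: "m > 0" "\<And>x. m * (x \<bullet> x) \<le> x \<bullet> (W *v x)"
    using quadratic_form_lower_bound[of W] primal(3) by auto
  have f: "x \<bullet> ((- 2 *\<^sub>R (W ** J)) *v x) = - 2 * ((W *v x) \<bullet> (J *v x))" for x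
  proof -
    have "(- 2 *\<^sub>R (W ** J)) *v x = - 2 *\<^sub>R (W *v (J *v x))"
      unfolding scaleR_matrix_vector_assoc[symmetric] matrix_vector_mul_assoc[symmetric] ..
    then show ?thesis by (simp add: symmetric_inner[OF primal(1)])
  qed
  obtain c where c: "c > 0" "\<And>x. c * (x \<bullet> x) \<le> x \<bullet> ((- 2 *\<^sub>R (W ** J)) *v x)"
    by (rule quadratic_form_lower_bound[of "- 2 *\<^sub>R (W ** J)"]) (use primal(2) f in auto)
  show ?thesis
  proof (rule that[OF primal(1) m(1) c(1) m(2)])
    show "2 * ((W *v x) \<bullet> (J *v x)) \<le> - c * (x \<bullet> x)" for x using c(2)[of x] f[of x] by simp
  qed
next
  case (dual Y Z)
  then have "Y \<noteq> 0" by auto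
  then obtain l where "complex_eigenvalue (complex_matrix J) l" "0 \<le> Re l"
    using psd_lyapunov_eigenvector[OF dual(1,3,2,4) dual(5)[unfolded scaleR_one] subspace_UNIV UNIV_I
        not_UNIV_subset_kernel[of Y]] by blast
  then show ?thesis using assms by (auto simp: hurwitz_def)
qed

text \<open>
  The Sylvester operator is injective, since the kernel of a solution of the homogeneous equation would
  yield a common eigenvalue of \<open>J\<close> and \<open>S\<close>; by equality of dimensions it is surjective.
\<close>

lemma sylvester_solution:
  fixes J :: "real ^ 'k ^ 'k" and S :: "real ^ 'p ^ 'p" and E :: "real ^ 'p ^ 'k"
  assumes "hurwitz J" and S: "\<And>l. complex_eigenvalue (complex_matrix S) l \<Longrightarrow> 0 \<le> Re l"
  obtains X where "X ** S - J ** X = E"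
proof -
  have lin: "linear (\<lambda>X :: real ^ 'p ^ 'k. X ** S - J ** X)"
  proof -
    have "(r *\<^sub>R X) ** S = r *\<^sub>R (X ** S)" "J ** (r *\<^sub>R X) = r *\<^sub>R (J ** X)"
      "(X + X') ** S = X ** S + X' ** S" for r and X X' :: "real ^ 'p ^ 'k"
      by (simp_all add: vec_eq_iff matrix_matrix_mult_def sum_distrib_left sum.distrib algebra_simps)
    then show ?thesis by (intro linearI) (simp_all add: matrix_add_ldistrib scaleR_diff_right)
  qed
  have "X = 0" if X: "X ** S - J ** X = 0" for X :: "real ^ 'p ^ 'k"
  proof (rule ccontr)
    assume "X \<noteq> 0"
    have XS: "X *v (S *v x) = J *v (X *v x)" for x
      using X by (simp add: matrix_vector_mul_assoc)
    obtain a b l where abl: "a \<notin> {x. X *v x = 0} \<or> b \<notin> {x. X *v x = 0}"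
      "S *v a - (Re l *\<^sub>R a - Im l *\<^sub>R b) \<in> {x. X *v x = 0}"
      "S *v b - (Re l *\<^sub>R b + Im l *\<^sub>R a) \<in> {x. X *v x = 0}"
      "complex_eigenvalue (complex_matrix S) l"
      by (rule quotient_eigenvector[OF subspace_UNIV UNIV_I subspace_kernel[of X] _
            not_UNIV_subset_kernel[OF \<open>X \<noteq> 0\<close>]]) (auto simp: XS)
    then have "complex_eigenvalue (complex_matrix J) l"
      unfolding complex_eigenvalue_real
      by (intro exI[of _ "X *v a"] exI[of _ "X *v b"])
         (auto simp: matrix_vector_mult_diff_distrib matrix_vector_right_distrib
           matrix_vector_mult_scaleR XS)
    then show False using assms(1) S[OF abl(4)] by (force simp: hurwitz_def)
  qed
  then have "inj (\<lambda>X :: real ^ 'p ^ 'k. X ** S - J ** X)"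
    using linear_injective_0[OF lin] by blast
  then have "surj (\<lambda>X :: real ^ 'p ^ 'k. X ** S - J ** X)"
    by (rule linear_injective_imp_surjective[OF lin _ refl])
  then obtain X where "E = X ** S - J ** X" by (rule surjE)
  then show ?thesis using that by simp
qed


lemma orthogonal_psd_subspace_full:
  fixes Y :: "real ^ 'n ^ 'n"
  assumes Y: "transpose Y = Y" and V: "subspace V" "{x. Y *v x = 0} \<subseteq> V"
    and perp: "{x. \<forall>k\<in>V. k \<bullet> (Y *v x) = 0} \<subseteq> {x. Y *v x = 0}"
  shows "V = UNIV"
proof -
  have sub: "subspace ((*v) Y ` V)" using V(1) by (intro linear_subspace_image) auto
  have "x \<in> V" for x
  proof -
    have "Y *v x \<in> orthogonal_comp (orthogonal_comp ((*v) Y ` V))"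
      unfolding orthogonal_comp_def orthogonal_def
    proof clarify
      fix y assume y: "\<forall>z\<in>(*v) Y ` V. z \<bullet> y = 0"
      have "k \<bullet> (Y *v y) = 0" if "k \<in> V" for k
        using y that by (metis Y imageI symmetric_inner)
      then have "Y *v y = 0" using perp by auto
      then show "y \<bullet> (Y *v x) = 0" by (simp add: symmetric_inner[OF Y, symmetric])
    qed
    then obtain k where k: "k \<in> V" "Y *v x = Y *v k"
      unfolding orthogonal_comp_self[OF sub] by auto
    then have "x - k \<in> V" using V(2) by (auto simp: matrix_vector_mult_diff_distrib)
    then show "x \<in> V" using k(1) V(1) by (metis diff_add_cancel subspace_add)
  qed
  then show ?thesis by auto
qed

text \<open>
  If no eigenvalue has positive real part, a semidefinite form \<open>Y\<close> that is nondecreasing along the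
  transposed flow is constant: the trace of the induced map, which is the sum of its eigenvalues, would
  otherwise be positive. The proof replaces the trace by a splitting into invariant subspaces that are
  orthogonal with respect to \<open>Y\<close>.
\<close>

lemma dissipation_zero:
  fixes S Y Z :: "real ^ 'n ^ 'n"
  assumes Y: "transpose Y = Y" "\<And>x. 0 \<le> x \<bullet> (Y *v x)"
    and Z: "transpose Z = Z" "\<And>x. 0 \<le> x \<bullet> (Z *v x)"
    and eq: "S ** Y + Y ** transpose S = Z"
    and S: "\<And>l. complex_eigenvalue (complex_matrix S) l \<Longrightarrow> Re l \<le> 0"
  shows "Z = 0"
proof -
  let ?T = "transpose S"
  \<comment> \<open>The largest invariant subspace in the kernel of \<open>Z\<close> and its complement with respect to \<open>Y\<close>, which is again invariant.\<close>
  define N where "N = {x. \<forall>k. Z *v (((*v) ?T ^^ k) x) = 0}"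
  define Np where "Np = {x. \<forall>k\<in>N. k \<bullet> (Y *v x) = 0}"
  have it_add: "((*v) ?T ^^ k) (x + y) = ((*v) ?T ^^ k) x + ((*v) ?T ^^ k) y"
    and it_scale: "((*v) ?T ^^ k) (c *\<^sub>R x) = c *\<^sub>R ((*v) ?T ^^ k) x" for k x y c
    by (induction k) (simp_all add: matrix_vector_right_distrib matrix_vector_mult_scaleR)
  have it0: "((*v) ?T ^^ k) 0 = 0" for k using it_scale[of k 0 0] by simp
  have N: "subspace N"
    by (auto simp: subspace_def N_def it_add it_scale it0 matrix_vector_right_distrib matrix_vector_mult_scaleR)
  have NT: "?T *v x \<in> N" if "x \<in> N" for x
    using that unfolding N_def by (auto simp: funpow_swap1 dest: spec[of _ "Suc _"])
  have NZ: "Z *v x = 0" if "x \<in> N" for x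
    using that unfolding N_def by (auto dest: spec[of _ 0])
  have ker: "Y *v (((*v) ?T ^^ k) x) = 0" if "Y *v x = 0" for k x
    using that by (induction k) (auto intro: kernel_psd_lyapunov(2)[OF Y(1) Z eq])
  have kerN: "{x. Y *v x = 0} \<subseteq> N"
    using kernel_psd_lyapunov(1)[OF Y(1) Z eq ker] by (auto simp: N_def)
  have Np: "subspace Np"
    by (auto simp: subspace_def Np_def matrix_vector_right_distrib matrix_vector_mult_scaleR inner_add_right)
  have NpT: "?T *v x \<in> Np" if x: "x \<in> Np" for x
    unfolding Np_def
  proof clarify
    fix k assume k: "k \<in> N"
    have "k \<bullet> (Z *v x) = k \<bullet> (S *v (Y *v x)) + k \<bullet> (Y *v (?T *v x))"
      unfolding eq[symmetric]
      by (simp add: matrix_vector_mult_add_rdistrib matrix_vector_mul_assoc[symmetric] inner_add_right)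
    moreover have "k \<bullet> (Z *v x) = 0" using NZ[OF k] by (metis Z(1) symmetric_inner inner_zero_left)
    moreover have "k \<bullet> (S *v (Y *v x)) = (?T *v k) \<bullet> (Y *v x)"
      by (metis inner_commute inner_transpose_mult)
    moreover have "(?T *v k) \<bullet> (Y *v x) = 0" using x NT[OF k] by (simp add: Np_def)
    ultimately show "k \<bullet> (Y *v (?T *v x)) = 0" by simp
  qed
  have "Np \<subseteq> {x. Y *v x = 0}"
  proof (rule ccontr)
    assume "\<not> Np \<subseteq> {x. Y *v x = 0}"
    from psd_lyapunov_eigenvector[OF Y Z eq Np NpT this]
    obtain a b l where ab: "a \<in> Np" "b \<in> Np" "Y *v a \<noteq> 0 \<or> Y *v b \<noteq> 0"
      and e: "Y *v (?T *v a) = Y *v (Re l *\<^sub>R a - Im l *\<^sub>R b)"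
        "Y *v (?T *v b) = Y *v (Re l *\<^sub>R b + Im l *\<^sub>R a)"
      and l: "complex_eigenvalue (complex_matrix S) l"
      and form: "a \<bullet> (Z *v a) + b \<bullet> (Z *v b) = 2 * Re l * (a \<bullet> (Y *v a) + b \<bullet> (Y *v b))"
      and "0 < a \<bullet> (Y *v a) + b \<bullet> (Y *v b)" "0 \<le> Re l"
      by metis
    then have "Re l = 0" using S[OF l] by simp
    then have "a \<bullet> (Z *v a) = 0" "b \<bullet> (Z *v b) = 0"
      using form Z(2)[of a] Z(2)[of b] by auto
    then have Zab: "Z *v a = 0" "Z *v b = 0" by (auto intro: psd_null[OF Z])
    \<comment> \<open>The plane of the eigenvector modulo the kernel of \<open>Y\<close> is invariant and killed by \<open>Z\<close>, so it lies in \<open>N\<close> as well as in its complement.\<close>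
    define U where "U = {x. \<exists>p q. Y *v x = Y *v (p *\<^sub>R a + q *\<^sub>R b)}"
    have UT: "?T *v x \<in> U" if "x \<in> U" for x
    proof -
      obtain p q where pq: "Y *v x = Y *v (p *\<^sub>R a + q *\<^sub>R b)" using \<open>x \<in> U\<close> by (auto simp: U_def)
      have "Y *v (x - (p *\<^sub>R a + q *\<^sub>R b)) = 0" by (simp add: matrix_vector_mult_diff_distrib pq)
      from kernel_psd_lyapunov(2)[OF Y(1) Z eq this]
      have "Y *v (?T *v x) = p *\<^sub>R (Y *v (?T *v a)) + q *\<^sub>R (Y *v (?T *v b))"
        by (simp add: matrix_vector_mult_diff_distrib matrix_vector_right_distrib matrix_vector_mult_scaleR)
      also have "\<dots> = Y *v ((p * Re l + q * Im l) *\<^sub>R a + (q * Re l - p * Im l) *\<^sub>R b)"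
        unfolding e by (simp add: matrix_vector_mult_diff_distrib matrix_vector_right_distrib
          matrix_vector_mult_scaleR algebra_simps)
      finally show ?thesis unfolding U_def by blast
    qed
    have UZ: "Z *v x = 0" if "x \<in> U" for x
    proof -
      obtain p q where pq: "Y *v x = Y *v (p *\<^sub>R a + q *\<^sub>R b)" using \<open>x \<in> U\<close> by (auto simp: U_def)
      have "Y *v (x - (p *\<^sub>R a + q *\<^sub>R b)) = 0" by (simp add: matrix_vector_mult_diff_distrib pq)
      from kernel_psd_lyapunov(1)[OF Y(1) Z eq this] show ?thesis
        by (simp add: matrix_vector_mult_diff_distrib matrix_vector_right_distrib
          matrix_vector_mult_scaleR Zab)
    qed
    have itU: "((*v) ?T ^^ k) x \<in> U" if "x \<in> U" for k x
      using that by (induction k) (auto intro: UT)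
    have "Y *v a = Y *v (1 *\<^sub>R a + 0 *\<^sub>R b)" "Y *v b = Y *v (0 *\<^sub>R a + 1 *\<^sub>R b)" by simp_all
    then have "a \<in> U" "b \<in> U" unfolding U_def by blast+
    then have "a \<in> N" "b \<in> N" unfolding N_def using itU UZ by blast+
    then have "a \<bullet> (Y *v a) = 0" "b \<bullet> (Y *v b) = 0" using ab by (auto simp: Np_def)
    then show False using ab(3) psd_null[OF Y] by blast
  qed
  then have "N = UNIV"
    unfolding Np_def by (intro orthogonal_psd_subspace_full[OF Y(1) N kerN])
  then have "Z *v x = 0 *v x" for x using NZ by simp
  then show "Z = 0" by (simp add: matrix_eq)
qed

text \<open>
  An arbitrarily large Lyapunov form whose growth is paid for by the output \<open>d x\<close>. Its inverse provides
  an arbitrarily small stabilizing output injection, which exists because the spectrum is imaginary.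
  In the dual alternative \<open>Z = 0\<close>, so the range of \<open>Y\<close> is invariant and unobservable.
\<close>

lemma low_gain_lyapunov:
  fixes S :: "real ^ 'p ^ 'p" and d :: "real ^ 'p" and K :: real
  assumes S: "\<And>l. complex_eigenvalue (complex_matrix S) l \<Longrightarrow> Re l = 0"
    and obs: "\<And>a b r t. S *v a = r *\<^sub>R a - t *\<^sub>R b \<Longrightarrow> S *v b = r *\<^sub>R b + t *\<^sub>R a \<Longrightarrow>
      d \<bullet> a = 0 \<Longrightarrow> d \<bullet> b = 0 \<Longrightarrow> a = 0 \<and> b = 0"
  obtains W c where "transpose W = W" "c > 0" "\<And>x. K * (x \<bullet> x) \<le> x \<bullet> (W *v x)"
    "\<And>x. 2 * ((W *v x) \<bullet> (S *v x)) \<le> (d \<bullet> x)\<^sup>2 - c * (x \<bullet> x)"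
proof (cases rule: lmi_duality[where S = S and G = "outer d" and c = 1 and K = K])
  case (primal W)
  have f: "x \<bullet> ((outer d - 2 *\<^sub>R (W ** S)) *v x) = (d \<bullet> x)\<^sup>2 - 2 * ((W *v x) \<bullet> (S *v x))" for x
    by (simp add: matrix_vector_mult_diff_rdistrib scaleR_matrix_vector_assoc[symmetric]
        matrix_vector_mul_assoc[symmetric] symmetric_inner[OF primal(1)] inner_diff_right outer_form)
  obtain c where c: "c > 0" "\<And>x. c * (x \<bullet> x) \<le> x \<bullet> ((outer d - 2 *\<^sub>R (W ** S)) *v x)"
    by (rule quadratic_form_lower_bound[of "outer d - 2 *\<^sub>R (W ** S)"])
       (use primal(2) f in \<open>auto simp: outer_form\<close>)
  show ?thesis
  proof (rule that[OF primal(1) c(1)])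
    show "K * (x \<bullet> x) \<le> x \<bullet> (W *v x)" for x using primal(3)[of x] by (cases "x = 0") auto
    show "2 * ((W *v x) \<bullet> (S *v x)) \<le> (d \<bullet> x)\<^sup>2 - c * (x \<bullet> x)" for x
      using c(2)[of x] f[of x] by simp
  qed
next
  case (dual Y Z)
  note eq = dual(5)[unfolded scaleR_one]
  have Z0: "Z = 0" using dissipation_zero[OF dual(1,3,2,4) eq] S by force
  then have "Y \<noteq> 0" using dual(7) by simp
  have "d \<bullet> (Y *v d) = 0" using dual(6) dual(3)[of d] by (simp add: Z0 inner_outer)
  then have Yd: "Y *v d = 0" by (rule psd_null[OF dual(1,3)])
  have eq0: "S *v (Y *v x) = - (Y *v (transpose S *v x))" for x
  proof -
    have "(S ** Y + Y ** transpose S) *v x = 0" unfolding eq Z0 by simp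
    then show ?thesis
      by (simp add: matrix_vector_mult_add_rdistrib matrix_vector_mul_assoc[symmetric] eq_neg_iff_add_eq_0)
  qed
  obtain a b l where ab: "Y *v a \<noteq> 0 \<or> Y *v b \<noteq> 0"
    and e: "Y *v (transpose S *v a) = Y *v (Re l *\<^sub>R a - Im l *\<^sub>R b)"
      "Y *v (transpose S *v b) = Y *v (Re l *\<^sub>R b + Im l *\<^sub>R a)"
    using psd_lyapunov_eigenvector[OF dual(1,3,2,4) eq subspace_UNIV UNIV_I
        not_UNIV_subset_kernel[OF \<open>Y \<noteq> 0\<close>]] by metis
  have "d \<bullet> (Y *v x) = 0" for x using Yd by (metis dual(1) symmetric_inner inner_zero_left)
  moreover have "S *v (Y *v a) = (- Re l) *\<^sub>R (Y *v a) - (- Im l) *\<^sub>R (Y *v b)"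
    "S *v (Y *v b) = (- Re l) *\<^sub>R (Y *v b) + (- Im l) *\<^sub>R (Y *v a)"
    unfolding eq0 e by (simp_all add: matrix_vector_mult_diff_distrib matrix_vector_right_distrib
          matrix_vector_mult_scaleR)
  ultimately have "Y *v a = 0 \<and> Y *v b = 0" by (intro obs)
  then show ?thesis using ab by simp
qed

text \<open>
  A form that is positive in some direction and decays along the linear flow in all directions. Such
  a form exists next to eigenvalues of either sign, and is the form of Chetaev's instability criterion.
\<close>

lemma saddle_lyapunov:
  fixes S :: "real ^ 'n ^ 'n"
  assumes l0: "complex_eigenvalue (complex_matrix S) l0" "Re l0 < 0"
  obtains H s c x0 where "transpose H = H" "s > 0" "c > 0" "0 < x0 \<bullet> (H *v x0)"
    "\<And>x. 2 * ((H *v x) \<bullet> (S *v x)) + s * (x \<bullet> (H *v x)) \<le> - c * (x \<bullet> x)"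
proof -
  \<comment> \<open>A shift by \<open>r\<close> that keeps the given eigenvalue in the open left half plane and moves no eigenvalue onto the imaginary axis.\<close>
  have "infinite {0<..<- Re l0}" using l0(2) by simp
  moreover have "finite ((\<lambda>l. - Re l) ` {l. complex_eigenvalue (complex_matrix S) l})"
    by (intro finite_imageI finite_complex_eigenvalues)
  ultimately obtain r where r: "0 < r" "r < - Re l0"
    "r \<notin> (\<lambda>l. - Re l) ` {l. complex_eigenvalue (complex_matrix S) l}"
    by (metis finite_subset greaterThanLessThan_iff subsetI)
  define T where "T = S + mat r"
  have Tx: "T *v x = S *v x + r *\<^sub>R x" for x
    by (simp add: T_def matrix_vector_mult_add_rdistrib mat_vector_mult scalar_mult_eq_scaleR)
  have T: "Re l \<noteq> 0" if "complex_eigenvalue (complex_matrix T) l" for l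
    using that r(3) unfolding T_def complex_eigenvalue_shift by force
  show ?thesis
  proof (cases rule: lmi_duality[where S = T and G = 0 and c = 0 and K = "-1"])
    case (primal H)
    have f: "x \<bullet> ((- (H ** T)) *v x) = - ((H *v x) \<bullet> (T *v x))" for x
    proof -
      have "(- (H ** T)) *v x = - (H *v (T *v x))"
        using matrix_vector_mult_diff_rdistrib[of 0 "H ** T" x] by (simp add: matrix_vector_mul_assoc)
      then show ?thesis by (simp add: symmetric_inner[OF primal(1)])
    qed
    obtain c where c: "c > 0" "\<And>x. c * (x \<bullet> x) \<le> x \<bullet> ((- (H ** T)) *v x)"
      by (rule quadratic_form_lower_bound[of "- (H ** T)"]) (use primal(2) f in auto)
    have dec: "2 * ((H *v x) \<bullet> (S *v x)) + (2 * r) * (x \<bullet> (H *v x)) \<le> - (2 * c) * (x \<bullet> x)" for x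
      using c(2)[of x] f[of x] by (simp add: Tx inner_add_right inner_commute algebra_simps)
    obtain a b where ab: "a \<noteq> 0 \<or> b \<noteq> 0" "S *v a = Re l0 *\<^sub>R a - Im l0 *\<^sub>R b"
      "S *v b = Re l0 *\<^sub>R b + Im l0 *\<^sub>R a" using l0(1) unfolding complex_eigenvalue_real by auto
    have sym: "(H *v b) \<bullet> a = (H *v a) \<bullet> b" by (metis inner_commute primal(1) symmetric_inner)
    have "(H *v a) \<bullet> (T *v a) + (H *v b) \<bullet> (T *v b) = (Re l0 + r) * (a \<bullet> (H *v a) + b \<bullet> (H *v b))"
      unfolding Tx ab(2,3)
      by (simp add: inner_add_right inner_diff_right sym inner_commute[of a] inner_commute[of b] algebra_simps)
    moreover have "(H *v a) \<bullet> (T *v a) + (H *v b) \<bullet> (T *v b) < 0"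
    proof -
      have "0 < c * (a \<bullet> a) + c * (b \<bullet> b)"
      proof (cases "a = 0")
        case False
        then have "0 < c * (a \<bullet> a)" "0 \<le> c * (b \<bullet> b)" using c(1) by simp_all
        then show ?thesis by linarith
      qed (use ab(1) c(1) in auto)
      then show ?thesis using c(2)[of a] f[of a] c(2)[of b] f[of b] by linarith
    qed
    ultimately have "0 < a \<bullet> (H *v a) + b \<bullet> (H *v b)"
      using r(2) by (auto simp: mult_less_0_iff)
    then obtain x0 where x0: "0 < x0 \<bullet> (H *v x0)" by (metis add_nonpos_nonpos not_le)
    show ?thesis by (rule that[OF primal(1) _ _ x0 dec]) (use r c in auto)
  next
    case (dual Y Z)
    have "Z = 0" using dual(6) trace_psd_zero[OF dual(2,4)] by simp
    then have "Y \<noteq> 0" using dual(7) by simp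
    have eq: "T ** Y + Y ** transpose T = 0" using dual(5) by simp
    obtain a b l where "complex_eigenvalue (complex_matrix T) l"
       "a \<bullet> (0 *v a) + b \<bullet> (0 *v b) = 2 * Re l * (a \<bullet> (Y *v a) + b \<bullet> (Y *v b))"
       "0 < a \<bullet> (Y *v a) + b \<bullet> (Y *v b)"
      using psd_lyapunov_eigenvector[OF dual(1,3) _ _ eq subspace_UNIV UNIV_I
          not_UNIV_subset_kernel[OF \<open>Y \<noteq> 0\<close>]]
      by (metis (no_types, lifting) \<open>Z = 0\<close> dual(2) dual(4))
    then show ?thesis using T by simp
  qed
qed

section \<open>Strict derivatives\<close>

text \<open>
  Continuously differentiable maps have derivatives in this strict sense, and the notion is closed under
  composition. It gives at once local Lipschitz bounds and the bound on differences of remainders that the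
  perturbation arguments need.
\<close>

definition strict_derivative ::
  "('a::real_normed_vector \<Rightarrow> 'b::real_normed_vector) \<Rightarrow> ('a \<Rightarrow> 'b) \<Rightarrow> 'a \<Rightarrow> bool" where
  "strict_derivative F D a \<longleftrightarrow> bounded_linear D \<and>
    (\<forall>k>0. \<exists>r>0. \<forall>y\<in>ball a r. \<forall>z\<in>ball a r. norm (F y - F z - D (y - z)) \<le> k * norm (y - z))"

lemma strict_derivativeE:
  assumes "strict_derivative F D a" "k > 0"
  obtains r where "r > 0"
    "\<And>y z. y \<in> ball a r \<Longrightarrow> z \<in> ball a r \<Longrightarrow> norm (F y - F z - D (y - z)) \<le> k * norm (y - z)"
  using assms unfolding strict_derivative_def by metis

lemma strict_derivative_linear: "strict_derivative F D a \<Longrightarrow> bounded_linear D"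
  by (simp add: strict_derivative_def)

lemma strict_derivative_lipschitz:
  assumes "strict_derivative F D a"
  obtains r L where "r > 0" "L > 0"
    "\<And>y z. y \<in> ball a r \<Longrightarrow> z \<in> ball a r \<Longrightarrow> norm (F y - F z) \<le> L * norm (y - z)"
proof -
  obtain r where r: "r > 0"
    "\<And>y z. y \<in> ball a r \<Longrightarrow> z \<in> ball a r \<Longrightarrow> norm (F y - F z - D (y - z)) \<le> 1 * norm (y - z)"
    by (rule strict_derivativeE[OF assms zero_less_one]) blast
  obtain K where K: "K > 0" "\<And>x. norm (D x) \<le> norm x * K"
    using bounded_linear.pos_bounded[OF strict_derivative_linear[OF assms]] by auto
  show ?thesis
  proof (rule that[OF r(1), of "1 + K"])
    fix y z assume yz: "y \<in> ball a r" "z \<in> ball a r"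
    have "norm (F y - F z) \<le> norm (F y - F z - D (y - z)) + norm (D (y - z))"
      by (metis diff_add_cancel norm_triangle_ineq)
    then show "norm (F y - F z) \<le> (1 + K) * norm (y - z)"
      using r(2)[OF yz] K(2)[of "y - z"] by (simp add: algebra_simps)
  qed (use K in auto)
qed

lemma strict_derivative_has_derivative:
  assumes "strict_derivative F D a"
  shows "(F has_derivative D) (at a)"
  unfolding has_derivative_at_alt
proof (intro conjI allI impI)
  show "bounded_linear D" by (rule strict_derivative_linear[OF assms])
  fix e :: real assume "0 < e"
  then obtain r where r: "r > 0"
    "\<And>y z. y \<in> ball a r \<Longrightarrow> z \<in> ball a r \<Longrightarrow> norm (F y - F z - D (y - z)) \<le> e * norm (y - z)"
    by (rule strict_derivativeE[OF assms]) blast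
  then show "\<exists>d>0. \<forall>y. norm (y - a) < d \<longrightarrow> norm (F y - F a - D (y - a)) \<le> e * norm (y - a)"
    by (intro exI[of _ r]) (auto simp: dist_norm norm_minus_commute)
qed

lemma strict_derivative_bounded_linear:
  "bounded_linear D \<Longrightarrow> strict_derivative D D a"
  unfolding strict_derivative_def
  by (auto simp: bounded_linear.linear linear_diff intro!: exI[of _ 1])

lemma strict_derivative_compose:
  assumes F: "strict_derivative F D a" and G: "strict_derivative G E (F a)"
  shows "strict_derivative (\<lambda>x. G (F x)) (\<lambda>x. E (D x)) a"
  unfolding strict_derivative_def
proof (intro conjI allI impI)
  show "bounded_linear (\<lambda>x. E (D x))"
    by (rule bounded_linear_compose[OF strict_derivative_linear[OF G] strict_derivative_linear[OF F]])
  fix k :: real assume k: "k > 0"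
  obtain r1 L where r1: "r1 > 0" and L: "L > 0"
    and lip: "\<And>y z. y \<in> ball a r1 \<Longrightarrow> z \<in> ball a r1 \<Longrightarrow> norm (F y - F z) \<le> L * norm (y - z)"
    by (rule strict_derivative_lipschitz[OF F]) blast
  obtain M where M: "M > 0" "\<And>x. norm (E x) \<le> norm x * M"
    using bounded_linear.pos_bounded[OF strict_derivative_linear[OF G]] by auto
  obtain r2 where r2: "r2 > 0" and G': "\<And>y z. y \<in> ball (F a) r2 \<Longrightarrow> z \<in> ball (F a) r2 \<Longrightarrow>
      norm (G y - G z - E (y - z)) \<le> k / (2 * L) * norm (y - z)"
    by (rule strict_derivativeE[OF G, of "k / (2 * L)"]) (use k L in auto)
  obtain r3 where r3: "r3 > 0" and F': "\<And>y z. y \<in> ball a r3 \<Longrightarrow> z \<in> ball a r3 \<Longrightarrow>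
      norm (F y - F z - D (y - z)) \<le> k / (2 * M) * norm (y - z)"
    by (rule strict_derivativeE[OF F, of "k / (2 * M)"]) (use k M in auto)
  define r where "r = min r1 (min (r2 / L) r3)"
  have "r > 0" using r1 r2 r3 L by (simp add: r_def)
  moreover have "norm (G (F y) - G (F z) - E (D (y - z))) \<le> k * norm (y - z)"
    if yz: "y \<in> ball a r" "z \<in> ball a r" for y z
  proof -
    have in1: "x \<in> ball a r1" "x \<in> ball a r3" "F x \<in> ball (F a) r2" if "x \<in> ball a r" for x
    proof -
      show x: "x \<in> ball a r1" "x \<in> ball a r3" using that by (auto simp: r_def)
      have "norm (F a - F x) \<le> L * norm (a - x)" using x r1 by (intro lip) auto
      also have "\<dots> < L * (r2 / L)"
        using that L by (intro mult_strict_left_mono) (auto simp: r_def dist_norm)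
      finally show "F x \<in> ball (F a) r2" using L by (simp add: dist_norm)
    qed
    have lin: "E (F y - F z) - E (D (y - z)) = E (F y - F z - D (y - z))"
      using strict_derivative_linear[OF G] by (simp add: bounded_linear.linear linear_diff)
    have "G (F y) - G (F z) - E (D (y - z)) =
        (G (F y) - G (F z) - E (F y - F z)) + E (F y - F z - D (y - z))"
      unfolding lin[symmetric] by simp
    also have "norm \<dots> \<le> norm (G (F y) - G (F z) - E (F y - F z)) + norm (E (F y - F z - D (y - z)))"
      by (rule norm_triangle_ineq)
    also have "norm (G (F y) - G (F z) - E (F y - F z)) \<le> k / (2 * L) * norm (F y - F z)"
      using in1 yz by (intro G') auto
    also have "\<dots> \<le> k / (2 * L) * (L * norm (y - z))"
      using in1 yz k L by (intro mult_left_mono lip) auto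
    also have "norm (E (F y - F z - D (y - z))) \<le> norm (F y - F z - D (y - z)) * M" by (rule M)
    also have "\<dots> \<le> (k / (2 * M) * norm (y - z)) * M"
      using in1 yz M by (intro mult_right_mono F') auto
    also have "k / (2 * L) * (L * norm (y - z)) + (k / (2 * M) * norm (y - z)) * M = k * norm (y - z)"
      using L M by (simp add: field_simps)
    finally show ?thesis by simp
  qed
  ultimately show "\<exists>r>0. \<forall>y\<in>ball a r. \<forall>z\<in>ball a r. norm (G (F y) - G (F z) - E (D (y - z))) \<le> k * norm (y - z)"
    by blast
qed

lemma strict_derivative_Pair:
  assumes F: "strict_derivative F D a" and G: "strict_derivative G E a"
  shows "strict_derivative (\<lambda>x. (F x, G x)) (\<lambda>x. (D x, E x)) a"
  unfolding strict_derivative_def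
proof (intro conjI allI impI)
  show "bounded_linear (\<lambda>x. (D x, E x))"
    by (rule bounded_linear_Pair[OF strict_derivative_linear[OF F] strict_derivative_linear[OF G]])
  fix k :: real assume k: "k > 0"
  then have k2: "k / 2 > 0" by simp
  obtain r1 where r1: "r1 > 0" "\<And>y z. y \<in> ball a r1 \<Longrightarrow> z \<in> ball a r1 \<Longrightarrow>
      norm (F y - F z - D (y - z)) \<le> k / 2 * norm (y - z)"
    by (rule strict_derivativeE[OF F k2]) blast
  obtain r2 where r2: "r2 > 0" "\<And>y z. y \<in> ball a r2 \<Longrightarrow> z \<in> ball a r2 \<Longrightarrow>
      norm (G y - G z - E (y - z)) \<le> k / 2 * norm (y - z)"
    by (rule strict_derivativeE[OF G k2]) blast
  have "norm ((F y, G y) - (F z, G z) - (D (y - z), E (y - z))) \<le> k * norm (y - z)"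
    if "y \<in> ball a (min r1 r2)" "z \<in> ball a (min r1 r2)" for y z
  proof -
    have "norm (F y - F z - D (y - z), G y - G z - E (y - z))
        \<le> norm (F y - F z - D (y - z)) + norm (G y - G z - E (y - z))"
      by (rule norm_Pair_le)
    also have "\<dots> \<le> k / 2 * norm (y - z) + k / 2 * norm (y - z)"
      using that by (intro add_mono r1 r2) auto
    finally show ?thesis by simp
  qed
  then show "\<exists>r>0. \<forall>y\<in>ball a r. \<forall>z\<in>ball a r.
      norm ((F y, G y) - (F z, G z) - (D (y - z), E (y - z))) \<le> k * norm (y - z)"
    using r1(1) r2(1) by (intro exI[of _ "min r1 r2"]) auto
qed

lemma strict_derivative_linear_compose:
  "strict_derivative F D a \<Longrightarrow> bounded_linear E \<Longrightarrow> strict_derivative (\<lambda>x. E (F x)) (\<lambda>x. E (D x)) a"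
  by (rule strict_derivative_compose[OF _ strict_derivative_bounded_linear])

lemma strict_derivative_add:
  assumes "strict_derivative F D a" "strict_derivative G E a"
  shows "strict_derivative (\<lambda>x. F x + G x) (\<lambda>x. D x + E x) a"
  using strict_derivative_linear_compose[OF strict_derivative_Pair[OF assms], of "\<lambda>p. fst p + snd p"]
  by (simp add: bounded_linear_add bounded_linear_fst bounded_linear_snd)

lemma strict_derivative_diff:
  assumes "strict_derivative F D a" "strict_derivative G E a"
  shows "strict_derivative (\<lambda>x. F x - G x) (\<lambda>x. D x - E x) a"
  using strict_derivative_linear_compose[OF strict_derivative_Pair[OF assms], of "\<lambda>p. fst p - snd p"]
  by (simp add: bounded_linear_sub bounded_linear_fst bounded_linear_snd)

lemma strict_derivative_fst: "strict_derivative fst fst a"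
  and strict_derivative_snd: "strict_derivative snd snd a"
  by (intro strict_derivative_bounded_linear bounded_linear_fst bounded_linear_snd)+

lemma C2_on_strict_derivative:
  assumes F: "C2_on F S" and S: "open S" "a \<in> S"
  obtains D where "strict_derivative F D a"
proof -
  obtain F' F'' where F': "\<And>x. x \<in> S \<Longrightarrow> (F has_derivative blinfun_apply (F' x)) (at x)"
    and F'': "\<And>x. x \<in> S \<Longrightarrow> (F' has_derivative blinfun_apply (F'' x)) (at x)"
    using F unfolding C2_on_def by blast
  have cont: "continuous (at a) F'" using F''[OF S(2)] by (rule has_derivative_continuous)
  have "strict_derivative F (F' a) a"
    unfolding strict_derivative_def
  proof (intro conjI allI impI)
    show "bounded_linear (blinfun_apply (F' a))" by (rule blinfun.bounded_linear_right)
    fix k :: real assume k: "k > 0"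
    obtain d where d: "d > 0" "\<And>x. dist x a < d \<Longrightarrow> dist (F' x) (F' a) < k"
      using cont k unfolding continuous_at_eps_delta by metis
    obtain r0 where r0: "r0 > 0" "ball a r0 \<subseteq> S" using S open_contains_ball by blast
    define r where "r = min d r0"
    have "norm (F y - F z - F' a (y - z)) \<le> k * norm (y - z)" if "y \<in> ball a r" "z \<in> ball a r" for y z
    proof -
      have "norm ((\<lambda>x. F x - F' a x) y - (\<lambda>x. F x - F' a x) z) \<le> k * norm (y - z)"
      proof (rule differentiable_bound[where S = "ball a r" and f' = "\<lambda>x. blinfun_apply (F' x - F' a)"])
        fix x assume x: "x \<in> ball a r"
        then have xS: "x \<in> S" using r0 by (auto simp: r_def)
        have "((\<lambda>x. F x - F' a x) has_derivative (\<lambda>h. F' x h - F' a h)) (at x)"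
          by (intro has_derivative_diff F'[OF xS] blinfun.bounded_linear_right
              bounded_linear_imp_has_derivative)
        moreover have "blinfun_apply (F' x - F' a) = (\<lambda>h. F' x h - F' a h)"
          by (simp add: fun_eq_iff blinfun.diff_left)
        ultimately show "((\<lambda>x. F x - F' a x) has_derivative blinfun_apply (F' x - F' a)) (at x within ball a r)"
          by (simp add: has_derivative_at_withinI)
        have "dist (F' x) (F' a) < k" using x d(2)[of x] by (auto simp: r_def dist_commute)
        then show "onorm (blinfun_apply (F' x - F' a)) \<le> k"
          by (simp add: dist_norm norm_blinfun.rep_eq)
      qed (use that in auto)
      then show ?thesis by (simp add: blinfun.diff_right algebra_simps)
    qed
    then show "\<exists>r>0. \<forall>y\<in>ball a r. \<forall>z\<in>ball a r. norm (F y - F z - F' a (y - z)) \<le> k * norm (y - z)"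
      using d(1) r0(1) by (intro exI[of _ r]) (auto simp: r_def)
  qed
  then show ?thesis by (rule that)
qed

section \<open>Ordinary differential equations\<close>

definition locally_lipschitz :: "('a::real_normed_vector \<Rightarrow> 'b::real_normed_vector) \<Rightarrow> 'a set \<Rightarrow> bool" where
  "locally_lipschitz F D \<longleftrightarrow>
    (\<forall>p\<in>D. \<exists>r>0. \<exists>L. \<forall>x\<in>ball p r. \<forall>y\<in>ball p r. norm (F x - F y) \<le> L * norm (x - y))"

lemma strict_derivative_locally_lipschitz:
  assumes "\<And>p. p \<in> D \<Longrightarrow> \<exists>F'. strict_derivative F F' p"
  shows "locally_lipschitz F D"
  unfolding locally_lipschitz_def
proof
  fix p assume "p \<in> D"
  then obtain F' where "strict_derivative F F' p" using assms by blast
  then show "\<exists>r>0. \<exists>L. \<forall>x\<in>ball p r. \<forall>y\<in>ball p r. norm (F x - F y) \<le> L * norm (x - y)"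
    by (rule strict_derivative_lipschitz) blast
qed

lemma C2_on_locally_lipschitz: "C2_on F S \<Longrightarrow> open S \<Longrightarrow> locally_lipschitz F S"
  by (rule strict_derivative_locally_lipschitz) (meson C2_on_strict_derivative)

lemma has_vector_derivative_inner_self:
  fixes z :: "real \<Rightarrow> 'a::real_inner"
  assumes "(z has_vector_derivative z') (at t within T)"
  shows "((\<lambda>t. z t \<bullet> z t) has_real_derivative 2 * (z t \<bullet> z')) (at t within T)"
proof -
  have "((\<lambda>t. z t \<bullet> z t) has_derivative (\<lambda>h. z t \<bullet> (h *\<^sub>R z') + (h *\<^sub>R z') \<bullet> z t)) (at t within T)"
    using has_derivative_inner[OF assms[unfolded has_vector_derivative_def] assms[unfolded has_vector_derivative_def]] .
  then show ?thesis unfolding has_field_derivative_def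
    by (rule has_derivative_eq_rhs) (auto simp: inner_commute algebra_simps)
qed

text \<open>
  The function \<open>exp (- k x) * v x\<close> has a nonpositive derivative.
\<close>

lemma exp_growth_bound:
  fixes v :: "real \<Rightarrow> real"
  assumes st: "s \<le> t"
    and d: "\<And>x. x \<in> {s..t} \<Longrightarrow> (v has_real_derivative v' x) (at x within {s..t})"
    and le: "\<And>x. x \<in> {s..t} \<Longrightarrow> v' x \<le> k * v x"
  shows "v t \<le> exp (k * (t - s)) * v s"
proof -
  define u where "u x = exp (- k * x) * v x" for x
  have du: "(u has_real_derivative (exp (- k * x) * (v' x - k * v x))) (at x within {s..t})"
    if "x \<in> {s..t}" for x
    unfolding u_def by (rule derivative_eq_intros d[OF that] refl)+ (simp add: algebra_simps)
  have "u t \<le> u s"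
  proof (rule DERIV_nonpos_imp_decreasing_open[OF st])
    show "\<exists>y. (u has_real_derivative y) (at x) \<and> y \<le> 0" if "s < x" "x < t" for x
    proof (intro exI conjI)
      show "(u has_real_derivative (exp (- k * x) * (v' x - k * v x))) (at x)"
        using du[of x] that by (simp add: at_within_Icc_at)
      show "exp (- k * x) * (v' x - k * v x) \<le> 0"
        using le[of x] that by (intro mult_nonneg_nonpos) auto
    qed
    show "continuous_on {s..t} u"
      by (rule DERIV_continuous_on[OF du])
  qed
  then have "exp (k * t) * u t \<le> exp (k * t) * u s" by (intro mult_left_mono) auto
  moreover have "exp (k * t) * u t = v t" by (simp add: u_def mult.assoc[symmetric] exp_add[symmetric])
  moreover have "exp (k * t) * u s = exp (k * (t - s)) * v s"
    by (simp add: u_def mult.assoc[symmetric] exp_add[symmetric] right_diff_distrib)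
  ultimately show ?thesis by simp
qed

text \<open>
  Gronwall's estimate, obtained from the derivative of the squared distance.
\<close>

lemma trajectories_separation:
  fixes y z :: "real \<Rightarrow> 'a::real_inner"
  assumes st: "s \<le> t"
    and dy: "\<And>x. x \<in> {s..t} \<Longrightarrow> (y has_vector_derivative F (y x)) (at x within {s..t})"
    and dz: "\<And>x. x \<in> {s..t} \<Longrightarrow> (z has_vector_derivative F (z x)) (at x within {s..t})"
    and lip: "\<And>x. x \<in> {s..t} \<Longrightarrow> norm (F (y x) - F (z x)) \<le> L * norm (y x - z x)"
  shows "norm (y t - z t) \<le> exp (L * (t - s)) * norm (y s - z s)"
proof -
  define v where "v x = (y x - z x) \<bullet> (y x - z x)" for x
  have "v t \<le> exp ((2 * L) * (t - s)) * v s"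
  proof (rule exp_growth_bound[OF st])
    fix x assume x: "x \<in> {s..t}"
    show "(v has_real_derivative 2 * ((y x - z x) \<bullet> (F (y x) - F (z x)))) (at x within {s..t})"
      unfolding v_def
      by (rule has_vector_derivative_inner_self) (intro has_vector_derivative_diff dy dz x)
    have "(y x - z x) \<bullet> (F (y x) - F (z x)) \<le> norm (y x - z x) * (L * norm (y x - z x))"
      using norm_cauchy_schwarz mult_left_mono[OF lip[OF x] norm_ge_zero] by (rule order_trans)
    then show "2 * ((y x - z x) \<bullet> (F (y x) - F (z x))) \<le> 2 * L * v x"
      by (simp add: v_def power2_norm_eq_inner[symmetric] power2_eq_square mult_ac)
  qed
  then have "(norm (y t - z t))\<^sup>2 \<le> (exp (L * (t - s)) * norm (y s - z s))\<^sup>2"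
    unfolding v_def power2_norm_eq_inner[symmetric] power_mult_distrib
    by (simp add: exp_double[symmetric] mult.assoc)
  then show ?thesis by (rule power2_le_imp_le) simp
qed

lemma ode_solution_subset:
  "ode_solution F D T a z \<Longrightarrow> T' \<subseteq> T \<Longrightarrow> ode_solution F D T' a z"
  unfolding ode_solution_def by (auto intro: has_vector_derivative_within_subset)

lemma ode_solution_continuous_on: "ode_solution F D T a z \<Longrightarrow> continuous_on T z"
  unfolding ode_solution_def continuous_on_eq_continuous_within
  using has_vector_derivative_continuous by blast

lemma ode_unique:
  fixes F :: "'a::real_inner \<Rightarrow> 'a"
  assumes lip: "locally_lipschitz F D"
    and y: "ode_solution F D {0..T} a y" and z: "ode_solution F D {0..T} a z" and t: "t \<in> {0..T}"
  shows "y t = z t"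
proof (rule ccontr)
  assume neq: "y t \<noteq> z t"
  define B where "B = {s \<in> {0..T}. y s \<noteq> z s}"
  define m where "m = Inf B"
  have B: "t \<in> B" "bdd_below B" using t neq by (auto simp: B_def intro: bdd_belowI[of _ 0])
  have cy: "continuous_on {0..T} y" and cz: "continuous_on {0..T} z"
    using y z by (auto intro: ode_solution_continuous_on)
  have m0: "0 \<le> m" unfolding m_def using B by (intro cInf_greatest) (auto simp: B_def)
  have mt: "m \<le> t" unfolding m_def using B by (intro cInf_lower)
  have below: "y s = z s" if "0 \<le> s" "s < m" for s
    using that mt t cInf_lower[OF _ B(2), of s] by (force simp: B_def m_def)
  have eqm: "y m = z m"
  proof (cases "m = 0")
    case True then show ?thesis using y z by (simp add: ode_solution_def)
  next
    case False
    have mem: "m \<in> closure {0..<m}" using False m0 by simp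
    have sub: "closure {0..<m} \<subseteq> {0..T}" using False m0 mt t by simp
    have "continuous_on (closure {0..<m}) (\<lambda>s. y s - z s)"
      by (intro continuous_intros continuous_on_subset[OF cy sub] continuous_on_subset[OF cz sub])
    from continuous_constant_on_closure[OF this, of 0] below mem show ?thesis by auto
  qed
  have mI: "m \<in> {0..T}" using m0 mt t by simp
  have ym: "y m \<in> D" using y mI by (simp add: ode_solution_def)
  obtain r L where r: "r > 0" and L: "\<And>p q. p \<in> ball (y m) r \<Longrightarrow> q \<in> ball (y m) r \<Longrightarrow> norm (F p - F q) \<le> L * norm (p - q)"
    using lip ym unfolding locally_lipschitz_def by metis
  obtain d1 where d1: "d1 > 0" "\<And>s. s \<in> {0..T} \<Longrightarrow> dist s m < d1 \<Longrightarrow> dist (y s) (y m) < r"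
    using cy mI r unfolding continuous_on_iff by metis
  obtain d2 where d2: "d2 > 0" "\<And>s. s \<in> {0..T} \<Longrightarrow> dist s m < d2 \<Longrightarrow> dist (z s) (z m) < r"
    using cz mI r unfolding continuous_on_iff by metis
  obtain b where b: "b \<in> B" "b < m + min d1 d2"
    using cInf_lessD[of B "m + min d1 d2"] B d1(1) d2(1) unfolding m_def by auto
  have mb: "m \<le> b" unfolding m_def using b B by (intro cInf_lower)
  have sub: "{m..b} \<subseteq> {0..T}" using m0 b by (auto simp: B_def)
  have "norm (y b - z b) \<le> exp (L * (b - m)) * norm (y m - z m)"
  proof (rule trajectories_separation[OF mb])
    fix x assume x: "x \<in> {m..b}"
    show "(y has_vector_derivative F (y x)) (at x within {m..b})"
      "(z has_vector_derivative F (z x)) (at x within {m..b})"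
      using ode_solution_subset[OF y sub] ode_solution_subset[OF z sub] x
      by (simp_all add: ode_solution_def)
    have "dist x m < d1" "dist x m < d2" using x b by (auto simp: dist_real_def)
    then show "norm (F (y x) - F (z x)) \<le> L * norm (y x - z x)"
      using d1(2)[of x] d2(2)[of x] x sub eqm by (intro L) (auto simp: dist_commute)
  qed
  then have "y b = z b" by (simp add: eqm)
  then show False using b by (simp add: B_def)
qed

lemma ode_unique_ray:
  fixes F :: "'a::real_inner \<Rightarrow> 'a"
  assumes lip: "locally_lipschitz F D"
    and y: "ode_solution F D {0..} a y" and z: "ode_solution F D {0..} a z" and t: "0 \<le> t"
  shows "y t = z t"
  by (rule ode_unique[OF lip ode_solution_subset[OF y, of "{0..t}"] ode_solution_subset[OF z, of "{0..t}"]])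
     (use t in auto)

lemma exp_weighted_integral_bound:
  fixes g :: "real \<Rightarrow> 'a::euclidean_space"
  assumes "L > 0" "0 \<le> s" "0 \<le> d" and g: "continuous_on {0..s} g"
    and le: "\<And>t. t \<in> {0..s} \<Longrightarrow> norm (g t) \<le> L * exp (2 * L * t) * d"
  shows "norm (exp (- 2 * L * s) *\<^sub>R integral {0..s} g) \<le> d / 2"
proof -
  have "((\<lambda>t. L * exp (2 * L * t) * d) has_integral (exp (2 * L * s) * d / 2 - exp (2 * L * 0) * d / 2)) {0..s}"
    by (rule fundamental_theorem_of_calculus[OF \<open>0 \<le> s\<close>])
       (auto simp: has_real_derivative_iff_has_vector_derivative[symmetric] intro!: derivative_eq_intros)
  note * = this
  have I: "(\<lambda>t. L * exp (2 * L * t) * d) integrable_on {0..s}"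
    by (rule has_integral_integrable[OF *])
  have I2: "integral {0..s} (\<lambda>t. L * exp (2 * L * t) * d) = exp (2 * L * s) * d / 2 - d / 2"
    unfolding integral_unique[OF *] by simp
  have "norm (integral {0..s} g) \<le> integral {0..s} (\<lambda>t. L * exp (2 * L * t) * d)"
    by (intro integral_norm_bound_integral integrable_continuous_real g I le)
  also have "\<dots> \<le> exp (2 * L * s) * d / 2" unfolding I2 using \<open>0 \<le> d\<close> by simp
  finally have "exp (- 2 * L * s) * norm (integral {0..s} g) \<le> exp (- 2 * L * s) * (exp (2 * L * s) * d / 2)"
    by (intro mult_left_mono) auto
  also have "\<dots> = d / 2" by (simp add: mult.assoc[symmetric] exp_add[symmetric])
  finally show ?thesis by simp
qed

text \<open>
  Picard iteration in an exponentially weighted supremum norm gives the solution on the whole half line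
  in one step. The condition \<open>G t 0 = 0\<close> bounds the field by \<open>L * norm x\<close>, so the iterates stay in the
  weighted space.
\<close>

lemma global_ode_solution:
  fixes G :: "real \<Rightarrow> 'a::euclidean_space \<Rightarrow> 'a"
  assumes L: "L > 0" and lip: "\<And>t x y. 0 \<le> t \<Longrightarrow> norm (G t x - G t y) \<le> L * norm (x - y)"
    and G0: "\<And>t. 0 \<le> t \<Longrightarrow> G t 0 = 0"
    and cont: "continuous_on ({0..} \<times> UNIV) (\<lambda>(t, x). G t x)"
  obtains z where "z 0 = a" "\<And>t. 0 \<le> t \<Longrightarrow> (z has_vector_derivative G t (z t)) (at t within {0..})"
proof -
  define h where "h v t = G t (exp (2 * L * t) *\<^sub>R apply_bcontfun v t)" for v and t :: real
  \<comment> \<open>The weight \<open>exp (- 2 L t)\<close> makes the Picard operator a contraction with factor one half on all of the half line; it is constant for negative times so that it acts on functions of a real variable.\<close>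
  define \<Phi> where "\<Phi> v t = exp (- 2 * L * max 0 t) *\<^sub>R (a + integral {0..max 0 t} (h v))" for v t
  have hc: "continuous_on {0..s} (h v)" for v s
  proof -
    have "continuous_on {0..s} (\<lambda>t. (t, exp (2 * L * t) *\<^sub>R apply_bcontfun v t))"
      by (intro continuous_intros continuous_on_apply_bcontfun)
    moreover have "(\<lambda>t. (t, exp (2 * L * t) *\<^sub>R apply_bcontfun v t)) ` {0..s} \<subseteq> {0..} \<times> UNIV" by auto
    ultimately show ?thesis using continuous_on_compose2[OF cont] by (fastforce simp: h_def)
  qed
  have hle: "norm (h v t) \<le> L * exp (2 * L * t) * norm (apply_bcontfun v t)" if "0 \<le> t" for v t
    using lip[OF that, of "exp (2 * L * t) *\<^sub>R apply_bcontfun v t" 0] G0[OF that] by (simp add: h_def)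
  have hd: "((\<lambda>u. integral {0..u} (h v)) has_vector_derivative h v t) (at t within {0..})"
    if "0 \<le> t" for v t
  proof -
    have "((\<lambda>u. integral {0..u} (h v)) has_vector_derivative h v t) (at t within {0..t+1})"
      by (rule integral_has_vector_derivative[OF hc]) (use that in auto)
    moreover have "at t within {0..t+1} = at t within {0..}"
      by (rule at_within_nhd[of _ "{..<t+1}"]) auto
    ultimately show ?thesis by simp
  qed
  have \<Phi>: "\<Phi> v \<in> bcontfun" for v
  proof -
    have "continuous_on {0..} (\<lambda>u. integral {0..u} (h v))"
      unfolding continuous_on_eq_continuous_within
      using has_vector_derivative_continuous[OF hd] by auto
    then have "continuous_on UNIV (\<lambda>t. integral {0..max 0 t} (h v))"
      by (rule continuous_on_compose2[of "{0..}" _ UNIV "\<lambda>t. max 0 t"]) (auto intro!: continuous_intros)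
    then have "continuous_on UNIV (\<Phi> v)"
      unfolding \<Phi>_def by (intro continuous_intros)
    moreover have "bounded (range (\<Phi> v))"
    proof -
      obtain M where M: "\<And>t. norm (apply_bcontfun v t) \<le> M" "0 \<le> M"
        using bounded_apply_bcontfun[of v] unfolding bounded_iff
        by (meson norm_ge_zero order_trans rangeI)
      have "norm (\<Phi> v t) \<le> norm a + M / 2" for t
      proof -
        have "norm (\<Phi> v t) \<le> norm (exp (- 2 * L * max 0 t) *\<^sub>R a)
            + norm (exp (- 2 * L * max 0 t) *\<^sub>R integral {0..max 0 t} (h v))"
          unfolding \<Phi>_def scaleR_add_right by (rule norm_triangle_ineq)
        also have "norm (exp (- 2 * L * max 0 t) *\<^sub>R a) \<le> norm a"
          using L by (auto intro!: mult_left_le_one_le)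
        also have "norm (exp (- 2 * L * max 0 t) *\<^sub>R integral {0..max 0 t} (h v)) \<le> M / 2"
        proof (rule exp_weighted_integral_bound[OF L _ M(2) hc])
          fix u assume "u \<in> {0..max 0 t}"
          then have "norm (h v u) \<le> L * exp (2 * L * u) * norm (apply_bcontfun v u)" by (intro hle) auto
          also have "\<dots> \<le> L * exp (2 * L * u) * M" using L by (intro mult_left_mono M) auto
          finally show "norm (h v u) \<le> L * exp (2 * L * u) * M" .
        qed simp
        finally show ?thesis by simp
      qed
      then show ?thesis unfolding bounded_iff by blast
    qed
    ultimately show ?thesis by (simp add: bcontfun_def)
  qed
  define \<Psi> where "\<Psi> v = Bcontfun (\<Phi> v)" for v
  have \<Psi>: "apply_bcontfun (\<Psi> v) = \<Phi> v" for v by (simp add: \<Psi>_def Bcontfun_inverse \<Phi>)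
  have "dist (\<Psi> v) (\<Psi> w) \<le> (1/2) * dist v w" for v w
  proof (rule dist_bound)
    fix t :: real
    let ?s = "max 0 t"
    have int: "h v integrable_on {0..?s}" "h w integrable_on {0..?s}"
      by (intro integrable_continuous_real hc)+
    have "dist (\<Phi> v t) (\<Phi> w t) = norm (exp (- 2 * L * ?s) *\<^sub>R integral {0..?s} (\<lambda>u. h v u - h w u))"
      by (simp add: dist_norm \<Phi>_def Henstock_Kurzweil_Integration.integral_diff[OF int] algebra_simps)
    also have "\<dots> \<le> dist v w / 2"
    proof (rule exp_weighted_integral_bound[OF L])
      fix u assume u: "u \<in> {0..?s}"
      have "norm (h v u - h w u) \<le> L * norm (exp (2 * L * u) *\<^sub>R apply_bcontfun v u - exp (2 * L * u) *\<^sub>R apply_bcontfun w u)"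
        unfolding h_def using u by (intro lip) auto
      also have "\<dots> = L * exp (2 * L * u) * dist (apply_bcontfun v u) (apply_bcontfun w u)"
        by (simp add: scaleR_diff_right[symmetric] dist_norm)
      also have "\<dots> \<le> L * exp (2 * L * u) * dist v w"
        using L by (intro mult_left_mono dist_bounded) auto
      finally show "norm (h v u - h w u) \<le> L * exp (2 * L * u) * dist v w" .
    qed (auto intro!: continuous_intros hc)
    finally show "dist (\<Psi> v t) (\<Psi> w t) \<le> (1/2) * dist v w" by (simp add: \<Psi>)
  qed
  then have "\<exists>!v. \<Psi> v = v" by (intro banach_fix_type[of "1/2"]) auto
  then obtain v where "\<Psi> v = v" by auto
  then have v: "apply_bcontfun v t = \<Phi> v t" for t by (metis \<Psi>)
  define z where "z t = a + integral {0..t} (h v)" for t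
  have "exp (2 * L * t) *\<^sub>R apply_bcontfun v t = z t" if "0 \<le> t" for t
    unfolding v \<Phi>_def z_def using that by (simp add: exp_add[symmetric])
  then have hz: "h v t = G t (z t)" if "0 \<le> t" for t using that by (simp add: h_def)
  show ?thesis
  proof (rule that[of z])
    show "z 0 = a" by (simp add: z_def)
    fix t :: real assume t: "0 \<le> t"
    have "(z has_vector_derivative (0 + h v t)) (at t within {0..})"
      unfolding z_def by (intro has_vector_derivative_add has_vector_derivative_const hd t)
    then show "(z has_vector_derivative G t (z t)) (at t within {0..})" using hz[OF t] by simp
  qed
qed

section \<open>The spectrum of a nonwandering exosystem\<close>

lemma matrix_vector_bound:
  fixes M :: "real ^ 'n ^ 'm"
  obtains K where "K > 0" "\<And>x. norm (M *v x) \<le> K * norm x"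
  using bounded_linear.pos_bounded[OF matrix_vector_mul_bounded_linear[of M]] by (metis mult.commute)

lemma has_vector_derivative_quadratic_form:
  fixes H :: "real ^ 'n ^ 'n"
  assumes H: "transpose H = H" and z: "(z has_vector_derivative z') (at t within T)"
  shows "((\<lambda>t. z t \<bullet> (H *v z t)) has_real_derivative 2 * ((H *v z t) \<bullet> z')) (at t within T)"
proof -
  have "((\<lambda>t. H *v z t) has_derivative (\<lambda>h. H *v (h *\<^sub>R z'))) (at t within T)"
    by (rule bounded_linear.has_derivative[OF matrix_vector_mul_bounded_linear z[unfolded has_vector_derivative_def]])
  from has_derivative_inner[OF z[unfolded has_vector_derivative_def] this]
  show ?thesis unfolding has_field_derivative_def
    by (rule has_derivative_eq_rhs)
       (simp add: fun_eq_iff matrix_vector_mult_scaleR symmetric_inner[OF H, symmetric, of "z t"]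
         inner_commute[of z' "H *v z t"])
qed

lemma exp_decay_eventually:
  fixes s C e :: real
  assumes "s > 0" "e > 0"
  obtains T where "T > 0" "\<And>t. t \<ge> T \<Longrightarrow> exp (- s * t) * C < e"
proof -
  define T where "T = \<bar>C\<bar> / (s * e) + 1"
  have T: "T > 0" using assms by (simp add: T_def add_nonneg_pos)
  have "exp (- s * t) * C < e" if "t \<ge> T" for t
  proof -
    have "\<bar>C\<bar> = (\<bar>C\<bar> / (s * e)) * (s * e)" using assms by simp
    also have "\<dots> < t * (s * e)"
      using that assms by (intro mult_strict_right_mono) (auto simp: T_def)
    also have "\<dots> = e * (s * t)" by simp
    also have "\<dots> < e * exp (s * t)"
      using exp_ge_add_one_self[of "s * t"] assms by (intro mult_strict_left_mono) linarith+
    finally have "exp (- s * t) * \<bar>C\<bar> < exp (- s * t) * (e * exp (s * t))"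
      by (intro mult_strict_left_mono) auto
    also have "\<dots> = e" by (simp add: mult.left_commute[of _ e] exp_add[symmetric])
    finally have "exp (- s * t) * \<bar>C\<bar> < e" .
    moreover have "exp (- s * t) * C \<le> exp (- s * t) * \<bar>C\<bar>" by (intro mult_left_mono) auto
    ultimately show ?thesis by linarith
  qed
  then show ?thesis using T that by blast
qed

text \<open>
  The strict inequality for the linear part absorbs the remainder of the nonlinear field near the
  equilibrium.
\<close>

lemma quadratic_form_decay_near_equilibrium:
  fixes H S :: "real ^ 'n ^ 'n"
  assumes F: "strict_derivative F ((*v) S) 0" "F 0 = 0"
    and c: "c > 0" and dec: "\<And>x. 2 * ((H *v x) \<bullet> (S *v x)) + s * (x \<bullet> (H *v x)) \<le> - c * (x \<bullet> x)"
  obtains r where "r > 0" "\<And>x. norm x < r \<Longrightarrow> 2 * ((H *v x) \<bullet> F x) + s * (x \<bullet> (H *v x)) \<le> 0"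
proof -
  obtain K where K: "K > 0" "\<And>x. norm (H *v x) \<le> K * norm x" by (rule matrix_vector_bound[of H]) blast
  obtain r where r: "r > 0" "\<And>y z. y \<in> ball 0 r \<Longrightarrow> z \<in> ball 0 r \<Longrightarrow>
      norm (F y - F z - S *v (y - z)) \<le> c / (2 * K) * norm (y - z)"
    by (rule strict_derivativeE[OF F(1), of "c / (2 * K)"]) (use c K in auto)
  have "2 * ((H *v x) \<bullet> F x) + s * (x \<bullet> (H *v x)) \<le> 0" if "norm x < r" for x
  proof -
    have "(H *v x) \<bullet> (F x - S *v x) \<le> norm (H *v x) * norm (F x - S *v x)" by (rule norm_cauchy_schwarz)
    also have "\<dots> \<le> (K * norm x) * (c / (2 * K) * norm x)"
      using r(2)[of x 0] r(1) that F(2) K by (intro mult_mono) auto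
    also have "\<dots> = c / 2 * (x \<bullet> x)"
      using K(1) by (simp add: power2_norm_eq_inner[symmetric] power2_eq_square)
    finally have "2 * ((H *v x) \<bullet> F x) \<le> 2 * ((H *v x) \<bullet> (S *v x)) + c * (x \<bullet> x)"
      by (simp add: inner_diff_right)
    then show ?thesis using dec[of x] by linarith
  qed
  then show ?thesis using r(1) that by blast
qed

lemma scaled_into_open:
  fixes x0 :: "'a::real_normed_vector"
  assumes "open W" "0 \<in> W" "d > 0"
  obtains t where "t > 0" "t *\<^sub>R x0 \<in> W" "norm (t *\<^sub>R x0) < d"
proof -
  obtain e where e: "e > 0" "ball 0 e \<subseteq> W" using assms open_contains_ball by blast
  define t where "t = min d e / (norm x0 + 1)"
  have "t > 0" using assms e by (simp add: t_def add_nonneg_pos)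
  have "norm (t *\<^sub>R x0) = min d e * (norm x0 / (norm x0 + 1))" using assms e by (simp add: t_def)
  also have "\<dots> < min d e * 1"
    using assms(3) e(1) by (intro mult_strict_left_mono) (auto simp: divide_less_eq_1 add_nonneg_pos)
  finally have "norm (t *\<^sub>R x0) < min d e" by simp
  then show ?thesis using \<open>t > 0\<close> e(2) by (intro that[of t]) auto
qed

lemma lyapunov_stable_flow_bounded:
  fixes F :: "'a::real_inner \<Rightarrow> 'a"
  assumes lip: "locally_lipschitz F D"
    and "lyapunov_stable_origin F D" "e > 0"
  obtains d where "d > 0"
    "\<And>a. a \<in> D \<Longrightarrow> norm a < d \<Longrightarrow> \<exists>z. ode_solution F D {0..} a z \<and> (\<forall>t\<ge>0. norm (z t) < e)"
    "\<And>a z \<tau> t. norm a < d \<Longrightarrow> 0 \<le> t \<Longrightarrow> t \<le> \<tau> \<Longrightarrow> ode_solution F D {0..\<tau>} a z \<Longrightarrow> norm (z t) < e"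
proof -
  obtain d where d: "d > 0" "\<forall>a\<in>D. norm a < d \<longrightarrow> (\<exists>z. ode_solution F D {0..} a z) \<and>
      (\<forall>z. ode_solution F D {0..} a z \<longrightarrow> (\<forall>t\<ge>0. norm (z t) < e))"
    using assms(2,3) unfolding lyapunov_stable_origin_def by blast
  show ?thesis
  proof (rule that[OF d(1)])
    fix a z \<tau> t assume a: "norm a < d" and t: "0 \<le> t" "t \<le> (\<tau> :: real)" and z: "ode_solution F D {0..\<tau>} a z"
    have "a \<in> D" using z t unfolding ode_solution_def by force
    then obtain y where y: "ode_solution F D {0..} a y" "\<forall>t\<ge>0. norm (y t) < e" using d a by blast
    have "ode_solution F D {0..\<tau>} a y" by (rule ode_solution_subset[OF y(1)]) auto
    then have "z t = y t" using t by (intro ode_unique[OF lip z]) auto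
    then show "norm (z t) < e" using y t by simp
  qed (use d in blast)
qed

text \<open>
  If \<open>S\<close> had an eigenvalue in the open left half plane, the saddle form would decay exponentially along
  every trajectory near the origin. A point at which it is positive could then not be nonwandering.
  Lyapunov stability keeps the trajectories near the origin.
\<close>

lemma exosystem_spectrum_nonneg:
  fixes s :: "real ^ 'p \<Rightarrow> real ^ 'p"
  assumes W: "open W" "0 \<in> W" and s: "C2_on s W" "strict_derivative s ((*v) S) 0" "s 0 = 0"
    and stable: "lyapunov_stable_origin s W" and nonw: "\<And>w. w \<in> W \<Longrightarrow> nonwandering s W w"
    and l: "complex_eigenvalue (complex_matrix S) l"
  shows "0 \<le> Re l"
proof (rule ccontr)
  assume "\<not> 0 \<le> Re l"
  then obtain H \<sigma> c x0 where H: "transpose H = H" and \<sigma>: "\<sigma> > 0" and c: "c > 0" and x0: "0 < x0 \<bullet> (H *v x0)"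
    and dec: "\<And>x. 2 * ((H *v x) \<bullet> (S *v x)) + \<sigma> * (x \<bullet> (H *v x)) \<le> - c * (x \<bullet> x)"
    using saddle_lyapunov[OF l] by (metis not_le)
  obtain r where r: "r > 0" "\<And>x. norm x < r \<Longrightarrow> 2 * ((H *v x) \<bullet> s x) + \<sigma> * (x \<bullet> (H *v x)) \<le> 0"
    by (rule quadratic_form_decay_near_equilibrium[OF s(2,3) c dec]) blast
  obtain d where d: "d > 0"
    and bd: "\<And>a z \<tau> t. norm a < d \<Longrightarrow> 0 \<le> t \<Longrightarrow> t \<le> \<tau> \<Longrightarrow> ode_solution s W {0..\<tau>} a z \<Longrightarrow> norm (z t) < r"
    by (rule lyapunov_stable_flow_bounded[OF C2_on_locally_lipschitz[OF s(1) W(1)] stable r(1)]) blast+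
  obtain \<mu> where \<mu>: "\<mu> > 0" "\<mu> *\<^sub>R x0 \<in> W" "norm (\<mu> *\<^sub>R x0) < d"
    by (rule scaled_into_open[OF W d]) blast
  define w0 where "w0 = \<mu> *\<^sub>R x0"
  define V where "V x = x \<bullet> (H *v x)" for x
  have V0: "0 < V w0" using x0 \<mu>(1) by (simp add: V_def w0_def matrix_vector_mult_scaleR)
  obtain K where K: "K > 0" "\<And>x. norm (H *v x) \<le> K * norm x" by (rule matrix_vector_bound[of H]) blast
  have VK: "V x \<le> K * d\<^sup>2" if "norm x < d" for x
  proof -
    have "V x \<le> norm x * norm (H *v x)" unfolding V_def by (rule norm_cauchy_schwarz)
    also have "\<dots> \<le> d * (K * d)"
      using that K(1) d by (intro mult_mono order_trans[OF K(2)] mult_left_mono) auto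
    finally show ?thesis by (simp add: power2_eq_square mult_ac)
  qed
  define N where "N = {w. V w0 / 2 < V w} \<inter> ball 0 d"
  have "open N" unfolding N_def V_def
    by (intro open_Int open_Collect_less continuous_intros open_ball)
  moreover have "w0 \<in> N" using V0 \<mu>(3) by (simp add: N_def w0_def)
  moreover obtain T where T: "T > 0" "\<And>t. t \<ge> T \<Longrightarrow> exp (- \<sigma> * t) * (K * d\<^sup>2) < V w0 / 2"
    by (rule exp_decay_eventually[OF \<sigma>, of "V w0 / 2" "K * d\<^sup>2"]) (use V0 in auto)
  ultimately obtain \<tau> where \<tau>: "\<tau> > T" "flow_image s W \<tau> N \<inter> N \<noteq> {}"
    using nonw[of w0] \<mu>(2) unfolding nonwandering_def w0_def by blast
  then obtain a z where az: "a \<in> N" "ode_solution s W {0..\<tau>} a z" "z \<tau> \<in> N"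
    unfolding flow_image_def by auto
  have a: "norm a < d" using az(1) by (simp add: N_def)
  have "V (z \<tau>) \<le> exp (- \<sigma> * (\<tau> - 0)) * V (z 0)"
  proof (rule exp_growth_bound)
    show "0 \<le> \<tau>" using T(1) \<tau>(1) by simp
    fix t assume t: "t \<in> {0..\<tau>}"
    show "((\<lambda>t. V (z t)) has_real_derivative 2 * ((H *v z t) \<bullet> s (z t))) (at t within {0..\<tau>})"
      unfolding V_def using az(2) t
      by (intro has_vector_derivative_quadratic_form[OF H]) (simp add: ode_solution_def)
    have "norm (z t) < r" using t by (intro bd[OF a _ _ az(2)]) auto
    from r(2)[OF this] show "2 * ((H *v z t) \<bullet> s (z t)) \<le> - \<sigma> * V (z t)" by (simp add: V_def)
  qed
  also have "\<dots> \<le> exp (- \<sigma> * \<tau>) * (K * d\<^sup>2)"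
    using VK[OF a] az(2) by (simp add: ode_solution_def)
  also have "\<dots> < V w0 / 2" using \<tau>(1) by (intro T) simp
  finally show False using az(3) by (simp add: N_def)
qed

text \<open>
  The saddle form of \<open>-S\<close> grows exponentially along a trajectory that starts where it is positive, so the
  trajectory cannot stay near the origin.
\<close>

lemma exosystem_spectrum_nonpos:
  fixes s :: "real ^ 'p \<Rightarrow> real ^ 'p"
  assumes W: "open W" "0 \<in> W" and s: "C2_on s W" "strict_derivative s ((*v) S) 0" "s 0 = 0"
    and stable: "lyapunov_stable_origin s W"
    and l: "complex_eigenvalue (complex_matrix S) l"
  shows "Re l \<le> 0"
proof (rule ccontr)
  assume "\<not> Re l \<le> 0"
  then have "Re (- l) < 0" by simp
  moreover have "complex_eigenvalue (complex_matrix (- S)) (- l)"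
    using l by (simp add: complex_eigenvalue_uminus)
  ultimately obtain H \<sigma> c x0 where H: "transpose H = H" and \<sigma>: "\<sigma> > 0" and c: "c > 0"
    and x0: "0 < x0 \<bullet> (H *v x0)"
    and dec: "\<And>x. 2 * ((H *v x) \<bullet> ((- S) *v x)) + \<sigma> * (x \<bullet> (H *v x)) \<le> - c * (x \<bullet> x)"
    using saddle_lyapunov by metis
  have "(*v) (- S) = (\<lambda>x. - (S *v x))"
    using matrix_vector_mult_diff_rdistrib[of 0 S] by (simp add: fun_eq_iff)
  then have "strict_derivative (\<lambda>x. - s x) ((*v) (- S)) 0"
    using strict_derivative_linear_compose[OF s(2), of uminus] by (simp add: bounded_linear_minus bounded_linear_ident)
  then obtain r where r: "r > 0" "\<And>x. norm x < r \<Longrightarrow> 2 * ((H *v x) \<bullet> - s x) + \<sigma> * (x \<bullet> (H *v x)) \<le> 0"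
    by (rule quadratic_form_decay_near_equilibrium[OF _ _ c dec]) (use s(3) in auto)
  obtain d where d: "d > 0"
    and ex: "\<And>a. a \<in> W \<Longrightarrow> norm a < d \<Longrightarrow> \<exists>z. ode_solution s W {0..} a z \<and> (\<forall>t\<ge>0. norm (z t) < r)"
    by (rule lyapunov_stable_flow_bounded[OF C2_on_locally_lipschitz[OF s(1) W(1)] stable r(1)]) blast+
  obtain \<mu> where \<mu>: "\<mu> > 0" "\<mu> *\<^sub>R x0 \<in> W" "norm (\<mu> *\<^sub>R x0) < d"
    by (rule scaled_into_open[OF W d]) blast
  define w0 where "w0 = \<mu> *\<^sub>R x0"
  define V where "V x = x \<bullet> (H *v x)" for x
  have V0: "0 < V w0" using x0 \<mu>(1) by (simp add: V_def w0_def matrix_vector_mult_scaleR)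
  obtain z where z: "ode_solution s W {0..} w0 z" "\<And>t. t \<ge> 0 \<Longrightarrow> norm (z t) < r"
    using ex[OF \<mu>(2,3)] unfolding w0_def by blast
  obtain K where K: "K > 0" "\<And>x. norm (H *v x) \<le> K * norm x" by (rule matrix_vector_bound[of H]) blast
  obtain T where T: "T > 0" "\<And>t. t \<ge> T \<Longrightarrow> exp (- \<sigma> * t) * (K * r\<^sup>2) < V w0"
    by (rule exp_decay_eventually[OF \<sigma> V0, of "K * r\<^sup>2"]) blast
  have zT: "ode_solution s W {0..T} w0 z" by (rule ode_solution_subset[OF z(1)]) auto
  have "- V (z T) \<le> exp (\<sigma> * (T - 0)) * (- V (z 0))"
  proof (rule exp_growth_bound)
    fix t assume t: "t \<in> {0..T}"
    show "((\<lambda>t. - V (z t)) has_real_derivative - (2 * ((H *v z t) \<bullet> s (z t)))) (at t within {0..T})"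
      unfolding V_def using zT t
      by (intro DERIV_minus has_vector_derivative_quadratic_form[OF H]) (simp add: ode_solution_def)
    have "norm (z t) < r" using t by (intro z(2)) auto
    from r(2)[OF this] show "- (2 * ((H *v z t) \<bullet> s (z t))) \<le> \<sigma> * (- V (z t))" by (simp add: V_def)
  qed (use T in simp)
  then have "exp (\<sigma> * T) * V w0 \<le> V (z T)" using z(1) by (simp add: ode_solution_def)
  also have "V (z T) \<le> norm (z T) * norm (H *v z T)" unfolding V_def by (rule norm_cauchy_schwarz)
  also have "\<dots> \<le> r * (K * r)"
    using z(2)[of T] T(1) K(1) r(1) by (intro mult_mono order_trans[OF K(2)] mult_left_mono) auto
  finally have "exp (- \<sigma> * T) * (exp (\<sigma> * T) * V w0) \<le> exp (- \<sigma> * T) * (K * r\<^sup>2)"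
    by (intro mult_left_mono) (auto simp: power2_eq_square mult_ac)
  then have "V w0 \<le> exp (- \<sigma> * T) * (K * r\<^sup>2)"
    by (simp add: mult.assoc[symmetric] exp_add[symmetric])
  then show False using T(2)[of T] by simp
qed

section \<open>Perturbed exponential stability\<close>

text \<open>
  A perturbation that vanishes at the origin and has a small Lipschitz constant does not destroy the decay
  of the quadratic form \<open>\<beta>\<close>, uniformly in its dependence on time. The time dependence will come from the
  exosystem.
\<close>

lemma driven_exponential_stability:
  fixes J :: "'a::euclidean_space \<Rightarrow> 'a" and \<beta> :: "'a \<Rightarrow> 'a \<Rightarrow> real"
  assumes \<beta>: "bounded_bilinear \<beta>" "\<And>x y. \<beta> x y = \<beta> y x"
    and m: "m > 0" "\<And>x. m * (norm x)\<^sup>2 \<le> \<beta> x x"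
    and K: "K > 0" "\<And>x y. \<beta> x y \<le> K * norm x * norm y"
    and J: "bounded_linear J" and c: "c > 0" "\<And>x. 2 * \<beta> x (J x) \<le> - c * (norm x)\<^sup>2"
    and r: "r > 0" and \<rho>0: "\<And>t. 0 \<le> t \<Longrightarrow> \<rho> t 0 = 0"
    and lip: "\<And>t x y. 0 \<le> t \<Longrightarrow> x \<in> cball 0 r \<Longrightarrow> y \<in> cball 0 r \<Longrightarrow>
      norm (\<rho> t x - \<rho> t y) \<le> c / (4 * K) * norm (x - y)"
    and cont: "continuous_on ({0..} \<times> cball 0 r) (\<lambda>(t, x). \<rho> t x)"
    and a: "sqrt (K / m) * norm a \<le> r"
  obtains z where "z 0 = a" "\<And>t. 0 \<le> t \<Longrightarrow> (z has_vector_derivative J (z t) + \<rho> t (z t)) (at t within {0..})"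
    "\<And>t. 0 \<le> t \<Longrightarrow> norm (z t) \<le> sqrt (K / m) * exp (- (c / (4 * K)) * t) * norm a"
proof -
  \<comment> \<open>Freezing the perturbation outside the ball gives a globally Lipschitz field for which the decay estimate holds everywhere, so the solution never leaves the ball when it starts close to the origin.\<close>
  define p where "p = closest_point (cball (0 :: 'a) r)"
  have ne: "convex (cball (0 :: 'a) r)" "closed (cball (0 :: 'a) r)" "cball (0 :: 'a) r \<noteq> {}"
    using r by auto
  have p_in: "p x \<in> cball 0 r" for x unfolding p_def by (rule closest_point_in_set[OF ne(2,3)])
  have p_lip: "norm (p x - p y) \<le> norm (x - y)" for x y
    using closest_point_lipschitz[OF ne, of x y] by (simp add: p_def dist_norm)
  have p_self: "p x = x" if "norm x \<le> r" for x
    unfolding p_def using that by (intro closest_point_self) simp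
  define k where "k = c / (4 * K)"
  have k: "k > 0" using c K by (simp add: k_def)
  obtain B where B: "B > 0" "\<And>x. norm (J x) \<le> norm x * B"
    using bounded_linear.pos_bounded[OF J] by auto
  define G where "G t x = J x + \<rho> t (p x)" for t x
  have G\<rho>: "norm (\<rho> t (p x) - \<rho> t (p y)) \<le> k * norm (x - y)" if "0 \<le> t" for t x y
  proof -
    have "norm (\<rho> t (p x) - \<rho> t (p y)) \<le> k * norm (p x - p y)"
      unfolding k_def by (intro lip that p_in)
    also have "\<dots> \<le> k * norm (x - y)" using k by (intro mult_left_mono p_lip) auto
    finally show ?thesis .
  qed
  have G0: "\<rho> t (p 0) = 0" if "0 \<le> t" for t using \<rho>0[OF that] p_self[of 0] r by simp
  have Glip: "norm (G t x - G t y) \<le> (B + k) * norm (x - y)" if t: "0 \<le> t" for t x y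
  proof -
    have "G t x - G t y = J (x - y) + (\<rho> t (p x) - \<rho> t (p y))"
      using J by (simp add: G_def bounded_linear.linear linear_diff)
    also have "norm \<dots> \<le> norm (J (x - y)) + norm (\<rho> t (p x) - \<rho> t (p y))" by (rule norm_triangle_ineq)
    finally show ?thesis using B(2)[of "x - y"] G\<rho>[OF t, of x y] by (simp add: algebra_simps)
  qed
  have "continuous_on ({0..} \<times> UNIV) (\<lambda>q. (fst q, p (snd q)))"
    unfolding p_def by (intro continuous_intros continuous_on_compose2[OF continuous_on_closest_point[OF ne, of UNIV]]) auto
  then have "continuous_on ({0..} \<times> UNIV) (\<lambda>q. \<rho> (fst q) (p (snd q)))"
    using continuous_on_compose2[OF cont, of "{0..} \<times> UNIV" "\<lambda>q. (fst q, p (snd q))"] p_in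
    by (fastforce simp: split_beta)
  then have Gcont: "continuous_on ({0..} \<times> UNIV) (\<lambda>(t, x). G t x)"
    unfolding G_def split_beta
    by (intro continuous_on_add bounded_linear.continuous_on[OF J] continuous_intros)
  have G00: "G t 0 = 0" if "0 \<le> t" for t
    using G0[OF that] J by (simp add: G_def bounded_linear.linear linear_0)
  obtain z where z: "z 0 = a" "\<And>t. 0 \<le> t \<Longrightarrow> (z has_vector_derivative G t (z t)) (at t within {0..})"
    using global_ode_solution[OF _ Glip G00 Gcont, of a] B(1) k by (metis add_pos_pos)
  define V where "V t = \<beta> (z t) (z t)" for t
  have decay: "norm (z t) \<le> sqrt (K / m) * exp (- k * t) * norm a" if t: "0 \<le> t" for t
  proof -
    have "V t \<le> exp (- (2 * k) * (t - 0)) * V 0"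
    proof (rule exp_growth_bound[OF t])
      fix u assume u: "u \<in> {0..t}"
      have "(z has_vector_derivative G u (z u)) (at u within {0..t})"
        using u by (intro has_vector_derivative_within_subset[OF z(2)]) auto
      note zu = this[unfolded has_vector_derivative_def]
      have "(V has_derivative (\<lambda>h. \<beta> (z u) (h *\<^sub>R G u (z u)) + \<beta> (h *\<^sub>R G u (z u)) (z u))) (at u within {0..t})"
        unfolding V_def by (rule bounded_bilinear.FDERIV[OF \<beta>(1) zu zu])
      then show "(V has_real_derivative 2 * \<beta> (z u) (G u (z u))) (at u within {0..t})"
        unfolding has_field_derivative_def
        by (rule has_derivative_eq_rhs)
           (auto simp: fun_eq_iff \<beta>(2)[of "G u (z u)"] bounded_bilinear.scaleR_right[OF \<beta>(1)]
             bounded_bilinear.scaleR_left[OF \<beta>(1)])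
      have "norm (\<rho> u (p (z u))) \<le> k * norm (z u)"
        using G\<rho>[of u "z u" 0] G0[of u] u by simp
      then have "\<beta> (z u) (\<rho> u (p (z u))) \<le> K * norm (z u) * (k * norm (z u))"
        using K(1) by (intro order_trans[OF K(2)] mult_left_mono) auto
      also have "\<dots> = c / 4 * (norm (z u))\<^sup>2" using K(1) by (simp add: k_def power2_eq_square)
      finally have "2 * \<beta> (z u) (G u (z u)) \<le> - (c / 2) * (norm (z u))\<^sup>2"
        using c(2)[of "z u"] unfolding G_def bounded_bilinear.add_right[OF \<beta>(1)] by (simp add: algebra_simps)
      also have "\<dots> = - (2 * k) * (K * norm (z u) * norm (z u))"
        using K(1) by (simp add: k_def power2_eq_square)
      also have "\<dots> \<le> - (2 * k) * V u"
        using k K(2)[of "z u" "z u"] by (simp add: V_def)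
      finally show "2 * \<beta> (z u) (G u (z u)) \<le> - (2 * k) * V u" .
    qed
    also have "\<dots> \<le> exp (- (2 * k) * (t - 0)) * (K * norm a * norm a)"
      unfolding V_def z(1) by (intro mult_left_mono K) auto
    finally have "m * (norm (z t))\<^sup>2 \<le> exp (- (2 * k) * t) * (K * norm a * norm a)"
      using m(2)[of "z t"] by (simp add: V_def)
    then have "(norm (z t))\<^sup>2 \<le> (K / m) * (exp (- k * t))\<^sup>2 * (norm a)\<^sup>2"
      using m(1) by (simp add: field_simps power2_eq_square exp_add[symmetric])
    also have "\<dots> = (sqrt (K / m) * exp (- k * t) * norm a)\<^sup>2"
      using K(1) m(1) by (simp add: power_mult_distrib)
    finally show ?thesis by (rule power2_le_imp_le) (use K(1) m(1) in simp)
  qed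
  have small: "norm (z t) \<le> r" if "0 \<le> t" for t
  proof -
    have "sqrt (K / m) * exp (- k * t) * norm a \<le> sqrt (K / m) * 1 * norm a"
      using k that K(1) m(1) by (intro mult_right_mono mult_left_mono) auto
    then show ?thesis using decay[OF that] a by simp
  qed
  show ?thesis
  proof (rule that[of z, OF z(1)])
    fix t :: real assume t: "0 \<le> t"
    show "(z has_vector_derivative J (z t) + \<rho> t (z t)) (at t within {0..})"
      using z(2)[OF t] p_self[OF small[OF t]] by (simp add: G_def)
    show "norm (z t) \<le> sqrt (K / m) * exp (- (c / (4 * K)) * t) * norm a"
      using decay[OF t] by (simp add: k_def)
  qed
qed

section \<open>Low gain output injection\<close>

lemma positive_definite_inverse_bound:
  fixes W :: "real ^ 'p ^ 'p"
  assumes "K > 0" "\<And>x. K * (x \<bullet> x) \<le> x \<bullet> (W *v x)"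
  obtains b where "W *v b = d" "K * norm b \<le> norm d"
proof -
  have "x = 0" if "W *v x = 0" for x
  proof -
    have "K * (x \<bullet> x) \<le> 0" using assms(2)[of x] that by simp
    then have "x \<bullet> x \<le> 0" using assms(1) by (simp add: mult_le_0_iff)
    then show ?thesis by (metis inner_eq_zero_iff inner_ge_zero order_antisym)
  qed
  then have "inj ((*v) W)" using linear_injective_0[OF matrix_vector_mul_linear[of W]] by blast
  then have "surj ((*v) W)" by (intro linear_injective_imp_surjective[OF matrix_vector_mul_linear _ refl])
  then obtain b where b: "d = W *v b" by (rule surjE)
  have "norm b * (K * norm b) \<le> norm b * norm d"
  proof -
    have "norm b * (K * norm b) = K * (b \<bullet> b)" by (simp add: power2_norm_eq_inner[symmetric] power2_eq_square)
    also have "\<dots> \<le> b \<bullet> d" using assms(2)[of b] b by simp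
    also have "\<dots> \<le> norm b * norm d" by (rule norm_cauchy_schwarz)
    finally show ?thesis .
  qed
  then have "K * norm b \<le> norm d" by (cases "b = 0") auto
  then show ?thesis using that b by metis
qed

text \<open>
  The scalar estimate behind the low gain design: \<open>X\<close> is the size of the plant deviation, \<open>sg\<close> the output of
  the exosystem deviation, \<open>cx\<close> the output of the plant deviation, \<open>Z\<close> the squared size of the exosystem
  deviation, \<open>e\<close> the size of the gain, and \<open>t\<close> the derivative of the plant form.
\<close>

lemma low_gain_dissipation:
  fixes c k cc e c1 c2 X Z sg cx y t :: real
  assumes k: "0 < k" "8 * k * (cc\<^sup>2 + 1) \<le> c1" and e: "0 \<le> e" "e * (2 * cc + 1) \<le> c1 / 4" "2 * e \<le> k"
    and X: "0 \<le> X" "0 \<le> cc" and cx: "\<bar>cx\<bar> \<le> cc * X"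
    and t: "t \<le> - c1 * X\<^sup>2 + 2 * (e * X * \<bar>cx - sg\<bar>)"
  shows "t + k * (sg\<^sup>2 - c2 * Z + 2 * (sg * (cx - sg))) \<le> - (c1 / 2) * X\<^sup>2 - k * c2 * Z"
proof -
  have "\<bar>cx - sg\<bar> \<le> cc * X + \<bar>sg\<bar>" using cx by linarith
  then have "2 * (e * X * \<bar>cx - sg\<bar>) \<le> 2 * (e * X * (cc * X + \<bar>sg\<bar>))"
    using e X by (intro mult_left_mono) auto
  also have "\<dots> = 2 * e * cc * X\<^sup>2 + e * (2 * X * \<bar>sg\<bar>)" by (simp add: power2_eq_square algebra_simps)
  also have "\<dots> \<le> 2 * e * cc * X\<^sup>2 + e * (X\<^sup>2 + sg\<^sup>2)"
    using e(1) sum_squares_bound[of X "\<bar>sg\<bar>"] by (intro add_left_mono mult_left_mono) auto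
  also have "\<dots> = e * (2 * cc + 1) * X\<^sup>2 + e * sg\<^sup>2" by (simp add: algebra_simps)
  also have "\<dots> \<le> c1 / 4 * X\<^sup>2 + k / 2 * sg\<^sup>2"
    using e by (intro add_mono mult_right_mono) auto
  finally have 1: "2 * (e * X * \<bar>cx - sg\<bar>) \<le> c1 / 4 * X\<^sup>2 + k / 2 * sg\<^sup>2" .
  have "cx\<^sup>2 \<le> (cc * X)\<^sup>2" using cx by (metis abs_ge_zero power2_abs power_mono)
  then have cx2: "cx\<^sup>2 \<le> cc\<^sup>2 * X\<^sup>2" by (simp add: power_mult_distrib)
  have "0 \<le> (2 * cx - sg)\<^sup>2" by simp
  then have "2 * (sg * cx) \<le> 2 * cx\<^sup>2 + sg\<^sup>2 / 2" by (simp add: power2_eq_square algebra_simps)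
  then have "k * (2 * (sg * cx)) \<le> k * (2 * (cc\<^sup>2 * X\<^sup>2) + sg\<^sup>2 / 2)"
    using k(1) cx2 by (intro mult_left_mono) auto
  also have "\<dots> = (2 * k * cc\<^sup>2) * X\<^sup>2 + k / 2 * sg\<^sup>2" by (simp add: algebra_simps)
  also have "\<dots> \<le> c1 / 4 * X\<^sup>2 + k / 2 * sg\<^sup>2"
  proof (intro add_right_mono mult_right_mono)
    show "2 * k * cc\<^sup>2 \<le> c1 / 4" using k by (simp add: algebra_simps)
  qed simp
  finally have 2: "k * (2 * (sg * cx)) \<le> c1 / 4 * X\<^sup>2 + k / 2 * sg\<^sup>2" .
  have "k * (sg\<^sup>2 - c2 * Z + 2 * (sg * (cx - sg))) = k * (2 * (sg * cx)) - k * sg\<^sup>2 - k * c2 * Z"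
    by (simp add: power2_eq_square algebra_simps)
  then show ?thesis using 1 2 t by linarith
qed

text \<open>
  The linear part of the closed loop of the plant with a copy of the exosystem, where \<open>R\<close> is the derivative
  of \<open>\<pi>\<close>, and \<open>B\<close>, \<open>d\<close> are the feedthroughs of the controller state into plant and error, given by the linear
  regulator equations. In suitable coordinates it is an output injection with gain \<open>Bc\<close> into the exosystem
  and \<open>L Bc\<close> into the plant. The plant is stable by itself, so it suffices to stabilize the exosystem part
  with a gain so small that its effect on the plant is negligible; the stability margin of the exosystem
  part may then be arbitrarily small because the cross terms are bounded by the output, which the large form
  \<open>W\<close> dissipates.
\<close>

lemma stabilizing_output_injection:
  fixes A :: "real ^ 'n ^ 'n" and S :: "real ^ 'p ^ 'p" and P B R :: "real ^ 'p ^ 'n"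
    and c :: "real ^ 'n" and q d :: "real ^ 'p"
  assumes A: "hurwitz A" and S: "\<And>l. complex_eigenvalue (complex_matrix S) l \<Longrightarrow> Re l = 0"
    and detect: "\<And>a a' b b' t. A *v a + P *v b = - t *\<^sub>R a' \<Longrightarrow> A *v a' + P *v b' = t *\<^sub>R a \<Longrightarrow>
      S *v b = - t *\<^sub>R b' \<Longrightarrow> S *v b' = t *\<^sub>R b \<Longrightarrow> c \<bullet> a + q \<bullet> b = 0 \<Longrightarrow> c \<bullet> a' + q \<bullet> b' = 0 \<Longrightarrow>
      b = 0 \<and> b' = 0"
    and B: "\<And>w. B *v w = R *v (S *v w) - A *v (R *v w) - P *v w"
    and d: "\<And>w. d \<bullet> w = - (c \<bullet> (R *v w)) - q \<bullet> w"
  obtains Bc \<beta> m g where "bounded_bilinear \<beta>" "\<And>u v. \<beta> u v = \<beta> v u" "m > 0"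
    "\<And>u. m * (norm u)\<^sup>2 \<le> \<beta> u u" "g > 0"
    "\<And>x z. 2 * \<beta> (x, z) (A *v x + B *v z, S *v z + (c \<bullet> x + d \<bullet> z) *\<^sub>R Bc) \<le> - g * (norm (x, z))\<^sup>2"
proof -
  \<comment> \<open>\<open>V\<close> decouples plant and exosystem, and \<open>L\<close> measures how far the regulator solution \<open>R\<close> is from it.\<close>
  obtain V where V: "V ** S - A ** V = P" by (rule sylvester_solution[OF A]) (use S in auto)
  have Vx: "V *v (S *v w) = A *v (V *v w) + P *v w" for w
    using V by (metis (no_types, lifting) add.commute diff_add_cancel matrix_vector_mul_assoc
        matrix_vector_mult_add_rdistrib)
  define L where "L = R - V"
  have Lx: "L *v w = R *v w - V *v w" for w by (simp add: L_def matrix_vector_mult_diff_rdistrib)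
  define qh where "qh = transpose V *v c + q"
  have qh: "qh \<bullet> w = c \<bullet> (V *v w) + q \<bullet> w" for w
    by (simp add: qh_def inner_add_left) (metis inner_commute inner_transpose_mult)
  obtain M m1 c1 where M: "transpose M = M" "m1 > 0" "c1 > 0" "\<And>x. m1 * (x \<bullet> x) \<le> x \<bullet> (M *v x)"
    "\<And>x. 2 * ((M *v x) \<bullet> (A *v x)) \<le> - c1 * (x \<bullet> x)" by (rule hurwitz_lyapunov[OF A]) blast
  obtain KM where KM: "KM > 0" "\<And>x. norm (M *v x) \<le> KM * norm x" by (rule matrix_vector_bound[of M]) blast
  obtain KL where KL: "KL > 0" "\<And>x. norm (L *v x) \<le> KL * norm x" by (rule matrix_vector_bound[of L]) blast
  \<comment> \<open>The plant form dominates the term \<open>2 k (c x)\<^sup>2\<close> through the choice of \<open>k\<close>, and \<open>e0\<close> is the largest admissible coupling through the gain \<open>Bc\<close>; the bound \<open>K\<close> on \<open>W\<close> makes the gain that small.\<close>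
  define k where "k = c1 / (8 * ((norm c)\<^sup>2 + 1))"
  have k: "k > 0" "8 * k * ((norm c)\<^sup>2 + 1) \<le> c1"
  proof -
    have D: "0 < 8 * ((norm c)\<^sup>2 + 1)" by (simp add: add_nonneg_pos)
    show "k > 0" unfolding k_def using M(3) D by (rule divide_pos_pos)
    have "k * (8 * ((norm c)\<^sup>2 + 1)) = c1" unfolding k_def using D by simp
    then show "8 * k * ((norm c)\<^sup>2 + 1) \<le> c1" by (simp add: mult_ac)
  qed
  define e0 where "e0 = min (c1 / (4 * (2 * norm c + 1))) (k / 2)"
  have "e0 > 0" using M(3) k by (simp add: e0_def add_nonneg_pos)
  have e0: "e0 \<le> c1 / (4 * (2 * norm c + 1))" "2 * e0 \<le> k" by (simp_all add: e0_def)
  have "e0 * (2 * norm c + 1) \<le> c1 / (4 * (2 * norm c + 1)) * (2 * norm c + 1)"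
    using e0(1) by (intro mult_right_mono) auto
  also have "\<dots> = c1 / 4"
  proof -
    have "2 * norm c + 1 \<noteq> 0" using norm_ge_zero[of c] by linarith
    then show ?thesis by (simp add: divide_simps)
  qed
  finally have e0c: "e0 * (2 * norm c + 1) \<le> c1 / 4" .
  define K where "K = KM * KL * norm qh / e0 + 1"
  have K: "K > 0" using KM KL \<open>e0 > 0\<close> by (simp add: K_def add_nonneg_pos)
  have obs: "a = 0 \<and> b = 0"
    if "S *v a = r *\<^sub>R a - t *\<^sub>R b" "S *v b = r *\<^sub>R b + t *\<^sub>R a" "qh \<bullet> a = 0" "qh \<bullet> b = 0" for a b r t
  proof (rule ccontr)
    assume "\<not> (a = 0 \<and> b = 0)"
    then have "complex_eigenvalue (complex_matrix S) (Complex r t)"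
      unfolding complex_eigenvalue_real using that(1,2) by auto
    then have r: "r = 0" using S by fastforce
    have "A *v (V *v a) + P *v a = - t *\<^sub>R (V *v b)" "A *v (V *v b) + P *v b = t *\<^sub>R (V *v a)"
      unfolding Vx[symmetric] that(1,2) r by (simp_all add: matrix_vector_mult_scaleR linear_neg[OF matrix_vector_mul_linear])
    then show False using detect[of "V *v a" a t "V *v b" b] that r \<open>\<not> (a = 0 \<and> b = 0)\<close>
      by (auto simp: qh)
  qed
  obtain W c2 where W: "transpose W = W" "c2 > 0" "\<And>x. K * (x \<bullet> x) \<le> x \<bullet> (W *v x)"
    "\<And>x. 2 * ((W *v x) \<bullet> (S *v x)) \<le> (qh \<bullet> x)\<^sup>2 - c2 * (x \<bullet> x)"
    by (rule low_gain_lyapunov[where K = K, OF S obs]) blast+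
  obtain Bc where Bc: "W *v Bc = qh" "K * norm Bc \<le> norm qh"
    by (rule positive_definite_inverse_bound[OF K W(3)])
  define e where "e = KM * KL * norm Bc"
  have e: "0 \<le> e" "e \<le> e0"
  proof -
    show "0 \<le> e" using KM KL by (simp add: e_def)
    have "norm Bc \<le> norm qh / K" using Bc(2) K by (simp add: field_simps)
    then have "e \<le> KM * KL * (norm qh / K)" unfolding e_def using KM KL by (intro mult_left_mono) auto
    also have "\<dots> \<le> e0"
    proof -
      have "KM * KL * norm qh \<le> e0 * K" using \<open>e0 > 0\<close> by (simp add: K_def algebra_simps)
      then show ?thesis using K by (simp add: field_simps)
    qed
    finally show "e \<le> e0" .
  qed
  \<comment> \<open>In the coordinates \<open>(x - L z, z)\<close> the plant equation contains the error only through \<open>L Bc\<close>.\<close>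
  define y1 where "y1 u = fst u - L *v snd u" for u :: "(real ^ 'n) \<times> (real ^ 'p)"
  define \<beta> where "\<beta> u v = (M *v y1 u) \<bullet> y1 v + k * ((W *v snd u) \<bullet> snd v)"
    for u v :: "(real ^ 'n) \<times> (real ^ 'p)"
  define mu where "mu = min m1 (k * K)"
  define G where "G = 2 + 2 * KL\<^sup>2"
  have G: "(norm u)\<^sup>2 \<le> G * ((norm (y1 u))\<^sup>2 + (norm (snd u))\<^sup>2)" "G > 0" for u
  proof -
    show "G > 0" by (simp add: G_def add_pos_nonneg)
    have "norm (fst u) \<le> norm (y1 u) + norm (L *v snd u)"
      unfolding y1_def using norm_triangle_ineq[of "fst u - L *v snd u" "L *v snd u"] by simp
    then have "norm (fst u) \<le> norm (y1 u) + KL * norm (snd u)" using KL(2)[of "snd u"] by linarith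
    then have "(norm (fst u))\<^sup>2 \<le> (norm (y1 u) + KL * norm (snd u))\<^sup>2" by (intro power_mono) auto
    also have "\<dots> \<le> 2 * (norm (y1 u))\<^sup>2 + 2 * (KL * norm (snd u))\<^sup>2"
      using sum_squares_bound[of "norm (y1 u)" "KL * norm (snd u)"] by (simp add: power2_sum)
    finally have "(norm (fst u))\<^sup>2 + (norm (snd u))\<^sup>2 \<le> 2 * (norm (y1 u))\<^sup>2 + (2 * KL\<^sup>2 + 1) * (norm (snd u))\<^sup>2"
      by (simp add: power_mult_distrib algebra_simps)
    also have "\<dots> \<le> G * (norm (y1 u))\<^sup>2 + G * (norm (snd u))\<^sup>2"
      unfolding G_def by (rule add_mono; rule mult_right_mono) auto
    finally show "(norm u)\<^sup>2 \<le> G * ((norm (y1 u))\<^sup>2 + (norm (snd u))\<^sup>2)"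
      by (simp add: norm_prod_def distrib_left)
  qed
  have mono: "(x / G) * (norm u)\<^sup>2 \<le> y * (norm (y1 u))\<^sup>2 + z * (norm (snd u))\<^sup>2"
    if "0 \<le> x" "x \<le> y" "x \<le> z" for x y z u
  proof -
    have "(x / G) * (norm u)\<^sup>2 \<le> (x / G) * (G * ((norm (y1 u))\<^sup>2 + (norm (snd u))\<^sup>2))"
      using that G by (intro mult_left_mono) auto
    also have "\<dots> = x * (norm (y1 u))\<^sup>2 + x * (norm (snd u))\<^sup>2" using G(2) by (simp add: field_simps)
    also have "\<dots> \<le> y * (norm (y1 u))\<^sup>2 + z * (norm (snd u))\<^sup>2"
      using that by (intro add_mono mult_right_mono) auto
    finally show ?thesis .
  qed
  show ?thesis
  proof (rule that[of \<beta> "mu / G" "min (c1 / 2) (k * c2) / G" Bc])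
    show "\<beta> u v = \<beta> v u" for u v
      unfolding \<beta>_def by (metis M(1) W(1) inner_commute symmetric_inner)
    have "bilinear \<beta>"
      unfolding bilinear_def \<beta>_def y1_def
      by (auto intro!: linearI simp: matrix_vector_right_distrib matrix_vector_mult_diff_distrib
          matrix_vector_mult_scaleR inner_add_left inner_add_right inner_diff_left inner_diff_right algebra_simps)
    then show "bounded_bilinear \<beta>" by (simp add: bilinear_conv_bounded_bilinear)
    show "0 < mu / G" using M(2) k K G(2) by (simp add: mu_def)
    show "0 < min (c1 / 2) (k * c2) / G" using M(3) W(2) k G(2) by simp
    fix u
    have "mu / G * (norm u)\<^sup>2 \<le> m1 * (norm (y1 u))\<^sup>2 + (k * K) * (norm (snd u))\<^sup>2"
      by (rule mono) (use M(2) k K in \<open>auto simp: mu_def\<close>)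
    also have "\<dots> = m1 * (y1 u \<bullet> y1 u) + k * (K * (snd u \<bullet> snd u))"
      by (simp add: power2_norm_eq_inner)
    also have "\<dots> \<le> y1 u \<bullet> (M *v y1 u) + k * (snd u \<bullet> (W *v snd u))"
      using k(1) by (intro add_mono mult_left_mono M(4) W(3)) auto
    also have "\<dots> = \<beta> u u"
      by (simp add: \<beta>_def symmetric_inner[OF M(1)] symmetric_inner[OF W(1)])
    finally show "mu / G * (norm u)\<^sup>2 \<le> \<beta> u u" .
  next
    fix x z
    define xh where "xh = y1 (x, z)"
    have x: "x = xh + L *v z" by (simp add: xh_def y1_def)
    define y where "y = c \<bullet> x + d \<bullet> z"
    have y: "y = c \<bullet> xh - qh \<bullet> z"
      unfolding y_def x d qh by (simp add: Lx inner_add_right inner_diff_right)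
    have dyn: "y1 (A *v x + B *v z, S *v z + y *\<^sub>R Bc) = A *v xh - y *\<^sub>R (L *v Bc)"
      unfolding y1_def x B
      by (simp add: Lx matrix_vector_right_distrib matrix_vector_mult_diff_distrib
          matrix_vector_mult_scaleR Vx algebra_simps)
    have "2 * ((M *v xh) \<bullet> (A *v xh - y *\<^sub>R (L *v Bc))) \<le> - c1 * (norm xh)\<^sup>2 + 2 * (e * norm xh * \<bar>c \<bullet> xh - qh \<bullet> z\<bar>)"
    proof -
      have "- ((M *v xh) \<bullet> (y *\<^sub>R (L *v Bc))) \<le> norm (M *v xh) * norm (y *\<^sub>R (L *v Bc))"
        using norm_cauchy_schwarz[of "M *v xh" "- (y *\<^sub>R (L *v Bc))"] by simp
      also have "\<dots> \<le> (KM * norm xh) * (\<bar>y\<bar> * (KL * norm Bc))"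
        using KM KL unfolding norm_scaleR by (intro mult_mono mult_left_mono) auto
      also have "\<dots> = e * norm xh * \<bar>c \<bullet> xh - qh \<bullet> z\<bar>" by (simp add: e_def y mult_ac)
      finally show ?thesis using M(5)[of xh] by (simp add: inner_diff_right power2_norm_eq_inner)
    qed
    from low_gain_dissipation[OF k e(1) _ _ norm_ge_zero norm_ge_zero _ this, of c2 "(norm z)\<^sup>2"]
    have low: "2 * ((M *v xh) \<bullet> (A *v xh - y *\<^sub>R (L *v Bc)))
        + k * ((qh \<bullet> z)\<^sup>2 - c2 * (norm z)\<^sup>2 + 2 * ((qh \<bullet> z) * (c \<bullet> xh - qh \<bullet> z)))
      \<le> - (c1 / 2) * (norm xh)\<^sup>2 - k * c2 * (norm z)\<^sup>2"
      using e e0(2) order_trans[OF mult_right_mono[OF e(2), of "2 * norm c + 1"] e0c]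
        Cauchy_Schwarz_ineq2[of c xh] by simp
    have "2 * ((W *v z) \<bullet> (S *v z + y *\<^sub>R Bc)) = 2 * ((W *v z) \<bullet> (S *v z)) + 2 * ((qh \<bullet> z) * y)"
    proof -
      have "(W *v z) \<bullet> Bc = qh \<bullet> z"
        using symmetric_inner[OF W(1), of z Bc] Bc(1) by (simp add: inner_commute)
      then show ?thesis by (simp add: inner_add_right mult.commute)
    qed
    also have "\<dots> \<le> (qh \<bullet> z)\<^sup>2 - c2 * (norm z)\<^sup>2 + 2 * ((qh \<bullet> z) * (c \<bullet> xh - qh \<bullet> z))"
      using W(4)[of z] by (simp add: y power2_norm_eq_inner)
    finally have "k * (2 * ((W *v z) \<bullet> (S *v z + y *\<^sub>R Bc))) \<le>
        k * ((qh \<bullet> z)\<^sup>2 - c2 * (norm z)\<^sup>2 + 2 * ((qh \<bullet> z) * (c \<bullet> xh - qh \<bullet> z)))"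
      using k(1) by (intro mult_left_mono) auto
    then have "2 * \<beta> (x, z) (A *v x + B *v z, S *v z + y *\<^sub>R Bc) \<le> - (c1 / 2) * (norm xh)\<^sup>2 - k * c2 * (norm z)\<^sup>2"
      using low unfolding \<beta>_def dyn xh_def[symmetric] by simp
    moreover have "min (c1 / 2) (k * c2) / G * (norm (x, z))\<^sup>2 \<le> c1 / 2 * (norm (y1 (x, z)))\<^sup>2 + (k * c2) * (norm (snd (x, z)))\<^sup>2"
      by (rule mono) (use M(3) W(2) k in auto)
    ultimately show "2 * \<beta> (x, z) (A *v x + B *v z, S *v z + (c \<bullet> x + d \<bullet> z) *\<^sub>R Bc)
        \<le> - (min (c1 / 2) (k * c2) / G) * (norm (x, z))\<^sup>2"
      unfolding y_def xh_def by simp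
  qed
qed

section \<open>Closed loops\<close>

definition closed_loop where
  "closed_loop f h s \<eta> \<theta> = (\<lambda>(x, \<xi>, w). (f x (\<theta> \<xi>) w, \<eta> \<xi> (h x (\<theta> \<xi>) w), s w))"

definition unforced_loop where
  "unforced_loop f h \<eta> \<theta> = (\<lambda>(x, \<xi>). (f x (\<theta> \<xi>) 0, \<eta> \<xi> (h x (\<theta> \<xi>) 0)))"

definition loop_error where
  "loop_error h \<theta> = (\<lambda>(x, \<xi>, w). h x (\<theta> \<xi>) w)"

lemma solves_regulator_problem_loop:
  "solves_regulator_problem f h s X W Xc \<eta> \<theta> \<longleftrightarrow>
    locally_exp_stable_origin (unforced_loop f h \<eta> \<theta>) (X \<times> Xc) \<and>
    (\<exists>N. open N \<and> 0 \<in> N \<and> N \<subseteq> X \<times> Xc \<times> W \<and>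
      (\<forall>a\<in>N. \<exists>z. ode_solution (closed_loop f h s \<eta> \<theta>) (X \<times> Xc \<times> W) {0..} a z \<and>
        (\<forall>z'. ode_solution (closed_loop f h s \<eta> \<theta>) (X \<times> Xc \<times> W) {0..} a z' \<longrightarrow> (\<forall>t\<ge>0. z' t = z t)) \<and>
        ((\<lambda>t. loop_error h \<theta> (z t)) \<longlongrightarrow> 0) at_top))"
  by (simp add: solves_regulator_problem_def unforced_loop_def closed_loop_def loop_error_def Let_def)

lemma closed_loop_strict_derivative:
  assumes f: "strict_derivative (\<lambda>(x, u, w). f x u w) F' (x0, \<theta> \<xi>0, w0)"
    and h: "strict_derivative (\<lambda>(x, u, w). h x u w) H' (x0, \<theta> \<xi>0, w0)"
    and \<theta>: "strict_derivative \<theta> T' \<xi>0"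
    and \<eta>: "strict_derivative (\<lambda>(\<xi>, e). \<eta> \<xi> e) E' (\<xi>0, h x0 (\<theta> \<xi>0) w0)"
    and s: "strict_derivative s S' w0"
  shows "strict_derivative (closed_loop f h s \<eta> \<theta>)
      (\<lambda>(x, \<xi>, w). (F' (x, T' \<xi>, w), E' (\<xi>, H' (x, T' \<xi>, w)), S' w)) (x0, \<xi>0, w0)"
    and "strict_derivative (loop_error h \<theta>) (\<lambda>(x, \<xi>, w). H' (x, T' \<xi>, w)) (x0, \<xi>0, w0)"
proof -
  let ?p = "(x0, \<xi>0, w0)"
  have x: "strict_derivative (\<lambda>p. fst p) (\<lambda>p. fst p) ?p"
    and xi: "strict_derivative (\<lambda>p. fst (snd p)) (\<lambda>p. fst (snd p)) ?p"
    and w: "strict_derivative (\<lambda>p. snd (snd p)) (\<lambda>p. snd (snd p)) ?p"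
    by (intro strict_derivative_bounded_linear bounded_linear_intros)+
  have th: "strict_derivative (\<lambda>p. \<theta> (fst (snd p))) (\<lambda>p. T' (fst (snd p))) ?p"
    using strict_derivative_compose[OF xi, of \<theta> T'] \<theta> by simp
  note xuw = strict_derivative_Pair[OF x strict_derivative_Pair[OF th w]]
  have hc: "strict_derivative (\<lambda>p. h (fst p) (\<theta> (fst (snd p))) (snd (snd p)))
      (\<lambda>p. H' (fst p, T' (fst (snd p)), snd (snd p))) ?p"
    using strict_derivative_compose[OF xuw, of "\<lambda>(x, u, w). h x u w" H'] h by simp
  then show "strict_derivative (loop_error h \<theta>) (\<lambda>(x, \<xi>, w). H' (x, T' \<xi>, w)) ?p"
    by (simp add: loop_error_def case_prod_unfold)
  have fc: "strict_derivative (\<lambda>p. f (fst p) (\<theta> (fst (snd p))) (snd (snd p)))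
      (\<lambda>p. F' (fst p, T' (fst (snd p)), snd (snd p))) ?p"
    using strict_derivative_compose[OF xuw, of "\<lambda>(x, u, w). f x u w" F'] f by simp
  have ec: "strict_derivative (\<lambda>p. \<eta> (fst (snd p)) (h (fst p) (\<theta> (fst (snd p))) (snd (snd p))))
      (\<lambda>p. E' (fst (snd p), H' (fst p, T' (fst (snd p)), snd (snd p)))) ?p"
    using strict_derivative_compose[OF strict_derivative_Pair[OF xi hc], of "\<lambda>(\<xi>, e). \<eta> \<xi> e" E'] \<eta> by simp
  have sc: "strict_derivative (\<lambda>p. s (snd (snd p))) (\<lambda>p. S' (snd (snd p))) ?p"
    using strict_derivative_compose[OF w, of s S'] s by simp
  show "strict_derivative (closed_loop f h s \<eta> \<theta>)
      (\<lambda>(x, \<xi>, w). (F' (x, T' \<xi>, w), E' (\<xi>, H' (x, T' \<xi>, w)), S' w)) ?p"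
    using strict_derivative_Pair[OF fc strict_derivative_Pair[OF ec sc]]
    by (simp add: closed_loop_def case_prod_unfold)
qed

lemma unforced_loop_strict_derivative:
  fixes \<eta> :: "'z::real_normed_vector \<Rightarrow> real \<Rightarrow> 'z"
  assumes "strict_derivative (closed_loop f h s \<eta> \<theta>) D (x0, \<xi>0, 0)"
  shows "strict_derivative (unforced_loop f h \<eta> \<theta>)
    (\<lambda>(x, \<xi>). (fst (D (x, \<xi>, 0)), fst (snd (D (x, \<xi>, 0))))) (x0, \<xi>0)"
proof -
  have "bounded_linear (\<lambda>p. (fst p, snd p, 0))" by (intro bounded_linear_intros)
  then have "strict_derivative (\<lambda>p. (fst p, snd p, 0)) (\<lambda>p. (fst p, snd p, 0)) (x0, \<xi>0)"
    by (rule strict_derivative_bounded_linear)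
  from strict_derivative_compose[OF this, of "closed_loop f h s \<eta> \<theta>" D] assms
  have "strict_derivative (\<lambda>p. closed_loop f h s \<eta> \<theta> (fst p, snd p, 0)) (\<lambda>p. D (fst p, snd p, 0)) (x0, \<xi>0)"
    by simp
  from strict_derivative_linear_compose[OF this, of "\<lambda>q. (fst q, fst (snd q))"]
  show ?thesis by (simp add: closed_loop_def unforced_loop_def case_prod_unfold bounded_linear_intros)
qed

text \<open>
  The plant and exosystem in terms of strict derivatives: \<open>f'\<close> and \<open>h'\<close> are the derivatives at the origin,
  and detectability is expressed through the real and imaginary parts \<open>(a, b)\<close> and \<open>(a', b')\<close> of a vector.
\<close>

locale plant_exosystem =
  fixes f :: "real ^ 'n \<Rightarrow> real \<Rightarrow> real ^ 'p \<Rightarrow> real ^ 'n"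
    and h :: "real ^ 'n \<Rightarrow> real \<Rightarrow> real ^ 'p \<Rightarrow> real"
    and s :: "real ^ 'p \<Rightarrow> real ^ 'p"
    and X :: "(real ^ 'n) set" and U Ye :: "real set" and W :: "(real ^ 'p) set"
    and f' :: "(real ^ 'n) \<times> real \<times> (real ^ 'p) \<Rightarrow> real ^ 'n"
    and h' :: "(real ^ 'n) \<times> real \<times> (real ^ 'p) \<Rightarrow> real"
    and S :: "real ^ 'p ^ 'p"
  assumes X: "open X" "0 \<in> X" and U: "open U" "0 \<in> U" and W: "open W" "0 \<in> W" and Ye: "open Ye" "0 \<in> Ye"
    and f0: "f 0 0 0 = 0" and h0: "h 0 0 0 = 0" and s0: "s 0 = 0"
    and f_strict: "\<And>x u w. x \<in> X \<Longrightarrow> u \<in> U \<Longrightarrow> w \<in> W \<Longrightarrow> \<exists>D. strict_derivative (\<lambda>(x, u, w). f x u w) D (x, u, w)"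
    and h_strict: "\<And>x u w. x \<in> X \<Longrightarrow> u \<in> U \<Longrightarrow> w \<in> W \<Longrightarrow> \<exists>D. strict_derivative (\<lambda>(x, u, w). h x u w) D (x, u, w)"
    and s_C2: "C2_on s W"
    and f': "strict_derivative (\<lambda>(x, u, w). f x u w) f' (0, 0, 0)"
    and h': "strict_derivative (\<lambda>(x, u, w). h x u w) h' (0, 0, 0)"
    and s': "strict_derivative s ((*v) S) 0"
    and h_Ye: "\<And>x u w. x \<in> X \<Longrightarrow> u \<in> U \<Longrightarrow> w \<in> W \<Longrightarrow> h x u w \<in> Ye"
    and stable: "lyapunov_stable_origin s W"
    and nonw: "\<And>w. w \<in> W \<Longrightarrow> nonwandering s W w"
    and hurwitz: "hurwitz (matrix (\<lambda>x. f' (x, 0, 0)))"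
    and detect: "\<And>a a' b b' r t. f' (a, 0, b) = r *\<^sub>R a - t *\<^sub>R a' \<Longrightarrow> f' (a', 0, b') = r *\<^sub>R a' + t *\<^sub>R a \<Longrightarrow>
      S *v b = r *\<^sub>R b - t *\<^sub>R b' \<Longrightarrow> S *v b' = r *\<^sub>R b' + t *\<^sub>R b \<Longrightarrow>
      h' (a, 0, b) = 0 \<Longrightarrow> h' (a', 0, b') = 0 \<Longrightarrow> 0 \<le> r \<Longrightarrow> b = 0 \<and> b' = 0"
begin

lemma exosystem_spectrum_imaginary: "complex_eigenvalue (complex_matrix S) l \<Longrightarrow> Re l = 0"
  using exosystem_spectrum_nonneg[OF W s_C2 s' s0 stable nonw] exosystem_spectrum_nonpos[OF W s_C2 s' s0 stable]
  by (metis order_antisym)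

lemma closed_loop_locally_lipschitz:
  fixes \<eta> :: "'z::real_inner \<Rightarrow> real \<Rightarrow> 'z"
  assumes c: "controller U Ye Xc \<eta> \<theta>"
  shows "locally_lipschitz (closed_loop f h s \<eta> \<theta>) (X \<times> Xc \<times> W)"
    and "locally_lipschitz (unforced_loop f h \<eta> \<theta>) (X \<times> Xc)"
proof -
  have sd: "\<exists>D. strict_derivative (closed_loop f h s \<eta> \<theta>) D (x1, \<xi>1, w1)"
    if "x1 \<in> X" "\<xi>1 \<in> Xc" and w1: "w1 \<in> W" for x1 \<xi>1 w1
  proof -
    note xi = \<open>\<xi>1 \<in> Xc\<close>
    have in1: "x1 \<in> X" "\<theta> \<xi>1 \<in> U" using that c by (auto simp: controller_def)
    have cc: "open Xc" "open (Xc \<times> Ye)" "C2_on \<theta> Xc" "C2_on (\<lambda>(\<xi>, e). \<eta> \<xi> e) (Xc \<times> Ye)"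
      using c Ye by (auto simp: controller_def open_Times)
    obtain F' where F': "strict_derivative (\<lambda>(x, u, w). f x u w) F' (x1, \<theta> \<xi>1, w1)"
      using f_strict in1 w1 by blast
    obtain H' where H': "strict_derivative (\<lambda>(x, u, w). h x u w) H' (x1, \<theta> \<xi>1, w1)"
      using h_strict in1 w1 by blast
    obtain T' where T': "strict_derivative \<theta> T' \<xi>1" by (rule C2_on_strict_derivative[OF cc(3,1) xi])
    have "(\<xi>1, h x1 (\<theta> \<xi>1) w1) \<in> Xc \<times> Ye" using xi in1 w1 h_Ye by simp
    from C2_on_strict_derivative[OF cc(4,2) this]
    obtain E' where E': "strict_derivative (\<lambda>(\<xi>, e). \<eta> \<xi> e) E' (\<xi>1, h x1 (\<theta> \<xi>1) w1)" .
    obtain S' where S': "strict_derivative s S' w1" by (rule C2_on_strict_derivative[OF s_C2 W(1) w1])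
    show ?thesis using closed_loop_strict_derivative(1)[OF F' H' T' E' S'] by blast
  qed
  show "locally_lipschitz (closed_loop f h s \<eta> \<theta>) (X \<times> Xc \<times> W)"
    using sd by (intro strict_derivative_locally_lipschitz) auto
  show "locally_lipschitz (unforced_loop f h \<eta> \<theta>) (X \<times> Xc)"
  proof (rule strict_derivative_locally_lipschitz)
    fix p assume "p \<in> X \<times> Xc"
    then show "\<exists>D. strict_derivative (unforced_loop f h \<eta> \<theta>) D p"
      using sd[OF _ _ W(2), of "fst p" "snd p"] unforced_loop_strict_derivative by fastforce
  qed
qed

end

section \<open>The controller that copies the exosystem\<close>

locale feedforward = plant_exosystem f h s X U Ye W f' h' S
  for f :: "real ^ 'n \<Rightarrow> real \<Rightarrow> real ^ 'p \<Rightarrow> real ^ 'n" and h s X U Ye W f' h' S +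
  fixes Wo :: "(real ^ 'p) set" and \<pi> :: "real ^ 'p \<Rightarrow> real ^ 'n" and \<gamma> :: "real ^ 'p \<Rightarrow> real"
  assumes Wo: "open Wo" "0 \<in> Wo" "Wo \<subseteq> W"
    and \<pi>: "C2_on \<pi> Wo" "\<pi> 0 = 0" "\<And>w. w \<in> Wo \<Longrightarrow> \<pi> w \<in> X"
    and \<gamma>: "C2_on \<gamma> Wo" "\<gamma> 0 = 0" "\<And>w. w \<in> Wo \<Longrightarrow> \<gamma> w \<in> U"
    and invariance: "\<And>w. w \<in> Wo \<Longrightarrow> jacobian \<pi> (at w) *v s w = f (\<pi> w) (\<gamma> w) w"
    and zero_error: "\<And>w. w \<in> Wo \<Longrightarrow> h (\<pi> w) (\<gamma> w) w = 0"
begin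

lemma \<pi>_derivative:
  assumes "w \<in> Wo"
  shows "(\<pi> has_derivative (\<lambda>v. jacobian \<pi> (at w) *v v)) (at w)"
proof -
  obtain D where "strict_derivative \<pi> D w" by (rule C2_on_strict_derivative[OF \<pi>(1) Wo(1) assms])
  then have "\<pi> differentiable (at w)"
    using strict_derivative_has_derivative differentiable_def by blast
  then show ?thesis using jacobian_works by blast
qed

lemma linear_regulator_equations:
  obtains R \<gamma>' where "strict_derivative \<pi> ((*v) R) 0" "strict_derivative \<gamma> \<gamma>' 0"
    "\<And>w. R *v (S *v w) = f' (R *v w, \<gamma>' w, w)" "\<And>w. h' (R *v w, \<gamma>' w, w) = 0"
proof -
  obtain \<pi>' \<pi>'' where d1: "\<And>x. x \<in> Wo \<Longrightarrow> (\<pi> has_derivative blinfun_apply (\<pi>' x)) (at x)"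
    and d2: "\<And>x. x \<in> Wo \<Longrightarrow> (\<pi>' has_derivative blinfun_apply (\<pi>'' x)) (at x)"
    using \<pi>(1) unfolding C2_on_def by blast
  obtain D where D: "strict_derivative \<pi> D 0" by (rule C2_on_strict_derivative[OF \<pi>(1) Wo(1,2)])
  obtain \<gamma>' where \<gamma>': "strict_derivative \<gamma> \<gamma>' 0" by (rule C2_on_strict_derivative[OF \<gamma>(1) Wo(1,2)])
  have Deq: "D = blinfun_apply (\<pi>' 0)"
    by (rule has_derivative_unique[OF strict_derivative_has_derivative[OF D] d1[OF Wo(2)]])
  define R where "R = matrix D"
  have R: "R *v v = D v" for v
    unfolding R_def using strict_derivative_linear[OF D] by (simp add: bounded_linear.linear matrix_works)
  have sd: "strict_derivative \<pi> ((*v) R) 0" proof -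
    have "(*v) R = D" using R by (rule ext)
    then show ?thesis using D by simp
  qed
  have w: "strict_derivative (\<lambda>w. w) (\<lambda>w. w) (0 :: real ^ 'p)"
    by (intro strict_derivative_bounded_linear bounded_linear_ident)
  note p = strict_derivative_Pair[OF D strict_derivative_Pair[OF \<gamma>' w]]
  have df: "strict_derivative (\<lambda>w. f (\<pi> w) (\<gamma> w) w) (\<lambda>w. f' (D w, \<gamma>' w, w)) 0"
    using strict_derivative_compose[OF p, of "\<lambda>(x, u, w). f x u w" f'] f' by (simp add: \<pi>(2) \<gamma>(2))
  have dh: "strict_derivative (\<lambda>w. h (\<pi> w) (\<gamma> w) w) (\<lambda>w. h' (D w, \<gamma>' w, w)) 0"
    using strict_derivative_compose[OF p, of "\<lambda>(x, u, w). h x u w" h'] h' by (simp add: \<pi>(2) \<gamma>(2))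
  \<comment> \<open>The derivative of \<open>w \<mapsto> \<pi>'(w) s(w)\<close> at the origin contains no second derivative of \<open>\<pi>\<close>, because \<open>s 0 = 0\<close>.\<close>
  have "((\<lambda>w. blinfun_apply (\<pi>' w) (s w)) has_derivative
      (\<lambda>v. blinfun_apply (\<pi>' 0) (S *v v) + blinfun_apply (blinfun_apply (\<pi>'' 0) v) (s 0))) (at 0)"
    by (rule bounded_bilinear.FDERIV[OF bounded_bilinear_blinfun_apply d2[OF Wo(2)]
          strict_derivative_has_derivative[OF s']])
  then have "((\<lambda>w. f (\<pi> w) (\<gamma> w) w) has_derivative
      (\<lambda>v. blinfun_apply (\<pi>' 0) (S *v v) + blinfun_apply (blinfun_apply (\<pi>'' 0) v) (s 0))) (at 0)"
  proof (rule has_derivative_transform_within_open[OF _ Wo(1,2)])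
    fix w assume w: "w \<in> Wo"
    have "blinfun_apply (\<pi>' w) = (\<lambda>v. jacobian \<pi> (at w) *v v)"
      by (rule has_derivative_unique[OF d1[OF w] \<pi>_derivative[OF w]])
    then show "blinfun_apply (\<pi>' w) (s w) = f (\<pi> w) (\<gamma> w) w" using invariance[OF w] by simp
  qed
  from has_derivative_unique[OF this strict_derivative_has_derivative[OF df]]
  have 1: "D (S *v v) = f' (D v, \<gamma>' v, v)" for v
    by (simp add: fun_eq_iff s0 Deq blinfun.zero_right)
  have "((\<lambda>w. 0) has_derivative (\<lambda>v. 0)) (at (0 :: real ^ 'p))" by simp
  then have "((\<lambda>w. h (\<pi> w) (\<gamma> w) w) has_derivative (\<lambda>v. 0)) (at 0)"
    by (rule has_derivative_transform_within_open[OF _ Wo(1,2)]) (simp add: zero_error)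
  from has_derivative_unique[OF this strict_derivative_has_derivative[OF dh]]
  have 2: "h' (D v, \<gamma>' v, v) = 0" for v by (simp add: fun_eq_iff)
  show ?thesis by (rule that[OF sd \<gamma>']) (use 1 2 R in simp_all)
qed

lemma stabilizing_gain:
  obtains Bc \<beta> m g \<gamma>' where "strict_derivative \<gamma> \<gamma>' 0" "bounded_bilinear \<beta>" "\<And>u v. \<beta> u v = \<beta> v u"
    "m > 0" "\<And>u. m * (norm u)\<^sup>2 \<le> \<beta> u u" "g > 0"
    "\<And>x z. 2 * \<beta> (x, z) (f' (x, \<gamma>' z, 0), S *v z + h' (x, \<gamma>' z, 0) *\<^sub>R Bc) \<le> - g * (norm (x, z))\<^sup>2"
proof -
  obtain R \<gamma>' where R: "strict_derivative \<pi> ((*v) R) 0" and \<gamma>': "strict_derivative \<gamma> \<gamma>' 0"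
    and R1: "\<And>w. R *v (S *v w) = f' (R *v w, \<gamma>' w, w)" and R2: "\<And>w. h' (R *v w, \<gamma>' w, w) = 0"
    by (rule linear_regulator_equations) blast
  have linf: "linear f'" and linh: "linear h'" and ling: "linear \<gamma>'"
    using f' h' \<gamma>' strict_derivative_linear bounded_linear.linear by blast+
  define A where "A = matrix (\<lambda>x. f' (x, 0, 0))"
  define P where "P = matrix (\<lambda>w. f' (0, 0, w))"
  define B where "B = matrix (\<lambda>w. f' (0, \<gamma>' w, 0))"
  define c where "c = (\<chi> i. h' (axis i 1, 0, 0))"
  define q where "q = (\<chi> i. h' (0, 0, axis i 1))"
  define d where "d = (\<chi> i. h' (0, \<gamma>' (axis i 1), 0))"
  have emb1: "linear (\<lambda>x. (x, 0, 0) :: (real ^ 'n) \<times> real \<times> (real ^ 'p))"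
      "linear (\<lambda>w. (0, 0, w) :: (real ^ 'n) \<times> real \<times> (real ^ 'p))"
      "linear (\<lambda>w. (0, \<gamma>' w, 0) :: (real ^ 'n) \<times> real \<times> (real ^ 'p))"
    by (intro linearI; simp add: linear_add[OF ling] linear_scale[OF ling])+
  have lin1: "linear (\<lambda>x. f' (x, 0, 0))" "linear (\<lambda>w. f' (0, 0, w))" "linear (\<lambda>w. f' (0, \<gamma>' w, 0))"
    and lin2: "linear (\<lambda>x. h' (x, 0, 0))" "linear (\<lambda>w. h' (0, 0, w))" "linear (\<lambda>w. h' (0, \<gamma>' w, 0))"
    using emb1[THEN linear_compose, OF linf] emb1[THEN linear_compose, OF linh] by (simp_all add: o_def)
  have A: "A *v x = f' (x, 0, 0)" and P: "P *v w = f' (0, 0, w)" and B: "B *v w = f' (0, \<gamma>' w, 0)" for x w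
    unfolding A_def P_def B_def using lin1 by (simp_all add: matrix_works)
  have dot: "(\<chi> i. l (axis i 1)) \<bullet> x = l x" if "linear l" for l :: "real ^ 'k \<Rightarrow> real" and x
  proof -
    have "l x = l (\<Sum>i\<in>UNIV. x $ i *\<^sub>R axis i 1)"
      by (simp add: basis_expansion scalar_mult_eq_scaleR[symmetric])
    also have "\<dots> = (\<Sum>i\<in>UNIV. x $ i * l (axis i 1))"
      by (simp add: linear_sum[OF that] linear_scale[OF that])
    finally show ?thesis by (simp add: inner_vec_def mult.commute)
  qed
  have c: "c \<bullet> x = h' (x, 0, 0)" and q: "q \<bullet> w = h' (0, 0, w)" and d: "d \<bullet> w = h' (0, \<gamma>' w, 0)" for x w
    unfolding c_def q_def d_def using dot[OF lin2(1)] dot[OF lin2(2)] dot[OF lin2(3)] by auto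
  have f3: "f' (x, \<gamma>' v, w) = A *v x + B *v v + P *v w" for x v w
    unfolding A B P by (simp add: linear_add[OF linf, symmetric])
  have h3: "h' (x, \<gamma>' v, w) = c \<bullet> x + d \<bullet> v + q \<bullet> w" for x v w
    unfolding c d q by (simp add: linear_add[OF linh, symmetric])
  obtain Bc \<beta> m g where \<beta>: "bounded_bilinear \<beta>" "\<And>u v. \<beta> u v = \<beta> v u" and m: "m > 0"
    "\<And>u. m * (norm u)\<^sup>2 \<le> \<beta> u u" and g: "g > 0"
    "\<And>x z. 2 * \<beta> (x, z) (A *v x + B *v z, S *v z + (c \<bullet> x + d \<bullet> z) *\<^sub>R Bc) \<le> - g * (norm (x, z))\<^sup>2"
  proof (rule stabilizing_output_injection[of A S P c q B R d])
    show "hurwitz A" using hurwitz unfolding A_def .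
    show "Re l = 0" if "complex_eigenvalue (complex_matrix S) l" for l by (rule exosystem_spectrum_imaginary[OF that])
    show "B *v w = R *v (S *v w) - A *v (R *v w) - P *v w" for w
      unfolding R1 f3 by simp
    show "d \<bullet> w = - (c \<bullet> (R *v w)) - q \<bullet> w" for w using R2[of w] unfolding h3 by simp
    fix a a' b b' t
    assume e: "A *v a + P *v b = - t *\<^sub>R a'" "A *v a' + P *v b' = t *\<^sub>R a"
      "S *v b = - t *\<^sub>R b'" "S *v b' = t *\<^sub>R b" "c \<bullet> a + q \<bullet> b = 0" "c \<bullet> a' + q \<bullet> b' = 0"
    have "f' (a, 0, b) = A *v a + P *v b" "h' (a, 0, b) = c \<bullet> a + q \<bullet> b" for a b
      unfolding A P c q by (simp_all add: linear_add[OF linf, symmetric] linear_add[OF linh, symmetric])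
    then show "b = 0 \<and> b' = 0" using detect[of a b 0 t a' b'] e by simp
  qed (use that in blast)
  show ?thesis
    by (rule that[OF \<gamma>' \<beta> m g(1)]) (use g(2) f3[of _ _ 0] h3[of _ _ 0] in simp)
qed

text \<open>
  The state of the closed loop with exosystem state \<open>w\<close> and deviation \<open>z\<close> from the invariant graph of
  \<open>\<pi>\<close> and of the identity, on which the error is zero.
\<close>

definition frame where "frame w z = (\<pi> w + fst z, w + snd z, w)"

lemma frame_diff: "frame w y - frame w z = (fst (y - z), snd (y - z), 0)"
  by (simp add: frame_def)

lemma loop_error_frame: "w \<in> Wo \<Longrightarrow> loop_error h \<gamma> (frame w 0) = 0"
  by (simp add: loop_error_def frame_def zero_error)

text \<open>
  In the coordinates given by \<open>frame\<close> the deviation satisfies a differential equation driven by the exosystem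
  trajectory. Its field vanishes at zero by the regulator equations, and its derivative at the origin is
  the stable matrix of \<open>stabilizing_gain\<close>.
\<close>

lemma driven_closed_loop:
  obtains Bc M \<alpha> \<epsilon> r where "M > 0" "\<alpha> > 0" "\<epsilon> > 0" "r > 0"
    "\<And>w a. (\<And>t. 0 \<le> t \<Longrightarrow> (w has_vector_derivative s (w t)) (at t within {0..})) \<Longrightarrow>
      (\<And>t. 0 \<le> t \<Longrightarrow> norm (w t) < \<epsilon>) \<Longrightarrow> norm a < r \<Longrightarrow>
      \<exists>z. z 0 = a \<and> (\<forall>t\<ge>0. norm (z t) \<le> M * exp (- \<alpha> * t) * norm a) \<and>
        ode_solution (closed_loop f h s (\<lambda>\<xi> e. s \<xi> + e *\<^sub>R Bc) \<gamma>) (X \<times> Wo \<times> W) {0..}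
          (frame (w 0) a) (\<lambda>t. frame (w t) (z t)) \<and>
        ((\<lambda>t. loop_error h \<gamma> (frame (w t) (z t))) \<longlongrightarrow> 0) at_top"
proof -
  obtain Bc \<beta> m g \<gamma>' where \<gamma>': "strict_derivative \<gamma> \<gamma>' 0"
    and \<beta>: "bounded_bilinear \<beta>" "\<And>u v. \<beta> u v = \<beta> v u" and m: "m > 0"
    "\<And>u. m * (norm u)\<^sup>2 \<le> \<beta> u u" and g: "g > 0"
    "\<And>x z. 2 * \<beta> (x, z) (f' (x, \<gamma>' z, 0), S *v z + h' (x, \<gamma>' z, 0) *\<^sub>R Bc) \<le> - g * (norm (x, z))\<^sup>2"
    by (rule stabilizing_gain) blast
  define cl where "cl = closed_loop f h s (\<lambda>\<xi> e. s \<xi> + e *\<^sub>R Bc) \<gamma>"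
  define Gc where "Gc p = (fst (cl p), fst (snd (cl p)))" for p
  define Gl where "Gl = (\<lambda>(x, \<xi>, w). (f' (x, \<gamma>' \<xi>, w), S *v \<xi> + h' (x, \<gamma>' \<xi>, w) *\<^sub>R Bc))"
  have out: "strict_derivative (\<lambda>(\<xi>, e). s \<xi> + e *\<^sub>R Bc) (\<lambda>(\<xi>, e). S *v \<xi> + e *\<^sub>R Bc) (0, 0)"
  proof -
    have fs: "strict_derivative fst fst (0 :: real ^ 'p, 0 :: real)" by (rule strict_derivative_fst)
    have e: "strict_derivative (\<lambda>p. snd p *\<^sub>R Bc) (\<lambda>p. snd p *\<^sub>R Bc) (0 :: real ^ 'p, 0 :: real)"
      by (intro strict_derivative_bounded_linear bounded_linear_scaleR_const bounded_linear_snd)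
    have "strict_derivative (\<lambda>p. s (fst p)) (\<lambda>p. S *v fst p) (0 :: real ^ 'p, 0 :: real)"
      using strict_derivative_compose[OF fs, of s "(*v) S"] s' by simp
    from strict_derivative_add[OF this e] show ?thesis by (simp add: case_prod_unfold)
  qed
  have sdall: "strict_derivative cl
      (\<lambda>(x, \<xi>, w). (f' (x, \<gamma>' \<xi>, w), S *v \<xi> + h' (x, \<gamma>' \<xi>, w) *\<^sub>R Bc, S *v w)) (0, 0, 0)"
    and sdh: "strict_derivative (loop_error h \<gamma>) (\<lambda>(x, \<xi>, w). h' (x, \<gamma>' \<xi>, w)) (0, 0, 0)"
    using closed_loop_strict_derivative[of f f' 0 \<gamma> 0 0 h h' \<gamma>' "\<lambda>\<xi> e. s \<xi> + e *\<^sub>R Bc"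
        "\<lambda>(\<xi>, e). S *v \<xi> + e *\<^sub>R Bc" s "(*v) S"] f' h' \<gamma>' s' out
    by (simp_all add: \<gamma>(2) h0 cl_def)
  have sdG: "strict_derivative Gc Gl (0, 0, 0)"
    using strict_derivative_linear_compose[OF sdall, of "\<lambda>p. (fst p, fst (snd p))"]
    by (simp add: Gc_def[abs_def] Gl_def case_prod_unfold bounded_linear_intros)
  define J where "J z = Gl (fst z, snd z, 0)" for z
  have J: "bounded_linear J"
    unfolding J_def
    by (intro bounded_linear_compose[OF strict_derivative_linear[OF sdG]] bounded_linear_intros)
  have gJ: "2 * \<beta> u (J u) \<le> - g * (norm u)\<^sup>2" for u
    using g(2)[of "fst u" "snd u"] by (simp add: J_def Gl_def)
  obtain K where K: "K > 0" "\<And>x y. \<beta> x y \<le> K * norm x * norm y"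
  proof -
    obtain K where "K > 0" "\<And>x y. norm (\<beta> x y) \<le> norm x * norm y * K"
      using bounded_bilinear.pos_bounded[OF \<beta>(1)] by blast
    then show ?thesis using that[of K] by (metis abs_le_D1 mult.commute mult.left_commute real_norm_def)
  qed
  define k where "k = g / (4 * K)"
  have k: "k > 0" using g K by (simp add: k_def)
  obtain r1 where r1: "r1 > 0" "\<And>y z. y \<in> ball (0, 0, 0) r1 \<Longrightarrow> z \<in> ball (0, 0, 0) r1 \<Longrightarrow>
      norm (Gc y - Gc z - Gl (y - z)) \<le> k * norm (y - z)"
    by (rule strict_derivativeE[OF sdG k]) blast
  obtain r2 Lh where r2: "r2 > 0" "Lh > 0" "\<And>y z. y \<in> ball (0, 0, 0) r2 \<Longrightarrow> z \<in> ball (0, 0, 0) r2 \<Longrightarrow>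
      norm (loop_error h \<gamma> y - loop_error h \<gamma> z) \<le> Lh * norm (y - z)"
    by (rule strict_derivative_lipschitz[OF sdh]) blast
  have "open (X \<times> Wo \<times> W)" "(0, 0, 0) \<in> X \<times> Wo \<times> W"
    using X Wo W by (auto intro!: open_Times)
  then obtain r3 where r3: "r3 > 0" "ball (0, 0, 0) r3 \<subseteq> X \<times> Wo \<times> W"
    using open_contains_ball by blast
  obtain r4 Lp where r4: "r4 > 0" "Lp > 0" "\<And>y z. y \<in> ball 0 r4 \<Longrightarrow> z \<in> ball 0 r4 \<Longrightarrow>
      norm (\<pi> y - \<pi> z) \<le> Lp * norm (y - z)"
    by (rule C2_on_strict_derivative[OF \<pi>(1) Wo(1,2)], rule strict_derivative_lipschitz) blast+
  define r where "r = min r1 (min r2 r3)"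
  have r: "r > 0" using r1 r2 r3 by (simp add: r_def)
  define \<epsilon> where "\<epsilon> = min r4 (r / (4 * (Lp + 2)))"
  have \<epsilon>: "\<epsilon> > 0" using r r4 by (simp add: \<epsilon>_def)
  define M where "M = sqrt (K / m)"
  have M: "M > 0" using K m by (simp add: M_def)
  have frame_norm: "norm (frame w z) < r" if w: "norm w < \<epsilon>" and z: "norm z \<le> r / 4" for w z
  proof -
    have "norm (\<pi> w) \<le> Lp * norm w" using r4(3)[of w 0] w r4(1) by (simp add: \<epsilon>_def \<pi>(2))
    moreover have "norm (frame w 0) \<le> norm (\<pi> w) + (norm w + norm w)"
      using norm_Pair_le[of "\<pi> w" "(w, w)"] norm_Pair_le[of w w] by (simp add: frame_def)
    moreover have "(Lp + 2) * norm w \<le> (Lp + 2) * (r / (4 * (Lp + 2)))"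
      using w r4 by (intro mult_left_mono) (auto simp: \<epsilon>_def)
    moreover have "(Lp + 2) * (r / (4 * (Lp + 2))) = r / 4"
    proof -
      have "Lp + 2 \<noteq> 0" using r4(2) by linarith
      then show ?thesis by (simp add: divide_simps)
    qed
    moreover have "(Lp + 2) * norm w = Lp * norm w + (norm w + norm w)" by (simp add: algebra_simps)
    ultimately have 1: "norm (frame w 0) \<le> r / 4" by linarith
    have "frame w z = frame w 0 + (fst z, snd z, 0)" by (simp add: frame_def)
    then have "norm (frame w z) \<le> norm (frame w 0) + norm (fst z, snd z, 0 :: real ^ 'p)"
      by (metis norm_triangle_ineq)
    moreover have "norm (fst z, snd z, 0 :: real ^ 'p) = norm z" by (simp add: norm_prod_def)
    ultimately show ?thesis using 1 z r by linarith
  qed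
  \<comment> \<open>The difference of the field at the state and at the corresponding point of the invariant graph, with its linear part removed.\<close>
  define \<rho> where "\<rho> w z = Gc (frame w z) - Gc (frame w 0) - J z" for w z
  have \<rho>lip: "norm (\<rho> w x - \<rho> w y) \<le> k * norm (x - y)"
    if w: "norm w < \<epsilon>" and xy: "x \<in> cball 0 (r / 4)" "y \<in> cball 0 (r / 4)" for w x y
  proof -
    have "\<rho> w x - \<rho> w y = Gc (frame w x) - Gc (frame w y) - Gl (frame w x - frame w y)"
      unfolding frame_diff J_def[symmetric] \<rho>_def using J by (simp add: bounded_linear.linear linear_diff)
    also have "norm \<dots> \<le> k * norm (frame w x - frame w y)"
      using frame_norm[OF w, of x] frame_norm[OF w, of y] xy
      by (intro r1) (auto simp: r_def zero_prod_def[symmetric])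
    also have "norm (frame w x - frame w y) = norm (x - y)" unfolding frame_diff by (simp add: norm_prod_def)
    finally show ?thesis .
  qed
  have Gcont: "continuous_on (ball 0 r) Gc"
  proof -
    obtain BG where BG: "BG > 0" "\<And>x. norm (Gl x) \<le> norm x * BG"
      using bounded_linear.pos_bounded[OF strict_derivative_linear[OF sdG]] by auto
    have "norm (Gc y - Gc z) \<le> (k + BG) * norm (y - z)" if "y \<in> ball 0 r" "z \<in> ball 0 r" for y z
    proof -
      have "norm (Gc y - Gc z) \<le> norm (Gc y - Gc z - Gl (y - z)) + norm (Gl (y - z))"
        by (metis diff_add_cancel norm_triangle_ineq)
      also have "\<dots> \<le> k * norm (y - z) + norm (y - z) * BG"
        using that by (intro add_mono r1 BG) (auto simp: r_def zero_prod_def[symmetric])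
      finally show ?thesis by (simp add: algebra_simps)
    qed
    then have "(k + BG)-lipschitz_on (ball 0 r) Gc"
      using k BG by (intro lipschitz_onI) (auto simp: dist_norm)
    then show ?thesis by (rule lipschitz_on_continuous_on)
  qed
  \<comment> \<open>Initial deviations below \<open>r'\<close> stay in the ball of radius \<open>r / 4\<close> on which \<open>frame\<close> takes values in the domain of the closed loop.\<close>
  define r' where "r' = r / (4 * M)"
  have r': "r' > 0" using r M by (simp add: r'_def)
  have main: "\<exists>z. z 0 = a \<and> (\<forall>t\<ge>0. norm (z t) \<le> M * exp (- k * t) * norm a) \<and>
      ode_solution cl (X \<times> Wo \<times> W) {0..} (frame (w 0) a) (\<lambda>t. frame (w t) (z t)) \<and>
      ((\<lambda>t. loop_error h \<gamma> (frame (w t) (z t))) \<longlongrightarrow> 0) at_top"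
    if wd: "\<And>t. 0 \<le> t \<Longrightarrow> (w has_vector_derivative s (w t)) (at t within {0..})"
      and w\<epsilon>: "\<And>t. 0 \<le> t \<Longrightarrow> norm (w t) < \<epsilon>" and a: "norm a < r'" for w a
  proof -
    have inB: "frame (w t) z \<in> ball 0 r" if "0 \<le> t" "norm z \<le> r / 4" for t z
      using frame_norm[OF w\<epsilon>[OF that(1)] that(2)] by simp
    have dom: "frame (w t) z \<in> X \<times> Wo \<times> W" if "0 \<le> t" "norm z \<le> r / 4" for t z
      using inB[OF that] r3(2) by (auto simp: r_def zero_prod_def[symmetric])
    have wWo: "w t \<in> Wo" if "0 \<le> t" for t using dom[OF that, of 0] r by (simp add: frame_def)
    have wc: "continuous_on {0..} w"
      unfolding continuous_on_eq_continuous_within using has_vector_derivative_continuous[OF wd] by auto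
    have \<pi>d: "((\<lambda>t. \<pi> (w t)) has_vector_derivative f (\<pi> (w t)) (\<gamma> (w t)) (w t)) (at t within {0..})" if t: "0 \<le> t" for t
      using has_derivative_compose[OF wd[OF t, unfolded has_vector_derivative_def] \<pi>_derivative[OF wWo[OF t]]]
      unfolding has_vector_derivative_def invariance[OF wWo[OF t], symmetric]
      by (simp add: matrix_vector_mult_scaleR)
    have \<pi>c: "continuous_on {0..} (\<lambda>t. \<pi> (w t))"
      unfolding continuous_on_eq_continuous_within using has_vector_derivative_continuous[OF \<pi>d] by auto
    have c1: "continuous_on ({0..} \<times> cball 0 (r / 4)) (\<lambda>p. frame (w (fst p)) (snd p))"
      unfolding frame_def
      by (intro continuous_intros continuous_on_compose2[OF wc] continuous_on_compose2[OF \<pi>c]) auto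
    have c0: "continuous_on ({0..} \<times> cball 0 (r / 4)) (\<lambda>p. frame (w (fst p)) 0)"
      unfolding frame_def
      by (intro continuous_intros continuous_on_compose2[OF wc] continuous_on_compose2[OF \<pi>c]) auto
    have im1: "frame (w (fst p)) (snd p) \<in> ball 0 r" if "p \<in> {0..} \<times> cball 0 (r / 4)" for p
      using that by (intro inB) auto
    have im0: "frame (w (fst p)) 0 \<in> ball 0 r" if "p \<in> {0..} \<times> cball 0 (r / 4)" for p
      using that r by (intro inB) auto
    have "continuous_on ({0..} \<times> cball 0 (r / 4)) (\<lambda>p. \<rho> (w (fst p)) (snd p))"
      unfolding \<rho>_def
      by (intro continuous_on_diff continuous_on_compose2[OF Gcont c1] continuous_on_compose2[OF Gcont c0]
          bounded_linear.continuous_on[OF J] continuous_on_snd continuous_on_id image_subsetI im1 im0)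
    then have \<rho>c: "continuous_on ({0..} \<times> cball 0 (r / 4)) (\<lambda>(t, z). \<rho> (w t) z)"
      by (simp add: case_prod_unfold)
    obtain z where z: "z 0 = a" "\<And>t. 0 \<le> t \<Longrightarrow> (z has_vector_derivative J (z t) + \<rho> (w t) (z t)) (at t within {0..})"
      "\<And>t. 0 \<le> t \<Longrightarrow> norm (z t) \<le> M * exp (- k * t) * norm a"
    proof (rule driven_exponential_stability[OF \<beta> m K J g(1) gJ, of "r / 4" "\<lambda>t. \<rho> (w t)" a])
      show "r / 4 > 0" using r by simp
      show "\<rho> (w t) 0 = 0" for t using J by (simp add: \<rho>_def bounded_linear.linear linear_0)
      show "norm (\<rho> (w t) x - \<rho> (w t) y) \<le> g / (4 * K) * norm (x - y)"
        if "0 \<le> t" "x \<in> cball 0 (r / 4)" "y \<in> cball 0 (r / 4)" for t x y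
        using \<rho>lip[OF w\<epsilon>[OF that(1)] that(2,3)] by (simp add: k_def)
      show "sqrt (K / m) * norm a \<le> r / 4"
        using a M by (simp add: M_def[symmetric] r'_def field_simps)
    qed (use \<rho>c that in \<open>auto simp: M_def k_def\<close>)
    have Mbound: "M * exp (- k * t) * norm a \<le> r / 4" if "0 \<le> t" for t
    proof -
      have "M * exp (- k * t) * norm a \<le> M * 1 * norm a"
        using M k that by (intro mult_right_mono mult_left_mono) auto
      also have "\<dots> \<le> r / 4" using a M by (simp add: r'_def field_simps)
      finally show ?thesis .
    qed
    have zr: "norm (z t) \<le> r / 4" if "0 \<le> t" for t using z(3)[OF that] Mbound[OF that] by simp
    define x where "x t = \<pi> (w t) + fst (z t)" for t
    define \<xi> where "\<xi> t = w t + snd (z t)" for t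
    define e where "e t = h (x t) (\<gamma> (\<xi> t)) (w t)" for t
    have fr: "frame (w t) (z t) = (x t, \<xi> t, w t)" for t by (simp add: frame_def x_def \<xi>_def)
    have "ode_solution cl (X \<times> Wo \<times> W) {0..} (frame (w 0) a) (\<lambda>t. frame (w t) (z t))"
      unfolding ode_solution_def
    proof (intro conjI ballI)
      show "frame (w 0) (z 0) = frame (w 0) a" by (simp add: z(1))
      fix t :: real assume "t \<in> {0..}"
      then have t: "0 \<le> t" by simp
      show "frame (w t) (z t) \<in> X \<times> Wo \<times> W" by (rule dom[OF t zr[OF t]])
      have "J (z t) + \<rho> (w t) (z t) = (f (x t) (\<gamma> (\<xi> t)) (w t) - f (\<pi> (w t)) (\<gamma> (w t)) (w t),
         s (\<xi> t) + e t *\<^sub>R Bc - s (w t))"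
        by (simp add: \<rho>_def Gc_def cl_def closed_loop_def fr e_def frame_def[of _ 0] zero_error[OF wWo[OF t]])
      note zd = z(2)[OF t, unfolded this]
      have "((\<lambda>t. fst (z t)) has_vector_derivative f (x t) (\<gamma> (\<xi> t)) (w t) - f (\<pi> (w t)) (\<gamma> (w t)) (w t)) (at t within {0..})"
        using bounded_linear.has_vector_derivative[OF bounded_linear_fst zd] by simp
      from has_vector_derivative_add[OF \<pi>d[OF t] this]
      have 1: "(x has_vector_derivative f (x t) (\<gamma> (\<xi> t)) (w t)) (at t within {0..})"
        by (simp add: x_def[abs_def])
      have "((\<lambda>t. snd (z t)) has_vector_derivative s (\<xi> t) + e t *\<^sub>R Bc - s (w t)) (at t within {0..})"
        using bounded_linear.has_vector_derivative[OF bounded_linear_snd zd] by simp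
      from has_vector_derivative_add[OF wd[OF t] this]
      have 2: "(\<xi> has_vector_derivative s (\<xi> t) + e t *\<^sub>R Bc) (at t within {0..})"
        by (simp add: \<xi>_def[abs_def])
      show "((\<lambda>t. frame (w t) (z t)) has_vector_derivative cl (frame (w t) (z t))) (at t within {0..})"
        using has_vector_derivative_Pair[OF 1 has_vector_derivative_Pair[OF 2 wd[OF t]]]
        by (simp add: fr cl_def closed_loop_def e_def)
    qed
    moreover have "((\<lambda>t. loop_error h \<gamma> (frame (w t) (z t))) \<longlongrightarrow> 0) at_top"
    proof (rule tendstoI)
      fix e :: real assume e: "e > 0"
      obtain T where T: "T > 0" "\<And>t. t \<ge> T \<Longrightarrow> exp (- k * t) * (Lh * M * norm a) < e"
        by (rule exp_decay_eventually[OF k e]) blast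
      have "dist (loop_error h \<gamma> (frame (w t) (z t))) 0 < e" if "t \<ge> T" for t
      proof -
        have t: "0 \<le> t" using that T by simp
        have "norm (loop_error h \<gamma> (frame (w t) (z t)) - loop_error h \<gamma> (frame (w t) 0))
           \<le> Lh * norm (frame (w t) (z t) - frame (w t) 0)"
          using inB[OF t zr[OF t]] inB[OF t, of 0] r by (intro r2(3)) (auto simp: r_def zero_prod_def[symmetric])
        moreover have "norm (frame (w t) (z t) - frame (w t) 0) = norm (z t)" unfolding frame_diff by (simp add: norm_prod_def)
        ultimately have "norm (loop_error h \<gamma> (frame (w t) (z t))) \<le> Lh * norm (z t)"
          by (simp add: loop_error_frame[OF wWo[OF t]])
        also have "\<dots> \<le> Lh * (M * exp (- k * t) * norm a)" using r2(2) z(3)[OF t] by (intro mult_left_mono) auto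
        also have "\<dots> < e" using T(2)[OF that] by (simp add: mult_ac)
        finally show ?thesis by simp
      qed
      then show "\<forall>\<^sub>F t in at_top. dist (loop_error h \<gamma> (frame (w t) (z t))) 0 < e"
        unfolding eventually_at_top_linorder by blast
    qed
    ultimately show ?thesis using z(1,3) by blast
  qed
  show ?thesis by (rule that[of M k \<epsilon> r' Bc]) (use M k \<epsilon> r' main in \<open>unfold cl_def, blast\<close>)+
qed

end

lemma C2_on_subset: "C2_on F S \<Longrightarrow> T \<subseteq> S \<Longrightarrow> C2_on F T"
  unfolding C2_on_def by (meson continuous_on_subset subset_iff)

lemma C2_on_output_injection:
  fixes s :: "'a::real_normed_vector \<Rightarrow> 'b::real_normed_vector" and b :: 'b
  assumes "C2_on s S"
  shows "C2_on (\<lambda>(\<xi>, e). s \<xi> + e *\<^sub>R b) (S \<times> E)"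
proof -
  obtain F' F'' where F': "\<And>x. x \<in> S \<Longrightarrow> (s has_derivative blinfun_apply (F' x)) (at x)"
    and F'': "\<And>x. x \<in> S \<Longrightarrow> (F' has_derivative blinfun_apply (F'' x)) (at x)"
    and cont: "continuous_on S F''"
    using assms unfolding C2_on_def by blast
  define p1 :: "('a \<times> real) \<Rightarrow>\<^sub>L 'a" where "p1 = Blinfun fst"
  define p2 :: "('a \<times> real) \<Rightarrow>\<^sub>L 'b" where "p2 = Blinfun (\<lambda>p. snd p *\<^sub>R b)"
  define R :: "('a \<Rightarrow>\<^sub>L 'b) \<Rightarrow>\<^sub>L (('a \<times> real) \<Rightarrow>\<^sub>L 'b)" where "R = Blinfun (\<lambda>A. A o\<^sub>L p1)"
  have p1: "blinfun_apply p1 = fst" by (simp add: p1_def bounded_linear_Blinfun_apply bounded_linear_fst)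
  have p2: "blinfun_apply p2 = (\<lambda>p. snd p *\<^sub>R b)"
    unfolding p2_def by (intro bounded_linear_Blinfun_apply bounded_linear_scaleR_const bounded_linear_snd)
  have R: "blinfun_apply R = (\<lambda>A. A o\<^sub>L p1)"
    unfolding R_def by (intro bounded_linear_Blinfun_apply bounded_bilinear.bounded_linear_left[OF bounded_bilinear_blinfun_compose])
  define G' where "G' p = (F' (fst p) o\<^sub>L p1) + p2" for p :: "'a \<times> real"
  define G'' where "G'' p = R o\<^sub>L (F'' (fst p) o\<^sub>L p1)" for p :: "'a \<times> real"
  show ?thesis unfolding C2_on_def
  proof (intro exI[of _ G'] exI[of _ G''] conjI ballI)
    fix p assume "p \<in> S \<times> E"
    then have p: "fst p \<in> S" by auto
    have fst': "(fst has_derivative fst) (at p)" by (rule has_derivative_fst) simp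
    have "((\<lambda>p. s (fst p)) has_derivative (\<lambda>v. blinfun_apply (F' (fst p)) (fst v))) (at p)"
      by (rule has_derivative_compose[OF fst' F'[OF p]])
    moreover have "((\<lambda>p. snd p *\<^sub>R b) has_derivative (\<lambda>v. snd v *\<^sub>R b)) (at p)"
      by (intro bounded_linear_imp_has_derivative bounded_linear_scaleR_const bounded_linear_snd)
    ultimately have "((\<lambda>p. s (fst p) + snd p *\<^sub>R b) has_derivative (\<lambda>v. blinfun_apply (F' (fst p)) (fst v) + snd v *\<^sub>R b)) (at p)"
      by (rule has_derivative_add)
    moreover have "blinfun_apply (G' p) = (\<lambda>v. blinfun_apply (F' (fst p)) (fst v) + snd v *\<^sub>R b)"
      by (simp add: G'_def fun_eq_iff blinfun.add_left p1 p2)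
    ultimately show "((\<lambda>(\<xi>, e). s \<xi> + e *\<^sub>R b) has_derivative blinfun_apply (G' p)) (at p)"
      by (simp add: case_prod_unfold)
    have "((\<lambda>p. F' (fst p)) has_derivative (\<lambda>v. blinfun_apply (F'' (fst p)) (fst v))) (at p)"
      by (rule has_derivative_compose[OF fst' F''[OF p]])
    from bounded_linear.has_derivative[OF blinfun.bounded_linear_right[of R] this]
    have "((\<lambda>p. F' (fst p) o\<^sub>L p1) has_derivative (\<lambda>v. blinfun_apply (F'' (fst p)) (fst v) o\<^sub>L p1)) (at p)"
      unfolding R .
    from has_derivative_add[OF this has_derivative_const[of p2]]
    show "(G' has_derivative blinfun_apply (G'' p)) (at p)"
      unfolding G'_def by (rule has_derivative_eq_rhs) (simp add: G''_def fun_eq_iff R p1)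
  next
    have "continuous_on (S \<times> E) (\<lambda>p. F'' (fst p))"
      by (rule continuous_on_compose2[OF cont continuous_on_fst[OF continuous_on_id]]) auto
    then show "continuous_on (S \<times> E) G''"
      unfolding G''_def
      by (intro bounded_bilinear.continuous_on[OF bounded_bilinear_blinfun_compose] continuous_on_const)
  qed
qed

lemma finite_dimensional_euclidean: "finite_dimensional TYPE('a::euclidean_space)"
  unfolding finite_dimensional_def using finite_Basis span_Basis by blast

context feedforward
begin

lemma feedback_controller: "controller U Ye Wo (\<lambda>\<xi> e. s \<xi> + e *\<^sub>R Bc) \<gamma>"
  unfolding controller_def
  using Wo \<gamma> s0 C2_on_output_injection[OF C2_on_subset[OF s_C2 Wo(3)]]
  by (auto simp: finite_dimensional_euclidean)

text \<open>
  Exponential stability is the case of the exosystem at rest, and regulation the case of an exosystem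
  trajectory that stays small by Lyapunov stability. Solutions other than the constructed ones are covered
  by uniqueness.
\<close>

theorem feedback_solves_regulator_problem:
  "\<exists>Bc. solves_regulator_problem f h s X W Wo (\<lambda>\<xi> e. s \<xi> + e *\<^sub>R Bc) \<gamma>"
proof -
  obtain Bc M \<alpha> \<epsilon> r where pos: "M > 0" "\<alpha> > 0" "\<epsilon> > 0" "r > 0"
    and drive: "\<And>w a. (\<And>t. 0 \<le> t \<Longrightarrow> (w has_vector_derivative s (w t)) (at t within {0..})) \<Longrightarrow>
      (\<And>t. 0 \<le> t \<Longrightarrow> norm (w t) < \<epsilon>) \<Longrightarrow> norm a < r \<Longrightarrow>
      \<exists>z. z 0 = a \<and> (\<forall>t\<ge>0. norm (z t) \<le> M * exp (- \<alpha> * t) * norm a) \<and>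
        ode_solution (closed_loop f h s (\<lambda>\<xi> e. s \<xi> + e *\<^sub>R Bc) \<gamma>) (X \<times> Wo \<times> W) {0..}
          (frame (w 0) a) (\<lambda>t. frame (w t) (z t)) \<and>
        ((\<lambda>t. loop_error h \<gamma> (frame (w t) (z t))) \<longlongrightarrow> 0) at_top"
    by (rule driven_closed_loop) blast
  define \<eta> where "\<eta> \<xi> e = s \<xi> + e *\<^sub>R Bc" for \<xi> e
  have \<eta>: "\<eta> = (\<lambda>\<xi> e. s \<xi> + e *\<^sub>R Bc)" by (simp add: fun_eq_iff \<eta>_def)
  define F where "F = closed_loop f h s \<eta> \<gamma>"
  define G where "G = unforced_loop f h \<eta> \<gamma>"
  have contr: "controller U Ye Wo \<eta> \<gamma>" unfolding \<eta> by (rule feedback_controller)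
  note lip = closed_loop_locally_lipschitz[OF contr, folded F_def G_def]
  note drive = drive[folded \<eta>, folded F_def]
  have stab: "\<forall>a\<in>X \<times> Wo. norm a < r \<longrightarrow> (\<exists>z. ode_solution G (X \<times> Wo) {0..} a z) \<and>
      (\<forall>z. ode_solution G (X \<times> Wo) {0..} a z \<longrightarrow> (\<forall>t\<ge>0. norm (z t) \<le> M * exp (- \<alpha> * t) * norm a))"
  proof (intro ballI impI conjI allI)
    fix a assume a: "a \<in> X \<times> Wo" "norm a < r"
    have fr: "frame 0 z = (fst z, snd z, 0)" for z by (simp add: frame_def \<pi>(2))
    obtain z where z: "z 0 = a" "\<forall>t\<ge>0. norm (z t) \<le> M * exp (- \<alpha> * t) * norm a"
      and sol: "ode_solution F (X \<times> Wo \<times> W) {0..} (frame 0 a) (\<lambda>t. frame 0 (z t))"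
      using drive[of "\<lambda>_. 0" a] a(2) pos(3) by (auto simp: s0)
    have zs: "ode_solution G (X \<times> Wo) {0..} a z"
      unfolding ode_solution_def
    proof (intro conjI ballI z(1))
      fix t :: real assume t: "t \<in> {0..}"
      have "((\<lambda>t. frame 0 (z t)) has_vector_derivative F (frame 0 (z t))) (at t within {0..})"
        and dom: "frame 0 (z t) \<in> X \<times> Wo \<times> W"
        using sol t unfolding ode_solution_def by simp_all
      from bounded_linear.has_vector_derivative[OF _ this(1), of "\<lambda>q. (fst q, fst (snd q))"]
      show "(z has_vector_derivative G (z t)) (at t within {0..})"
        by (simp add: fr F_def G_def closed_loop_def unforced_loop_def case_prod_unfold bounded_linear_intros)
      show "z t \<in> X \<times> Wo" using dom by (metis fr mem_Times_iff fst_conv snd_conv)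
    qed
    then show "\<exists>z. ode_solution G (X \<times> Wo) {0..} a z" by blast
    fix y t assume y: "ode_solution G (X \<times> Wo) {0..} a y" and t: "(0 :: real) \<le> t"
    have "y t = z t" by (rule ode_unique_ray[OF lip(2) y zs t])
    then show "norm (y t) \<le> M * exp (- \<alpha> * t) * norm a" using z(2) t by simp
  qed
  have "0 \<in> X \<times> Wo" "G 0 = 0"
    using X Wo by (simp_all add: zero_prod_def G_def unforced_loop_def \<eta>_def \<gamma>(2) f0 h0 s0)
  then have exp: "locally_exp_stable_origin G (X \<times> Wo)"
    unfolding locally_exp_stable_origin_def using stab pos by blast
  obtain d where d: "d > 0"
    "\<And>a. a \<in> W \<Longrightarrow> norm a < d \<Longrightarrow> \<exists>z. ode_solution s W {0..} a z \<and> (\<forall>t\<ge>0. norm (z t) < \<epsilon>)"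
    by (rule lyapunov_stable_flow_bounded[OF C2_on_locally_lipschitz[OF s_C2 W(1)] stable pos(3)]) blast+
  obtain D where D: "strict_derivative \<pi> D 0" by (rule C2_on_strict_derivative[OF \<pi>(1) Wo(1,2)])
  obtain r4 Lp where r4: "r4 > 0" "Lp > 0" "\<And>y z. y \<in> ball 0 r4 \<Longrightarrow> z \<in> ball 0 r4 \<Longrightarrow>
      norm (\<pi> y - \<pi> z) \<le> Lp * norm (y - z)"
    by (rule strict_derivative_lipschitz[OF D]) blast
  have "open (X \<times> Wo \<times> W)" "0 \<in> X \<times> Wo \<times> W"
    using X Wo W by (auto intro!: open_Times simp: zero_prod_def)
  then obtain r3 where r3: "r3 > 0" "ball 0 r3 \<subseteq> X \<times> Wo \<times> W" by (rule openE) blast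
  define \<delta> where "\<delta> = min (min d r4) (min r3 (r / (Lp + 3)))"
  have \<delta>: "\<delta> > 0" using d r4 r3 pos by (simp add: \<delta>_def)
  have main: "\<exists>z. ode_solution F (X \<times> Wo \<times> W) {0..} a z \<and>
      (\<forall>z'. ode_solution F (X \<times> Wo \<times> W) {0..} a z' \<longrightarrow> (\<forall>t\<ge>0. z' t = z t)) \<and>
      ((\<lambda>t. loop_error h \<gamma> (z t)) \<longlongrightarrow> 0) at_top"
    if a: "a \<in> ball 0 \<delta>" for a
  proof -
    obtain x0 \<xi>0 w0 where aa: "a = (x0, \<xi>0, w0)" by (cases a) auto
    have "norm x0 \<le> norm a" "norm (\<xi>0, w0) \<le> norm a" 
      using norm_fst_le[of x0 "(\<xi>0, w0)"] norm_snd_le[of "(\<xi>0, w0)" x0] by (simp_all add: aa)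
    moreover have "norm \<xi>0 \<le> norm (\<xi>0, w0)" "norm w0 \<le> norm (\<xi>0, w0)"
      by (rule norm_fst_le norm_snd_le)+
    ultimately have n: "norm x0 < \<delta>" "norm \<xi>0 < \<delta>" "norm w0 < \<delta>" using a by auto
    have "w0 \<in> W" using a r3(2) by (auto simp: \<delta>_def aa)
    then obtain w where w: "ode_solution s W {0..} w0 w" "\<And>t. 0 \<le> t \<Longrightarrow> norm (w t) < \<epsilon>"
      using d(2)[of w0] n(3) by (auto simp: \<delta>_def)
    have w00: "w 0 = w0" using w(1) by (simp add: ode_solution_def)
    define b where "b = (x0 - \<pi> w0, \<xi>0 - w0)"
    have "norm (\<pi> w0) \<le> Lp * norm w0" using r4(3)[of w0 0] r4(1) n(3) by (simp add: \<delta>_def \<pi>(2))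
    also have "\<dots> \<le> Lp * \<delta>" using n r4 by (intro mult_left_mono) auto
    finally have "norm b < \<delta> + Lp * \<delta> + (\<delta> + \<delta>)"
      using norm_Pair_le[of "x0 - \<pi> w0" "\<xi>0 - w0"] norm_triangle_ineq4[of x0 "\<pi> w0"]
        norm_triangle_ineq4[of \<xi>0 w0] n unfolding b_def by linarith
    also have "\<dots> = (Lp + 3) * \<delta>" by (simp add: algebra_simps)
    also have "\<dots> \<le> (Lp + 3) * (r / (Lp + 3))" using r4 by (intro mult_left_mono) (auto simp: \<delta>_def)
    also have "\<dots> = r"
    proof -
      have "Lp + 3 \<noteq> 0" using r4(2) by linarith
      then show ?thesis by simp
    qed
    finally have b: "norm b < r" .
    have "(w has_vector_derivative s (w t)) (at t within {0..})" if "0 \<le> t" for t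
      using w(1) that by (simp add: ode_solution_def)
    from drive[of w b, OF this w(2) b] obtain z
      where sol: "ode_solution F (X \<times> Wo \<times> W) {0..} (frame (w 0) b) (\<lambda>t. frame (w t) (z t))"
        and lim: "((\<lambda>t. loop_error h \<gamma> (frame (w t) (z t))) \<longlongrightarrow> 0) at_top" by blast
    have "frame (w 0) b = a" unfolding w00 by (simp add: frame_def b_def aa)
    note sol = sol[unfolded this]
    have "z' t = frame (w t) (z t)" if "ode_solution F (X \<times> Wo \<times> W) {0..} a z'" "0 \<le> t" for z' t
      by (rule ode_unique_ray[OF lip(1) that(1) sol that(2)])
    then show ?thesis using sol lim by blast
  qed
  have "\<exists>N. open N \<and> 0 \<in> N \<and> N \<subseteq> X \<times> Wo \<times> W \<and> (\<forall>a\<in>N. \<exists>z. ode_solution F (X \<times> Wo \<times> W) {0..} a z \<and>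
      (\<forall>z'. ode_solution F (X \<times> Wo \<times> W) {0..} a z' \<longrightarrow> (\<forall>t\<ge>0. z' t = z t)) \<and>
      ((\<lambda>t. loop_error h \<gamma> (z t)) \<longlongrightarrow> 0) at_top)"
  proof (intro exI[of _ "ball 0 \<delta>"] conjI ballI main)
    show "0 \<in> ball 0 \<delta>" using \<delta> by simp
    show "ball 0 \<delta> \<subseteq> X \<times> Wo \<times> W" using r3(2) by (auto simp: \<delta>_def)
  qed simp
  then have "solves_regulator_problem f h s X W Wo \<eta> \<gamma>"
    using exp unfolding solves_regulator_problem_loop F_def G_def by blast
  then show ?thesis unfolding \<eta> by blast
qed

end

section \<open>Steady states of regulated systems\<close>

text \<open>
  At the first instant at which \<open>\<phi>\<close> reaches \<open>R\<close> the bound holds on the whole preceding interval, which the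
  step turns into a strict inequality.
\<close>

lemma continuity_bootstrap:
  fixes \<phi> :: "real \<Rightarrow> real"
  assumes cont: "continuous_on {0..} \<phi>" and 0: "\<phi> 0 < R"
    and step: "\<And>T. 0 \<le> T \<Longrightarrow> (\<And>t. 0 \<le> t \<Longrightarrow> t \<le> T \<Longrightarrow> \<phi> t \<le> R) \<Longrightarrow> \<phi> T < R"
    and t: "0 \<le> t"
  shows "\<phi> t < R"
proof (rule ccontr)
  assume nt: "\<not> \<phi> t < R"
  define B where "B = {u \<in> {0..t}. \<phi> u = R}"
  have IVT: "\<exists>x. 0 \<le> x \<and> x \<le> u \<and> \<phi> x = R" if "0 \<le> u" "R \<le> \<phi> u" for u
    using IVT'[of \<phi> 0 R u] 0 that continuous_on_subset[OF cont, of "{0..u}"] by fastforce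
  have "closed B"
    unfolding B_def by (intro continuous_closed_preimage_constant continuous_on_subset[OF cont]) auto
  moreover have "B \<noteq> {}" using IVT[OF t] nt by (auto simp: B_def)
  moreover have bb: "bdd_below B" by (rule bdd_belowI[of _ 0]) (auto simp: B_def)
  ultimately have inf: "Inf B \<in> B" by (intro closed_contains_Inf)
  have "\<phi> u \<le> R" if u: "0 \<le> u" "u \<le> Inf B" for u
  proof (rule ccontr)
    assume "\<not> \<phi> u \<le> R"
    then obtain x where x: "0 \<le> x" "x \<le> u" "\<phi> x = R" using IVT[OF u(1)] by auto
    then have "x \<in> B" using u inf by (auto simp: B_def)
    then have "x = u" using cInf_lower[OF _ bb, of x] x u by simp
    then show False using x(3) \<open>\<not> \<phi> u \<le> R\<close> by simp
  qed
  then have "\<phi> (Inf B) < R" using inf by (intro step) (auto simp: B_def)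
  then show False using inf by (simp add: B_def)
qed

text \<open>
  A left eigenvector with \<open>0 \<le> Re l\<close> would give a functional that the nonlinear flow can change only by a small
  fraction of the initial distance, although exponential stability drives it to zero. The state space \<open>'b\<close> is
  embedded in a coordinate space by \<open>\<kappa>\<close> with left inverse \<open>lam\<close>.
\<close>

lemma hurwitz_of_exp_stable:
  fixes F D0 :: "'b::real_inner \<Rightarrow> 'b" and \<kappa> :: "'b \<Rightarrow> real ^ 'm" and Jm :: "real ^ 'm ^ 'm"
  assumes F: "strict_derivative F D0 0" and les: "locally_exp_stable_origin F D" and D: "open D"
    and \<kappa>: "bounded_linear \<kappa>" and lam: "bounded_linear lam" and inv: "\<And>z. lam (\<kappa> z) = z"
    and J: "\<And>y. Jm *v y = \<kappa> (D0 (lam y)) - (y - \<kappa> (lam y))"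
  shows "hurwitz Jm"
  unfolding hurwitz_def
proof (intro allI impI, rule ccontr)
  fix l assume l: "complex_eigenvalue (complex_matrix Jm) l" and "\<not> Re l < 0"
  then have re: "0 \<le> Re l" by simp
  obtain a b where ab: "a \<noteq> 0 \<or> b \<noteq> 0" "transpose Jm *v a = Re l *\<^sub>R a - Im l *\<^sub>R b"
    "transpose Jm *v b = Re l *\<^sub>R b + Im l *\<^sub>R a"
    using l complex_eigenvalue_transpose[of Jm l] complex_eigenvalue_real[of "transpose Jm" l] by blast
  have aJ: "a \<bullet> (Jm *v y) = Re l * (a \<bullet> y) - Im l * (b \<bullet> y)"
    and bJ: "b \<bullet> (Jm *v y) = Re l * (b \<bullet> y) + Im l * (a \<bullet> y)" for y
    using inner_transpose_mult[of y Jm a] inner_transpose_mult[of y Jm b] unfolding ab(2,3)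
    by (simp_all add: inner_commute inner_diff_right inner_add_right)
  have F0: "F 0 = 0" and D0: "0 \<in> D" using les by (auto simp: locally_exp_stable_origin_def)
  obtain r0 M \<alpha> where pos: "r0 > 0" "M > 0" "\<alpha> > 0"
    and les': "\<forall>x\<in>D. norm x < r0 \<longrightarrow> (\<exists>z. ode_solution F D {0..} x z) \<and>
      (\<forall>z. ode_solution F D {0..} x z \<longrightarrow> (\<forall>t\<ge>0. norm (z t) \<le> M * exp (- \<alpha> * t) * norm x))"
    using les unfolding locally_exp_stable_origin_def by (elim conjE exE) (rule that)
  have ex: "\<exists>z. ode_solution F D {0..} x z \<and> (\<forall>t\<ge>0. norm (z t) \<le> M * exp (- \<alpha> * t) * norm x)"
    if "x \<in> D" "norm x < r0" for x
    using les' that by meson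
  have linD0: "linear D0" using strict_derivative_linear[OF F] by (rule bounded_linear.linear)
  define Y where "Y z = Complex (a \<bullet> \<kappa> z) (b \<bullet> \<kappa> z)" for z
  have Yc: "Y z = of_real (a \<bullet> \<kappa> z) + \<i> * of_real (b \<bullet> \<kappa> z)" for z
    by (simp add: Y_def complex_eq_iff)
  have Y: "bounded_linear Y"
    unfolding Yc
    by (intro bounded_linear_add bounded_linear_compose[OF bounded_linear_of_real]
        bounded_linear_const_mult bounded_linear_compose[OF bounded_linear_inner_right \<kappa>])
  obtain KY where KY: "KY > 0" "\<And>z. norm (Y z) \<le> norm z * KY"
    using bounded_linear.pos_bounded[OF Y] by auto
  have YD: "Y (D0 z) = l * Y z" for z
  proof -
    have "\<kappa> (D0 z) = Jm *v (\<kappa> z)" unfolding J inv by simp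
    then show ?thesis by (simp add: Y_def complex_eq_iff aJ bJ)
  qed
  \<comment> \<open>Discounting the functional by \<open>exp (- l t)\<close> removes the linear part; what remains is integrable with a small constant, while the functional itself tends to zero.\<close>
  have Y0: "Y z1 = 0" for z1
  proof (rule ccontr)
    assume nz: "Y z1 \<noteq> 0"
    then have z1: "z1 \<noteq> 0" using Y by (auto simp: bounded_linear.linear linear_0)
    define k where "k = norm (Y z1) * \<alpha> / (2 * KY * M * norm z1)"
    have k: "k > 0" using nz z1 pos KY by (simp add: k_def)
    obtain rk where rk: "rk > 0" "\<And>y z. y \<in> ball 0 rk \<Longrightarrow> z \<in> ball 0 rk \<Longrightarrow> norm (F y - F z - D0 (y - z)) \<le> k * norm (y - z)"
      by (rule strict_derivativeE[OF F k]) blast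
    obtain e where e: "e > 0" "e *\<^sub>R z1 \<in> D" "norm (e *\<^sub>R z1) < min r0 (rk / M)"
      by (rule scaled_into_open[OF D D0, of "min r0 (rk / M)" z1]) (use pos rk in auto)
    define z0 where "z0 = e *\<^sub>R z1"
    obtain z where z: "ode_solution F D {0..} z0 z" "\<And>t. t \<ge> 0 \<Longrightarrow> norm (z t) \<le> M * exp (- \<alpha> * t) * norm z0"
      using ex[of z0] e unfolding z0_def by auto
    have small: "norm (z t) < rk" if "0 \<le> t" for t
    proof -
      have "M * exp (- \<alpha> * t) * norm z0 \<le> M * 1 * norm z0"
        using pos that by (intro mult_right_mono mult_left_mono) auto
      also have "\<dots> < rk" using e(3) pos by (simp add: z0_def field_simps)
      finally show ?thesis using z(2)[OF that] by simp
    qed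
    define C where "C = KY * k * M * norm z0"
    have C: "0 \<le> C" using KY k pos by (simp add: C_def)
    have zz: "z 0 = z0" using z(1) by (simp add: ode_solution_def)
    have main: "norm (Y z0) \<le> C / \<alpha> + exp (- \<alpha> * T) * (KY * M * norm z0)" if T: "T > 0" for T
    proof -
      define G where "G t = exp (- (of_real t * l)) * Y (z t)" for t
      have dG: "(G has_vector_derivative exp (- (of_real t * l)) * Y (F (z t) - D0 (z t))) (at t within {0..})" if t: "0 \<le> t" for t
      proof -
        have dz: "(z has_vector_derivative F (z t)) (at t within {0..})"
          using z(1) t by (simp add: ode_solution_def)
        have d1: "((\<lambda>t. Y (z t)) has_vector_derivative Y (F (z t))) (at t within {0..})"
          by (rule bounded_linear.has_vector_derivative[OF Y dz])
        have d2: "((\<lambda>t. exp (- (of_real t * l))) has_vector_derivative (exp (- (of_real t * l)) * - l)) (at t within {0..})"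
          by (auto intro!: derivative_eq_intros has_vector_derivative_real_field)
        have Yd: "Y (F (z t) - D0 (z t)) = Y (F (z t)) - l * Y (z t)"
          using Y by (simp add: bounded_linear.linear linear_diff YD)
        have "exp (- (of_real t * l)) * Y (F (z t) - D0 (z t))
            = exp (- (of_real t * l)) * Y (F (z t)) + (exp (- (of_real t * l)) * - l) * Y (z t)"
          unfolding Yd by (simp add: algebra_simps)
        then show ?thesis
          using has_vector_derivative_mult[OF d2 d1] unfolding G_def by simp
      qed
      define \<phi> where "\<phi> t = - (C / \<alpha>) * exp (- \<alpha> * t)" for t
      have d\<phi>: "(\<phi> has_vector_derivative C * exp (- \<alpha> * t)) (at t)" for t
        unfolding \<phi>_def has_real_derivative_iff_has_vector_derivative[symmetric]
        using pos by (auto intro!: derivative_eq_intros)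
      have "norm (G T - G 0) \<le> \<phi> T - \<phi> 0"
      proof (rule differentiable_bound_general[OF T])
        show "continuous_on {0..T} G"
          unfolding continuous_on_eq_continuous_within
          using has_vector_derivative_continuous[OF has_vector_derivative_within_subset[OF dG, of _ "{0..T}"]]
          by auto
        show "continuous_on {0..T} \<phi>" unfolding \<phi>_def by (intro continuous_intros)
        fix t assume t: "0 < t" "t < T"
        have "at t within {0..} = at t" by (rule at_within_nhd[of _ "{0<..}"]) (use t in auto)
        then show "(G has_vector_derivative exp (- (of_real t * l)) * Y (F (z t) - D0 (z t))) (at t)"
          using dG[of t] t by simp
        show "(\<phi> has_vector_derivative C * exp (- \<alpha> * t)) (at t)" by (rule d\<phi>)
        have "norm (F (z t) - D0 (z t)) \<le> k * norm (z t)"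
          using rk(2)[of "z t" 0] small[of t] rk(1) t F0 by simp
        also have "\<dots> \<le> k * (M * exp (- \<alpha> * t) * norm z0)"
          using k z(2)[of t] t by (intro mult_left_mono) auto
        finally have "norm (Y (F (z t) - D0 (z t))) \<le> (k * (M * exp (- \<alpha> * t) * norm z0)) * KY"
          using KY by (intro order_trans[OF KY(2)] mult_right_mono) auto
        moreover have "norm (exp (- (of_real t * l))) \<le> 1" using re t by simp
        ultimately have "norm (exp (- (of_real t * l)) * Y (F (z t) - D0 (z t))) \<le> 1 * ((k * (M * exp (- \<alpha> * t) * norm z0)) * KY)"
          unfolding norm_mult by (intro mult_mono) auto
        then show "norm (exp (- (of_real t * l)) * Y (F (z t) - D0 (z t))) \<le> C * exp (- \<alpha> * t)"
          by (simp add: C_def mult_ac)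
      qed
      also have "\<dots> \<le> C / \<alpha>" using C pos by (simp add: \<phi>_def)
      finally have 1: "norm (G T - G 0) \<le> C / \<alpha>" .
      have "norm (G T) \<le> 1 * norm (Y (z T))"
        unfolding G_def norm_mult using re T by (intro mult_right_mono) auto
      also have "\<dots> \<le> (M * exp (- \<alpha> * T) * norm z0) * KY"
        using z(2)[of T] T KY by (simp only: mult_1) (intro order_trans[OF KY(2)] mult_right_mono, auto)
      finally have 2: "norm (G T) \<le> exp (- \<alpha> * T) * (KY * M * norm z0)" by (simp add: mult_ac)
      have "norm (G 0) \<le> norm (G T) + norm (G T - G 0)" by (rule norm_triangle_sub[of "G 0" "G T", simplified norm_minus_commute[of "G 0"]])
      moreover have "G 0 = Y z0" by (simp add: G_def zz)
      ultimately show ?thesis using 1 2 by simp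
    qed
    have Yz0: "norm (Y z0) = e * norm (Y z1)" using Y e(1) by (simp add: z0_def bounded_linear.linear linear_scale)
    have "C / \<alpha> = norm (Y z0) / 2"
      using pos KY z1 e(1) unfolding Yz0 by (simp add: C_def k_def z0_def)
    moreover have "norm (Y z0) / 2 > 0" using nz e(1) by (simp add: Yz0)
    then obtain T where "T > 0" "\<And>t. t \<ge> T \<Longrightarrow> exp (- \<alpha> * t) * (KY * M * norm z0) < norm (Y z0) / 2"
      by (rule exp_decay_eventually[OF pos(3)]) blast
    ultimately show False using main[of T] by fastforce
  qed
  \<comment> \<open>On the kernel of \<open>lam\<close> the matrix acts as \<open>-1\<close>, which is incompatible with \<open>0 \<le> Re l\<close> unless the functional vanishes there too.\<close>
  have "a \<bullet> y = 0 \<and> b \<bullet> y = 0" for y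
  proof -
    define v where "v = y - \<kappa> (lam y)"
    have "lam v = 0" using lam by (simp add: v_def bounded_linear.linear linear_diff inv)
    then have Jv: "Jm *v v = - v"
      unfolding J using \<kappa> by (simp add: linear_0[OF linD0] bounded_linear.linear linear_0)
    have e: "- (a \<bullet> v) = Re l * (a \<bullet> v) - Im l * (b \<bullet> v)" "- (b \<bullet> v) = Re l * (b \<bullet> v) + Im l * (a \<bullet> v)"
      using aJ[of v] bJ[of v] unfolding Jv by simp_all
    have "(1 + Re l) * ((a \<bullet> v)\<^sup>2 + (b \<bullet> v)\<^sup>2) =
       (a \<bullet> v) * ((a \<bullet> v) + Re l * (a \<bullet> v) - Im l * (b \<bullet> v)) + (b \<bullet> v) * ((b \<bullet> v) + Re l * (b \<bullet> v) + Im l * (a \<bullet> v))"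
      by (simp add: power2_eq_square algebra_simps)
    also have "\<dots> = 0"
    proof -
      have "(a \<bullet> v) + Re l * (a \<bullet> v) - Im l * (b \<bullet> v) = 0"
        "(b \<bullet> v) + Re l * (b \<bullet> v) + Im l * (a \<bullet> v) = 0" using e by linarith+
      then show ?thesis by simp
    qed
    finally have "(a \<bullet> v)\<^sup>2 + (b \<bullet> v)\<^sup>2 = 0" using re by simp
    then have "a \<bullet> v = 0" "b \<bullet> v = 0" by (simp_all add: sum_power2_eq_zero_iff)
    moreover have "a \<bullet> \<kappa> (lam y) = 0" "b \<bullet> \<kappa> (lam y) = 0"
      using Y0[of "lam y"] by (simp_all add: Y_def complex_eq_iff)
    ultimately show ?thesis by (simp add: v_def inner_diff_right)
  qed
  then have "a \<bullet> a = 0" "b \<bullet> b = 0" by blast+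
  then show False using ab(1) by simp
qed

lemma young_dissipation:
  fixes x w p k1 C c K :: real
  assumes "0 \<le> x" "0 \<le> w" "0 \<le> p" "p \<le> k1 * C * (x + w)" "0 < k1" "0 < C" "0 < K" "6 * (K * C) * k1 \<le> c"
  shows "2 * (K * x * p) \<le> c / 2 * x\<^sup>2 + k1 * (K * C) * w\<^sup>2"
proof -
  have "2 * (K * x * p) \<le> 2 * (K * x * (k1 * C * (x + w)))"
    using assms by (intro mult_left_mono) auto
  also have "\<dots> = k1 * (K * C) * (2 * x\<^sup>2 + 2 * x * w)" by (simp add: power2_eq_square algebra_simps)
  also have "\<dots> \<le> k1 * (K * C) * (3 * x\<^sup>2 + w\<^sup>2)"
    using assms sum_squares_bound[of x w] by (intro mult_left_mono) auto
  also have "\<dots> = (3 * k1 * (K * C)) * x\<^sup>2 + k1 * (K * C) * w\<^sup>2" by (simp add: algebra_simps)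
  also have "\<dots> \<le> c / 2 * x\<^sup>2 + k1 * (K * C) * w\<^sup>2"
    using assms(8) by (intro add_right_mono mult_right_mono) (simp_all add: mult_ac)
  finally show ?thesis .
qed


text \<open>
  A stable system driven by the exosystem forgets its initial state and follows the linear steady state
  \<open>Pm w\<close>. The deviation from it is small relative to the current state of the exosystem: the latter cannot
  decay faster than the deviation, since its spectrum lies in the closed right half plane.
\<close>

lemma tracking_error_decay:
  fixes F :: "'b::real_inner \<Rightarrow> real ^ 'p \<Rightarrow> 'b" and s :: "real ^ 'p \<Rightarrow> real ^ 'p"
    and \<kappa> :: "'b \<Rightarrow> real ^ 'm" and Jm :: "real ^ 'm ^ 'm" and Pm :: "real ^ 'p ^ 'm"
  assumes F: "strict_derivative (\<lambda>(z, w). F z w) (\<lambda>(z, w). D0 z + Dw w) (0, 0)" "F 0 0 = 0"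
    and s: "strict_derivative s ((*v) S) 0" "s 0 = 0"
    and S: "\<And>l. complex_eigenvalue (complex_matrix S) l \<Longrightarrow> 0 \<le> Re l"
    and \<kappa>: "bounded_linear \<kappa>" and lam: "bounded_linear lam" and inv: "\<And>z. lam (\<kappa> z) = z"
    and J: "\<And>z. Jm *v (\<kappa> z) = \<kappa> (D0 z)" and hJ: "hurwitz Jm"
    and Pm: "\<And>w. Pm *v (S *v w) = Jm *v (Pm *v w) + \<kappa> (Dw w)"
  obtains C \<mu> where "C > 0" "\<mu> > 0"
    "\<And>q. 0 < q \<Longrightarrow> q \<le> 1 \<Longrightarrow> \<exists>R>0. \<forall>z w T. 0 \<le> T \<longrightarrow> z 0 = 0 \<longrightarrow>
      (\<forall>t\<in>{0..T}. norm (z t) \<le> R \<and> norm (w t) \<le> R \<and>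
        (z has_vector_derivative F (z t) (w t)) (at t within {0..T}) \<and>
        (w has_vector_derivative s (w t)) (at t within {0..T})) \<longrightarrow>
      norm (\<kappa> (z T) - Pm *v w T) \<le> C * (q * norm (w T) + exp (- \<mu> * T) * norm (w 0))"
proof -
  obtain M m1 c where M: "transpose M = M" "m1 > 0" "c > 0" "\<And>x. m1 * (x \<bullet> x) \<le> x \<bullet> (M *v x)"
    "\<And>x. 2 * ((M *v x) \<bullet> (Jm *v x)) \<le> - c * (x \<bullet> x)" by (rule hurwitz_lyapunov[OF hJ]) blast
  obtain KM where KM: "KM > 0" "\<And>x. norm (M *v x) \<le> KM * norm x" by (rule matrix_vector_bound[of M]) blast
  define \<mu> where "\<mu> = c / (4 * KM)"
  have \<mu>: "\<mu> > 0" using M KM by (simp add: \<mu>_def)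
  \<comment> \<open>The form \<open>N\<close> of the exosystem may shrink at most at the rate \<open>\<mu>\<close>, which is half the decay rate of the form \<open>M\<close> of the deviation.\<close>
  define \<sigma> where "\<sigma> = \<mu> / 2"
  have "hurwitz (- S + mat (- \<sigma>))"
    unfolding hurwitz_def
  proof (intro allI impI)
    fix l assume "complex_eigenvalue (complex_matrix (- S + mat (- \<sigma>))) l"
    then have "complex_eigenvalue (complex_matrix S) (- (l - of_real (- \<sigma>)))"
      unfolding complex_eigenvalue_shift complex_eigenvalue_uminus .
    from S[OF this] show "Re l < 0" using \<mu> by (simp add: \<sigma>_def)
  qed
  then obtain N n1 cN where N: "transpose N = N" "n1 > 0" "cN > 0" "\<And>x. n1 * (x \<bullet> x) \<le> x \<bullet> (N *v x)"
    "\<And>x. 2 * ((N *v x) \<bullet> ((- S + mat (- \<sigma>)) *v x)) \<le> - cN * (x \<bullet> x)" by (rule hurwitz_lyapunov) blast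
  obtain KN where KN: "KN > 0" "\<And>x. norm (N *v x) \<le> KN * norm x" by (rule matrix_vector_bound[of N]) blast
  have mS: "(*v) (- S) = (\<lambda>x. - (S *v x))"
    using matrix_vector_mult_diff_rdistrib[of 0 S] by (simp add: fun_eq_iff)
  have Ndec: "2 * ((N *v x) \<bullet> ((- S) *v x)) + (- \<mu>) * (x \<bullet> (N *v x)) \<le> - cN * (x \<bullet> x)" for x
    using N(5)[of x]
    by (simp add: matrix_vector_mult_add_rdistrib mat_vector_mult scalar_mult_eq_scaleR inner_add_right
        inner_commute fun_cong[OF mS] \<sigma>_def algebra_simps)
  have "strict_derivative (\<lambda>x. - s x) ((*v) (- S)) 0"
    unfolding mS
    using strict_derivative_linear_compose[OF s(1), of uminus] by (simp add: bounded_linear_minus bounded_linear_ident)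
  then obtain rN where rN: "rN > 0" "\<And>x. norm x < rN \<Longrightarrow> 2 * ((N *v x) \<bullet> - s x) + (- \<mu>) * (x \<bullet> (N *v x)) \<le> 0"
    by (rule quadratic_form_decay_near_equilibrium[OF _ _ N(3) Ndec]) (use s(2) in auto)
  obtain Kk where Kk: "Kk > 0" "\<And>x. norm (\<kappa> x) \<le> norm x * Kk" using bounded_linear.pos_bounded[OF \<kappa>] by auto
  obtain Kl where Kl: "Kl > 0" "\<And>x. norm (lam x) \<le> norm x * Kl" using bounded_linear.pos_bounded[OF lam] by auto
  obtain KP where KP: "KP > 0" "\<And>x. norm (Pm *v x) \<le> KP * norm x" by (rule matrix_vector_bound[of Pm]) blast
  define C1 where "C1 = Kk * Kl + Kk * Kl * KP + Kk + KP"
  have C1: "C1 > 0" using Kk Kl KP by (simp add: C1_def add_pos_pos)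
  define C3 where "C3 = KM * C1"
  have C3: "C3 > 0" using C1 KM by (simp add: C3_def)
  define k0 where "k0 = min 1 (c / (6 * C3))"
  have k0: "k0 > 0" "k0 \<le> 1" "6 * C3 * k0 \<le> c"
  proof -
    show "k0 > 0" "k0 \<le> 1" using M(3) C3 by (auto simp: k0_def)
    have "6 * C3 * k0 \<le> 6 * C3 * (c / (6 * C3))" using C3 by (intro mult_left_mono) (auto simp: k0_def)
    also have "\<dots> = c" using C3 by simp
    finally show "6 * C3 * k0 \<le> c" .
  qed
  define E where "E = max (C3 / (\<mu> * n1) * KN) (KM * KP\<^sup>2) / m1"
  have E: "E > 0" using C3 \<mu> N KN M by (auto simp: E_def intro!: divide_pos_pos mult_pos_pos simp: less_max_iff_disj)
  define C where "C = sqrt E"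
  have C: "C > 0" using E by (simp add: C_def)
  have main: "\<exists>R>0. \<forall>z w T. 0 \<le> T \<longrightarrow> z 0 = 0 \<longrightarrow>
      (\<forall>t\<in>{0..T}. norm (z t) \<le> R \<and> norm (w t) \<le> R \<and>
        (z has_vector_derivative F (z t) (w t)) (at t within {0..T}) \<and>
        (w has_vector_derivative s (w t)) (at t within {0..T})) \<longrightarrow>
      norm (\<kappa> (z T) - Pm *v w T) \<le> C * (q * norm (w T) + exp (- \<mu> * T) * norm (w 0))"
    if q: "0 < q" "q \<le> 1" for q
  proof -
    \<comment> \<open>Linearisation error of relative size \<open>q\<^sup>2\<close>, so that the deviation itself is of relative size \<open>q\<close>.\<close>
    define k1 where "k1 = q\<^sup>2 * k0"
    have "q\<^sup>2 \<le> 1" using q by (simp add: power_le_one)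
    then have k1: "k1 > 0" "k1 \<le> q\<^sup>2" "6 * C3 * k1 \<le> c"
    proof -
      show "k1 > 0" "k1 \<le> q\<^sup>2" using q k0 by (simp_all add: k1_def mult_left_le)
      have "k1 \<le> k0" using \<open>q\<^sup>2 \<le> 1\<close> k0 by (simp add: k1_def mult_left_le_one_le)
      then have "6 * C3 * k1 \<le> 6 * C3 * k0" using C3 by (intro mult_left_mono) auto
      then show "6 * C3 * k1 \<le> c" using k0(3) by simp
    qed
    obtain r1 where r1: "r1 > 0" "\<And>y z. y \<in> ball (0, 0) r1 \<Longrightarrow> z \<in> ball (0, 0) r1 \<Longrightarrow>
       norm ((\<lambda>(z, w). F z w) y - (\<lambda>(z, w). F z w) z - (\<lambda>(z, w). D0 z + Dw w) (y - z)) \<le> k1 * norm (y - z)"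
      by (rule strict_derivativeE[OF F(1) k1(1)]) blast
    obtain r2 where r2: "r2 > 0" "\<And>y z. y \<in> ball 0 r2 \<Longrightarrow> z \<in> ball 0 r2 \<Longrightarrow>
       norm (s y - s z - S *v (y - z)) \<le> k1 * norm (y - z)"
      by (rule strict_derivativeE[OF s(1) k1(1)]) blast
    define R where "R = min (r1 / 3) (min (r2 / 2) (rN / 2))"
    have R: "R > 0" using r1 r2 rN by (simp add: R_def)
    have concl: "norm (\<kappa> (z T) - Pm *v w T) \<le> C * (q * norm (w T) + exp (- \<mu> * T) * norm (w 0))"
      if T: "0 \<le> T" and z0: "z 0 = 0"
        and traj: "\<forall>t\<in>{0..T}. norm (z t) \<le> R \<and> norm (w t) \<le> R \<and>
        (z has_vector_derivative F (z t) (w t)) (at t within {0..T}) \<and>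
        (w has_vector_derivative s (w t)) (at t within {0..T})" for z w T
    proof -
      define \<zeta> where "\<zeta> t = \<kappa> (z t) - Pm *v w t" for t
      define \<zeta>' where "\<zeta>' t = \<kappa> (F (z t) (w t)) - Pm *v s (w t)" for t
      have d\<zeta>: "(\<zeta> has_vector_derivative \<zeta>' t) (at t within {0..T})" if "t \<in> {0..T}" for t
        unfolding \<zeta>_def \<zeta>'_def using traj that
        by (intro has_vector_derivative_diff bounded_linear.has_vector_derivative[OF \<kappa>]
            bounded_linear.has_vector_derivative[OF matrix_vector_mul_bounded_linear]) auto
      have small: "norm (z t) \<le> R" "norm (w t) \<le> R" if "t \<in> {0..T}" for t using traj that by auto
      have rem: "norm (\<zeta>' t - Jm *v \<zeta> t) \<le> k1 * C1 * (norm (\<zeta> t) + norm (w t))" if t: "t \<in> {0..T}" for t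
      proof -
        define f1 where "f1 = F (z t) (w t) - (D0 (z t) + Dw (w t))"
        define f2 where "f2 = s (w t) - S *v w t"
        have "norm (z t, w t) \<le> norm (z t) + norm (w t)" by (rule norm_Pair_le)
        also have "\<dots> < r1" using small[OF t] r1(1) by (auto simp: R_def)
        finally have "norm (z t, w t) < r1" .
        then have "norm f1 \<le> k1 * norm (z t, w t)"
        proof -
          have "(z t, w t) \<in> ball (0, 0) r1" "(0, 0) \<in> ball (0 :: 'b, 0 :: real ^ 'p) r1"
            using \<open>norm (z t, w t) < r1\<close> r1(1) by (simp_all add: zero_prod_def[symmetric])
          from r1(2)[OF this] show ?thesis using F(2) by (simp add: f1_def)
        qed
        also have "\<dots> \<le> k1 * (norm (z t) + norm (w t))" using k1 by (intro mult_left_mono norm_Pair_le) auto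
        finally have f1: "norm f1 \<le> k1 * (norm (z t) + norm (w t))" .
        have "norm (w t) < r2" using small(2)[OF t] r2(1) by (auto simp: R_def)
        then have f2: "norm f2 \<le> k1 * norm (w t)"
          using r2(2)[of "w t" 0] r2(1) s(2) by (simp add: f2_def)
        have "\<zeta>' t - Jm *v \<zeta> t = \<kappa> f1 - Pm *v f2"
        proof -
          have "\<kappa> f1 = \<kappa> (F (z t) (w t)) - (\<kappa> (D0 (z t)) + \<kappa> (Dw (w t)))"
            using \<kappa> by (simp add: f1_def bounded_linear.linear linear_diff linear_add)
          moreover have "Pm *v f2 = Pm *v s (w t) - (Jm *v (Pm *v w t) + \<kappa> (Dw (w t)))"
            by (simp add: f2_def matrix_vector_mult_diff_distrib Pm)
          ultimately show ?thesis by (simp add: \<zeta>'_def \<zeta>_def matrix_vector_mult_diff_distrib J)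
        qed
        then have "norm (\<zeta>' t - Jm *v \<zeta> t) \<le> norm (\<kappa> f1) + norm (Pm *v f2)"
          by (simp add: norm_triangle_ineq4)
        also have "\<dots> \<le> (k1 * (norm (z t) + norm (w t))) * Kk + KP * (k1 * norm (w t))"
          using Kk KP f1 f2
          by (intro add_mono order_trans[OF Kk(2)] order_trans[OF KP(2)] mult_right_mono mult_left_mono) auto
        also have "norm (z t) \<le> (norm (\<zeta> t) + KP * norm (w t)) * Kl"
        proof -
          have "norm (\<kappa> (z t)) \<le> norm (\<zeta> t) + norm (Pm *v w t)"
            using norm_triangle_ineq[of "\<zeta> t" "Pm *v w t"] by (simp add: \<zeta>_def)
          also have "\<dots> \<le> norm (\<zeta> t) + KP * norm (w t)" using KP(2) by simp
          finally have "norm (\<kappa> (z t)) * Kl \<le> (norm (\<zeta> t) + KP * norm (w t)) * Kl"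
            using Kl by (intro mult_right_mono) auto
          then show ?thesis using Kl(2)[of "\<kappa> (z t)"] by (simp add: inv)
        qed
        then have "(k1 * (norm (z t) + norm (w t))) * Kk + KP * (k1 * norm (w t))
          \<le> (k1 * ((norm (\<zeta> t) + KP * norm (w t)) * Kl + norm (w t))) * Kk + KP * (k1 * norm (w t))"
          using k1 Kk by (intro add_right_mono mult_right_mono mult_left_mono) auto
        also have "\<dots> = k1 * (Kk * Kl * norm (\<zeta> t) + (Kk * Kl * KP + Kk + KP) * norm (w t))"
          by (simp add: algebra_simps)
        also have "\<dots> \<le> k1 * (C1 * norm (\<zeta> t) + C1 * norm (w t))"
          using k1 Kk Kl KP by (intro mult_left_mono add_mono mult_right_mono) (auto simp: C1_def)
        finally show ?thesis by (simp add: algebra_simps)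
      qed
      \<comment> \<open>With this weight the decay of \<open>M\<close> absorbs both the forcing by \<open>w\<close> and the possible decrease of \<open>N\<close>.\<close>
      define c0 where "c0 = k1 * C3 / (\<mu> * n1)"
      have c0: "c0 > 0" using k1 C3 \<mu> N by (simp add: c0_def)
      define V where "V t = \<zeta> t \<bullet> (M *v \<zeta> t) - c0 * (w t \<bullet> (N *v w t))" for t
      have "V T \<le> exp (- (2 * \<mu>) * (T - 0)) * V 0"
      proof (rule exp_growth_bound[OF T])
        fix t assume t: "t \<in> {0..T}"
        show "(V has_real_derivative 2 * ((M *v \<zeta> t) \<bullet> \<zeta>' t) - c0 * (2 * ((N *v w t) \<bullet> s (w t)))) (at t within {0..T})"
          unfolding V_def using traj t
          by (intro DERIV_diff DERIV_cmult has_vector_derivative_quadratic_form M(1) N(1) d\<zeta>[OF t]) auto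
        have "(M *v \<zeta> t) \<bullet> (\<zeta>' t - Jm *v \<zeta> t) \<le> norm (M *v \<zeta> t) * norm (\<zeta>' t - Jm *v \<zeta> t)"
          by (rule norm_cauchy_schwarz)
        also have "\<dots> \<le> KM * norm (\<zeta> t) * norm (\<zeta>' t - Jm *v \<zeta> t)"
          by (intro mult_right_mono KM) auto
        finally have "2 * ((M *v \<zeta> t) \<bullet> (\<zeta>' t - Jm *v \<zeta> t)) \<le> 2 * (KM * norm (\<zeta> t) * norm (\<zeta>' t - Jm *v \<zeta> t))"
          by simp
        also have "\<dots> \<le> c / 2 * (norm (\<zeta> t))\<^sup>2 + k1 * (KM * C1) * (norm (w t))\<^sup>2"
          by (rule young_dissipation[OF _ _ _ rem[OF t] k1(1) C1 KM(1)]) (use k1(3) in \<open>auto simp: C3_def\<close>)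
        finally have 1: "2 * ((M *v \<zeta> t) \<bullet> \<zeta>' t) \<le> - (c / 2) * (norm (\<zeta> t))\<^sup>2 + k1 * C3 * (norm (w t))\<^sup>2"
          using M(5)[of "\<zeta> t"] by (simp add: inner_diff_right power2_norm_eq_inner C3_def)
        have "\<zeta> t \<bullet> (M *v \<zeta> t) \<le> norm (\<zeta> t) * (KM * norm (\<zeta> t))"
          by (intro order_trans[OF norm_cauchy_schwarz] mult_left_mono KM) auto
        then have "2 * \<mu> * (\<zeta> t \<bullet> (M *v \<zeta> t)) \<le> 2 * \<mu> * (norm (\<zeta> t) * (KM * norm (\<zeta> t)))"
          using \<mu> by (intro mult_left_mono) auto
        also have "\<dots> = c / 2 * (norm (\<zeta> t))\<^sup>2" using KM(1) by (simp add: \<mu>_def power2_eq_square)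
        finally have 2: "2 * \<mu> * (\<zeta> t \<bullet> (M *v \<zeta> t)) \<le> c / 2 * (norm (\<zeta> t))\<^sup>2" .
        have "norm (w t) < rN" using small(2)[OF t] rN(1) by (auto simp: R_def)
        from rN(2)[OF this] have "- (2 * ((N *v w t) \<bullet> s (w t))) \<le> \<mu> * (w t \<bullet> (N *v w t))" by simp
        from mult_left_mono[OF this, of c0]
        have 3: "- (c0 * (2 * ((N *v w t) \<bullet> s (w t)))) \<le> c0 * (\<mu> * (w t \<bullet> (N *v w t)))" using c0 by simp
        have "k1 * C3 * (norm (w t))\<^sup>2 = c0 * (\<mu> * (n1 * (w t \<bullet> w t)))"
          using \<mu> N(2) by (simp add: c0_def power2_norm_eq_inner)
        also have "\<dots> \<le> c0 * (\<mu> * (w t \<bullet> (N *v w t)))" using c0 \<mu> by (intro mult_left_mono N) auto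
        finally have 4: "k1 * C3 * (norm (w t))\<^sup>2 \<le> c0 * (\<mu> * (w t \<bullet> (N *v w t)))" .
        have "- (2 * \<mu>) * V t = - (2 * \<mu> * (\<zeta> t \<bullet> (M *v \<zeta> t))) + 2 * (c0 * (\<mu> * (w t \<bullet> (N *v w t))))"
          by (simp add: V_def algebra_simps)
        then show "2 * ((M *v \<zeta> t) \<bullet> \<zeta>' t) - c0 * (2 * ((N *v w t) \<bullet> s (w t))) \<le> - (2 * \<mu>) * V t"
          using 1 2 3 4 by linarith
      qed
      also have "\<dots> \<le> exp (- (2 * \<mu>) * (T - 0)) * (KM * KP\<^sup>2 * (norm (w 0))\<^sup>2)"
      proof (intro mult_left_mono)
        have w00: "0 \<le> w 0 \<bullet> (N *v w 0)" using N(2) order_trans[OF _ N(4)[of "w 0"]] by simp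
        have "\<kappa> 0 = 0" using \<kappa> by (simp add: bounded_linear.linear linear_0)
        then have \<zeta>0: "\<zeta> 0 = - (Pm *v w 0)" by (simp add: \<zeta>_def z0)
        have "norm (\<zeta> 0) \<le> KP * norm (w 0)" unfolding \<zeta>0 using KP(2) by simp
        moreover have "\<zeta> 0 \<bullet> (M *v \<zeta> 0) \<le> norm (\<zeta> 0) * (KM * norm (\<zeta> 0))"
          by (intro order_trans[OF norm_cauchy_schwarz] mult_left_mono KM) auto
        moreover have "norm (\<zeta> 0) * (KM * norm (\<zeta> 0)) \<le> (KP * norm (w 0)) * (KM * (KP * norm (w 0)))"
          using calculation(1) KM KP by (intro mult_mono mult_left_mono) auto
        ultimately have "\<zeta> 0 \<bullet> (M *v \<zeta> 0) \<le> KM * KP\<^sup>2 * (norm (w 0))\<^sup>2"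
          by (simp add: power2_eq_square mult_ac)
        moreover have "0 \<le> c0 * (w 0 \<bullet> (N *v w 0))" using c0 w00 by simp
        ultimately show "V 0 \<le> KM * KP\<^sup>2 * (norm (w 0))\<^sup>2" unfolding V_def by linarith
      qed simp
      finally have VT: "V T \<le> exp (- (2 * \<mu>) * T) * (KM * KP\<^sup>2 * (norm (w 0))\<^sup>2)" by simp
      have "m1 * (norm (\<zeta> T))\<^sup>2 \<le> c0 * (w T \<bullet> (N *v w T)) + exp (- (2 * \<mu>) * T) * (KM * KP\<^sup>2 * (norm (w 0))\<^sup>2)"
        using VT M(4)[of "\<zeta> T"] by (simp add: V_def power2_norm_eq_inner)
      also have "c0 * (w T \<bullet> (N *v w T)) \<le> (q\<^sup>2 * C3 / (\<mu> * n1)) * (KN * (norm (w T))\<^sup>2)"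
      proof (intro mult_mono)
        show "c0 \<le> q\<^sup>2 * C3 / (\<mu> * n1)"
          unfolding c0_def using k1(2) C3 \<mu> N(2) by (intro divide_right_mono mult_right_mono) auto
        have "w T \<bullet> (N *v w T) \<le> norm (w T) * (KN * norm (w T))"
          by (intro order_trans[OF norm_cauchy_schwarz] mult_left_mono KN) auto
        then show "w T \<bullet> (N *v w T) \<le> KN * (norm (w T))\<^sup>2" by (simp add: power2_eq_square mult_ac)
        show "0 \<le> w T \<bullet> (N *v w T)" using N(2) order_trans[OF _ N(4)[of "w T"]] by simp
      qed (use q C3 \<mu> N in auto)
      also have "(q\<^sup>2 * C3 / (\<mu> * n1)) * (KN * (norm (w T))\<^sup>2) + exp (- (2 * \<mu>) * T) * (KM * KP\<^sup>2 * (norm (w 0))\<^sup>2)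
         = (C3 / (\<mu> * n1) * KN) * (q * norm (w T))\<^sup>2 + (KM * KP\<^sup>2) * (exp (- \<mu> * T) * norm (w 0))\<^sup>2"
        by (simp add: power_mult_distrib exp_double[symmetric] mult_ac)
      also have "\<dots> \<le> (E * m1) * (q * norm (w T))\<^sup>2 + (E * m1) * (exp (- \<mu> * T) * norm (w 0))\<^sup>2"
        using M(2) by (intro add_mono mult_right_mono) (auto simp: E_def)
      also have "\<dots> \<le> (E * m1) * (q * norm (w T) + exp (- \<mu> * T) * norm (w 0))\<^sup>2"
      proof -
        have "0 \<le> (E * m1) * (2 * (q * norm (w T)) * (exp (- \<mu> * T) * norm (w 0)))"
          using E M(2) q by simp
        then show ?thesis by (simp add: power2_sum distrib_left)
      qed
      finally have "m1 * (norm (\<zeta> T))\<^sup>2 \<le> m1 * (E * (q * norm (w T) + exp (- \<mu> * T) * norm (w 0))\<^sup>2)"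
        by (simp add: mult_ac)
      then have "(norm (\<zeta> T))\<^sup>2 \<le> E * (q * norm (w T) + exp (- \<mu> * T) * norm (w 0))\<^sup>2"
        using M(2) by simp
      also have "\<dots> = (C * (q * norm (w T) + exp (- \<mu> * T) * norm (w 0)))\<^sup>2"
        using E by (simp add: C_def power_mult_distrib)
      finally have "norm (\<zeta> T) \<le> C * (q * norm (w T) + exp (- \<mu> * T) * norm (w 0))"
        by (rule power2_le_imp_le) (use C q in simp)
      then show ?thesis by (simp add: \<zeta>_def)
    qed
    show ?thesis using R concl by (intro exI[of _ R]) blast
  qed
  show ?thesis by (rule that[of C \<mu>]) (use C \<mu> main in blast)+
qed

text \<open>
  Regulation of the nonlinear system forces the linear error to vanish on the linear steady state. Each
  trajectory has an error that tends to zero, but without any uniformity; Baire's theorem provides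
  uniformity on an open set of exosystem states, and the nonwandering property brings a trajectory back to
  that set after the transient. There the error is small and the state is close to its linear steady
  state, so the linear error is small relative to the exosystem state. This argument takes the place of a
  centre manifold on which the error is zero.
\<close>

lemma steady_output_vanishes:
  fixes F :: "'b::real_inner \<Rightarrow> real ^ 'p \<Rightarrow> 'b" and s :: "real ^ 'p \<Rightarrow> real ^ 'p"
    and hc :: "'b \<Rightarrow> real ^ 'p \<Rightarrow> real"
    and \<kappa> :: "'b \<Rightarrow> real ^ 'm" and Jm :: "real ^ 'm ^ 'm" and Pm :: "real ^ 'p ^ 'm"
  assumes F: "strict_derivative (\<lambda>(z, w). F z w) (\<lambda>(z, w). D0 z + Dw w) (0, 0)" "F 0 0 = 0"
    and s: "strict_derivative s ((*v) S) 0" "s 0 = 0" "C2_on s W"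
    and hc: "strict_derivative (\<lambda>(z, w). hc z w) (\<lambda>(z, w). hz z + hw w) (0, 0)" "hc 0 0 = 0"
      "bounded_linear hz" "bounded_linear hw"
    and W: "open W" "0 \<in> W" and stable: "lyapunov_stable_origin s W"
    and nonw: "\<And>w. w \<in> W \<Longrightarrow> nonwandering s W w"
    and S: "\<And>l. complex_eigenvalue (complex_matrix S) l \<Longrightarrow> 0 \<le> Re l"
    and \<kappa>: "bounded_linear \<kappa>" and lam: "bounded_linear lam" and inv: "\<And>z. lam (\<kappa> z) = z"
    and J: "\<And>z. Jm *v (\<kappa> z) = \<kappa> (D0 z)" and hJ: "hurwitz Jm"
    and Pm: "\<And>w. Pm *v (S *v w) = Jm *v (Pm *v w) + \<kappa> (Dw w)"
    and \<delta>0: "\<delta>0 > 0"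
    and sol: "\<And>a. norm a < \<delta>0 \<Longrightarrow> \<exists>z w. z 0 = 0 \<and> w 0 = a \<and>
      (\<forall>t\<ge>0. (z has_vector_derivative F (z t) (w t)) (at t within {0..}) \<and>
        (w has_vector_derivative s (w t)) (at t within {0..}) \<and> w t \<in> W) \<and>
      ((\<lambda>t. hc (z t) (w t)) \<longlongrightarrow> 0) at_top"
  shows "hz (lam (Pm *v v)) + hw v = 0"
proof (rule ccontr)
  assume nz: "hz (lam (Pm *v v)) + hw v \<noteq> 0"
  define c where "c x = hz (lam (Pm *v x)) + hw x" for x
  have c: "bounded_linear c"
    unfolding c_def
    by (intro bounded_linear_add hc(4) bounded_linear_compose[OF hc(3)] bounded_linear_compose[OF lam]
        matrix_vector_mul_bounded_linear)
  have cv: "\<bar>c v\<bar> > 0" using nz by (simp add: c_def)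
  then have v: "norm v > 0" using c by (auto simp: bounded_linear.linear linear_0)
  obtain Kc where Kc: "Kc > 0" "\<And>x. norm (c x) \<le> norm x * Kc" using bounded_linear.pos_bounded[OF c] by auto
  obtain Kl where Kl: "Kl > 0" "\<And>x. norm (lam x) \<le> norm x * Kl" using bounded_linear.pos_bounded[OF lam] by auto
  obtain Kh where Kh: "Kh > 0" "\<And>x. norm (hz x) \<le> norm x * Kh" using bounded_linear.pos_bounded[OF hc(3)] by auto
  obtain KP where KP: "KP > 0" "\<And>x. norm (Pm *v x) \<le> KP * norm x" by (rule matrix_vector_bound[of Pm]) blast
  obtain C \<mu> where C: "C > 0" and \<mu>: "\<mu> > 0"
    and track: "\<And>q. 0 < q \<Longrightarrow> q \<le> 1 \<Longrightarrow> \<exists>R>0. \<forall>z w T. 0 \<le> T \<longrightarrow> z 0 = 0 \<longrightarrow>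
      (\<forall>t\<in>{0..T}. norm (z t) \<le> R \<and> norm (w t) \<le> R \<and>
        (z has_vector_derivative F (z t) (w t)) (at t within {0..T}) \<and>
        (w has_vector_derivative s (w t)) (at t within {0..T})) \<longrightarrow>
      norm (\<kappa> (z T) - Pm *v w T) \<le> C * (q * norm (w T) + exp (- \<mu> * T) * norm (w 0))"
    by (rule tracking_error_decay[OF F s(1,2) S \<kappa> lam inv J hJ Pm]) blast+
  define C' where "C' = (Kh * Kl + Kl) * C + Kl * KP + 1"
  have C': "C' > 0" using Kh Kl KP C by (simp add: C'_def add_pos_pos)
  \<comment> \<open>The relative tracking accuracy at which the deviation from the steady state can no longer compensate \<open>c v\<close>.\<close>
  define q where "q = min 1 (\<bar>c v\<bar> / (8 * C' * norm v))"
  have q: "0 < q" "q \<le> 1" using cv v C' by (simp_all add: q_def)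
  have qc: "C' * q * (2 * norm v) \<le> \<bar>c v\<bar> / 4"
  proof -
    have "C' * q * (2 * norm v) \<le> C' * (\<bar>c v\<bar> / (8 * C' * norm v)) * (2 * norm v)"
      using C' v by (intro mult_right_mono mult_left_mono) (auto simp: q_def)
    also have "\<dots> = \<bar>c v\<bar> / 4" using C' v by (simp add: field_simps)
    finally show ?thesis .
  qed
  obtain Rq where Rq: "Rq > 0"
    and trackq: "\<And>z w T. 0 \<le> T \<Longrightarrow> z 0 = 0 \<Longrightarrow>
      (\<forall>t\<in>{0..T}. norm (z t) \<le> Rq \<and> norm (w t) \<le> Rq \<and>
        (z has_vector_derivative F (z t) (w t)) (at t within {0..T}) \<and>
        (w has_vector_derivative s (w t)) (at t within {0..T})) \<Longrightarrow>
      norm (\<kappa> (z T) - Pm *v w T) \<le> C * (q * norm (w T) + exp (- \<mu> * T) * norm (w 0))"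
    using track[OF q] by blast
  obtain rh where rh: "rh > 0" "\<And>y z. y \<in> ball (0, 0) rh \<Longrightarrow> z \<in> ball (0, 0) rh \<Longrightarrow>
     norm ((\<lambda>(z, w). hc z w) y - (\<lambda>(z, w). hc z w) z - (\<lambda>(z, w). hz z + hw w) (y - z)) \<le> q * norm (y - z)"
    by (rule strict_derivativeE[OF hc(1) q(1)]) blast
  obtain rl Lh where rl: "rl > 0" "Lh > 0" "\<And>y z. y \<in> ball (0, 0) rl \<Longrightarrow> z \<in> ball (0, 0) rl \<Longrightarrow>
     norm ((\<lambda>(z, w). hc z w) y - (\<lambda>(z, w). hc z w) z) \<le> Lh * norm (y - z)"
    by (rule strict_derivative_lipschitz[OF hc(1)]) blast
  have "strict_derivative (\<lambda>p. s (snd p)) (\<lambda>p. S *v snd p) (0 :: 'b, 0)"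
    using strict_derivative_compose[OF strict_derivative_snd, of s "(*v) S" "(0 :: 'b, 0)"] s(1) by simp
  from strict_derivative_Pair[OF F(1) this]
  obtain rf L where rf: "rf > 0" "L > 0" "\<And>y z. y \<in> ball (0, 0) rf \<Longrightarrow> z \<in> ball (0, 0) rf \<Longrightarrow>
     norm ((case y of (z, w) \<Rightarrow> F z w, s (snd y)) - (case z of (z, w) \<Rightarrow> F z w, s (snd z))) \<le> L * norm (y - z)"
    by (rule strict_derivative_lipschitz) blast
  define R where "R = min (min Rq (rh / 3)) (min (rl / 3) (rf / 3))"
  have R: "R > 0" using Rq rh rl rf by (simp add: R_def)
  define G where "G = Kl * (2 * C + KP) + 1"
  have G: "G \<ge> 1" using Kl C KP by (simp add: G_def)
  define \<epsilon> where "\<epsilon> = R / G"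
  have \<epsilon>: "\<epsilon> > 0" "\<epsilon> \<le> R" "Kl * (2 * C + KP) * \<epsilon> < R"
  proof -
    show p: "\<epsilon> > 0" using R G by (simp add: \<epsilon>_def)
    have "G * \<epsilon> = R" using G by (simp add: \<epsilon>_def)
    moreover have "1 * \<epsilon> \<le> G * \<epsilon>" using G p by (intro mult_right_mono) auto
    moreover have "G * \<epsilon> = Kl * (2 * C + KP) * \<epsilon> + \<epsilon>" by (simp add: G_def algebra_simps)
    ultimately show "\<epsilon> \<le> R" "Kl * (2 * C + KP) * \<epsilon> < R" using p by linarith+
  qed
  note lipW = C2_on_locally_lipschitz[OF s(3) W(1)]
  obtain d where d: "d > 0"
    and bd: "\<And>a z \<tau> t. norm a < d \<Longrightarrow> 0 \<le> t \<Longrightarrow> t \<le> \<tau> \<Longrightarrow> ode_solution s W {0..\<tau>} a z \<Longrightarrow> norm (z t) < \<epsilon>"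
    by (rule lyapunov_stable_flow_bounded[OF lipW stable \<epsilon>(1)]) blast+
  define \<delta> where "\<delta> = min \<delta>0 d"
  have \<delta>: "\<delta> > 0" using \<delta>0 d by (simp add: \<delta>_def)
  have "\<forall>a. \<exists>z w. norm a < \<delta> \<longrightarrow> z 0 = 0 \<and> w 0 = a \<and>
      (\<forall>t\<ge>0. (z has_vector_derivative F (z t) (w t)) (at t within {0..}) \<and>
        (w has_vector_derivative s (w t)) (at t within {0..}) \<and> w t \<in> W) \<and>
      ((\<lambda>t. hc (z t) (w t)) \<longlongrightarrow> 0) at_top"
  proof
    fix a
    show "\<exists>z w. norm a < \<delta> \<longrightarrow> z 0 = 0 \<and> w 0 = a \<and>
      (\<forall>t\<ge>0. (z has_vector_derivative F (z t) (w t)) (at t within {0..}) \<and>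
        (w has_vector_derivative s (w t)) (at t within {0..}) \<and> w t \<in> W) \<and>
      ((\<lambda>t. hc (z t) (w t)) \<longlongrightarrow> 0) at_top"
    proof (cases "norm a < \<delta>")
      case True
      then have "norm a < \<delta>0" by (simp add: \<delta>_def)
      from sol[OF this] show ?thesis by (elim exE) (intro exI impI)
    qed simp
  qed
  then obtain Z where "\<forall>a. \<exists>w. norm a < \<delta> \<longrightarrow> Z a 0 = 0 \<and> w 0 = a \<and>
      (\<forall>t\<ge>0. (Z a has_vector_derivative F (Z a t) (w t)) (at t within {0..}) \<and>
        (w has_vector_derivative s (w t)) (at t within {0..}) \<and> w t \<in> W) \<and>
      ((\<lambda>t. hc (Z a t) (w t)) \<longlongrightarrow> 0) at_top"
    by (rule choice[THEN exE])
  then obtain w where "\<forall>a. norm a < \<delta> \<longrightarrow> Z a 0 = 0 \<and> w a 0 = a \<and>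
      (\<forall>t\<ge>0. (Z a has_vector_derivative F (Z a t) (w a t)) (at t within {0..}) \<and>
        (w a has_vector_derivative s (w a t)) (at t within {0..}) \<and> w a t \<in> W) \<and>
      ((\<lambda>t. hc (Z a t) (w a t)) \<longlongrightarrow> 0) at_top"
    by (rule choice[THEN exE])
  then have Z0: "Z a 0 = 0" and w0: "w a 0 = a"
    and dZ: "0 \<le> t \<Longrightarrow> (Z a has_vector_derivative F (Z a t) (w a t)) (at t within {0..})"
    and dw: "0 \<le> t \<Longrightarrow> (w a has_vector_derivative s (w a t)) (at t within {0..})"
    and wW: "0 \<le> t \<Longrightarrow> w a t \<in> W"
    and lim: "((\<lambda>t. hc (Z a t) (w a t)) \<longlongrightarrow> 0) at_top" if "norm a < \<delta>" for a t
    using that by blast+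
  have dZT: "(Z a has_vector_derivative F (Z a t) (w a t)) (at t within {u..T})"
    and dwT: "(w a has_vector_derivative s (w a t)) (at t within {u..T})"
    if "norm a < \<delta>" "t \<in> {u..T}" "0 \<le> u" for a t u T
    using dZ[OF that(1), of t] dw[OF that(1), of t] that(2,3)
    by (auto intro: has_vector_derivative_within_subset)
  have wsol: "ode_solution s W {0..T} a (w a)" if "norm a < \<delta>" for a T
    unfolding ode_solution_def using w0[OF that] dwT[OF that] wW[OF that] by auto
  have w\<epsilon>: "norm (w a t) < \<epsilon>" if "norm a < \<delta>" "0 \<le> t" for a t
    by (rule bd[OF _ that(2) order_refl wsol[OF that(1)]]) (use that in \<open>simp add: \<delta>_def\<close>)
  have dev: "norm (\<kappa> (Z a T) - Pm *v w a T) \<le> C * (q * norm (w a T) + exp (- \<mu> * T) * norm a)"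
    if a: "norm a < \<delta>" and T: "0 \<le> T" and b: "\<And>t. 0 \<le> t \<Longrightarrow> t \<le> T \<Longrightarrow> norm (Z a t) \<le> R" for a T
  proof -
    have "norm (Z a t) \<le> Rq \<and> norm (w a t) \<le> Rq" if "t \<in> {0..T}" for t
      using b[of t] w\<epsilon>[OF a, of t] \<epsilon>(2) that by (auto simp: R_def)
    then show ?thesis
      using trackq[of T "Z a" "w a"] T Z0[OF a] w0[OF a] dZT[OF a] dwT[OF a] by auto
  qed
  have ZP: "norm (Z a t) \<le> Kl * (norm (\<kappa> (Z a t) - Pm *v w a t) + KP * norm (w a t))" for a t
  proof -
    have "norm (\<kappa> (Z a t)) \<le> norm (\<kappa> (Z a t) - Pm *v w a t) + norm (Pm *v w a t)"
      by (metis diff_add_cancel norm_triangle_ineq)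
    also have "\<dots> \<le> norm (\<kappa> (Z a t) - Pm *v w a t) + KP * norm (w a t)" using KP(2) by simp
    finally have "norm (\<kappa> (Z a t)) * Kl \<le> (norm (\<kappa> (Z a t) - Pm *v w a t) + KP * norm (w a t)) * Kl"
      using Kl(1) by (intro mult_right_mono) auto
    then show ?thesis using Kl(2)[of "\<kappa> (Z a t)"] by (simp add: inv mult.commute)
  qed
  \<comment> \<open>The tracking estimate itself keeps the trajectory inside the ball on which it is valid.\<close>
  have ZR: "norm (Z a t) < R" if a: "norm a < \<delta>" and t: "0 \<le> t" for a t
  proof (rule continuity_bootstrap[where \<phi> = "\<lambda>t. norm (Z a t)", OF _ _ _ t])
    show "continuous_on {0..} (\<lambda>t. norm (Z a t))"
    proof (intro continuous_on_norm)
      show "continuous_on {0..} (Z a)"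
        unfolding continuous_on_eq_continuous_within
        using has_vector_derivative_continuous[OF dZ[OF a]] by auto
    qed
    show "norm (Z a 0) < R" using Z0[OF a] R by simp
    fix T assume T: "0 \<le> T" and b: "\<And>t. 0 \<le> t \<Longrightarrow> t \<le> T \<Longrightarrow> norm (Z a t) \<le> R"
    have "norm (\<kappa> (Z a T) - Pm *v w a T) \<le> C * (q * norm (w a T) + exp (- \<mu> * T) * norm a)"
      by (rule dev[OF a T b])
    also have "\<dots> \<le> C * (1 * \<epsilon> + 1 * \<epsilon>)"
      using q w\<epsilon>[OF a T] w\<epsilon>[OF a order_refl] w0[OF a] \<mu> T C \<epsilon>(1)
      by (intro mult_left_mono add_mono mult_mono) auto
    finally have "norm (Z a T) \<le> Kl * (C * (1 * \<epsilon> + 1 * \<epsilon>) + KP * \<epsilon>)"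
      using w\<epsilon>[OF a T] KP Kl by (intro order_trans[OF ZP] mult_left_mono add_mono) auto
    also have "\<dots> = Kl * (2 * C + KP) * \<epsilon>" by (simp add: algebra_simps)
    also have "\<dots> < R" by (rule \<epsilon>(3))
    finally show "norm (Z a T) < R" .
  qed
  have inb: "(Z a t, w a t) \<in> ball (0, 0) rh" "(Z a t, w a t) \<in> ball (0, 0) rl" "(Z a t, w a t) \<in> ball (0, 0) rf"
    if a: "norm a < \<delta>" and t: "0 \<le> t" for a t
  proof -
    have "norm (Z a t, w a t) \<le> norm (Z a t) + norm (w a t)" by (rule norm_Pair_le)
    also have "\<dots> < R + R" using ZR[OF a t] w\<epsilon>[OF a t] \<epsilon>(2) by linarith
    finally have n: "norm (Z a t, w a t) < R + R" .
    have "R + R < rh" "R + R < rl" "R + R < rf" using R by (auto simp: R_def)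
    with n show "(Z a t, w a t) \<in> ball (0, 0) rh" "(Z a t, w a t) \<in> ball (0, 0) rl" "(Z a t, w a t) \<in> ball (0, 0) rf"
      by (simp_all add: zero_prod_def[symmetric])
  qed
  define e where "e a t = hc (Z a t) (w a t)" for a t
  have est: "\<bar>c (w a t)\<bar> \<le> \<bar>e a t\<bar> + C' * (q * norm (w a t) + exp (- \<mu> * t) * norm a)"
    if a: "norm a < \<delta>" and t: "0 \<le> t" for a t
  proof -
    define D where "D = norm (\<kappa> (Z a t) - Pm *v w a t)"
    define g where "g = q * norm (w a t) + exp (- \<mu> * t) * norm a"
    have D: "D \<le> C * g" unfolding D_def g_def
      by (rule dev[OF a t]) (use ZR[OF a] less_imp_le in blast)
    have g0: "q * norm (w a t) \<le> g" "0 \<le> g" using q by (simp_all add: g_def)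
    have "(0, 0) \<in> ball (0 :: 'b, 0 :: real ^ 'p) rh" using rh(1) by (simp add: zero_prod_def[symmetric])
    from rh(2)[OF inb(1)[OF a t] this]
    have "norm (e a t - (hz (Z a t) + hw (w a t))) \<le> q * norm (Z a t, w a t)"
      by (simp add: e_def hc(2))
    also have "\<dots> \<le> q * (norm (Z a t) + norm (w a t))" using q by (intro mult_left_mono norm_Pair_le) auto
    finally have 1: "\<bar>hz (Z a t) + hw (w a t)\<bar> \<le> \<bar>e a t\<bar> + q * (norm (Z a t) + norm (w a t))"
      by (simp add: abs_if split: if_splits)
    have "hz (Z a t) - hz (lam (Pm *v w a t)) = hz (lam (\<kappa> (Z a t) - Pm *v w a t))"
      using lam hc(3) by (simp add: bounded_linear.linear linear_diff inv)
    moreover have "norm (hz (lam (\<kappa> (Z a t) - Pm *v w a t))) \<le> D * Kl * Kh"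
      unfolding D_def using Kh by (intro order_trans[OF Kh(2)] mult_right_mono Kl) auto
    ultimately have 2: "\<bar>c (w a t)\<bar> \<le> \<bar>hz (Z a t) + hw (w a t)\<bar> + D * Kl * Kh"
      unfolding c_def real_norm_def by linarith
    have "q * norm (Z a t) \<le> q * (Kl * (D + KP * norm (w a t)))"
      unfolding D_def using q by (intro mult_left_mono ZP) auto
    also have "\<dots> = q * (Kl * D) + Kl * KP * (q * norm (w a t))" by (simp add: algebra_simps)
    also have "\<dots> \<le> 1 * (Kl * D) + Kl * KP * g"
      using q Kl KP g0 by (intro add_mono mult_mono mult_left_mono) (auto simp: D_def)
    finally have 3: "q * norm (Z a t) \<le> Kl * D + Kl * KP * g" by simp
    have "\<bar>c (w a t)\<bar> \<le> \<bar>e a t\<bar> + (Kl * D + Kl * KP * g) + g + D * Kl * Kh"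
      using 1 2 3 g0 by (simp add: distrib_left)
    also have "\<dots> = \<bar>e a t\<bar> + (Kh * Kl + Kl) * D + (Kl * KP + 1) * g" by (simp add: algebra_simps)
    also have "\<dots> \<le> \<bar>e a t\<bar> + (Kh * Kl + Kl) * (C * g) + (Kl * KP + 1) * g"
      using Kh(1) Kl(1) D by (intro add_right_mono add_left_mono mult_left_mono) auto
    also have "\<dots> = \<bar>e a t\<bar> + C' * g" by (simp add: C'_def algebra_simps)
    finally show ?thesis by (simp add: g_def)
  qed
  \<comment> \<open>For a fixed time the error depends continuously on the initial state of the exosystem.\<close>
  have econt: "\<bar>e a t - e b t\<bar> \<le> Lh * exp (L * t) * norm (a - b)"
    if a: "norm a < \<delta>" and b: "norm b < \<delta>" and t: "0 \<le> t" for a b t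
  proof -
    have "norm ((Z a t, w a t) - (Z b t, w b t)) \<le> exp (L * (t - 0)) * norm ((Z a 0, w a 0) - (Z b 0, w b 0))"
    proof (rule trajectories_separation[OF t, where F = "\<lambda>y. (case y of (z, w) \<Rightarrow> F z w, s (snd y))"])
      fix x assume x: "x \<in> {0..t}"
      show "((\<lambda>t. (Z a t, w a t)) has_vector_derivative (case (Z a x, w a x) of (z, w) \<Rightarrow> F z w, s (snd (Z a x, w a x)))) (at x within {0..t})"
        using has_vector_derivative_Pair[OF dZT[OF a x order_refl] dwT[OF a x order_refl]] by simp
      show "((\<lambda>t. (Z b t, w b t)) has_vector_derivative (case (Z b x, w b x) of (z, w) \<Rightarrow> F z w, s (snd (Z b x, w b x)))) (at x within {0..t})"
        using has_vector_derivative_Pair[OF dZT[OF b x order_refl] dwT[OF b x order_refl]] by simp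
      show "norm ((case (Z a x, w a x) of (z, w) \<Rightarrow> F z w, s (snd (Z a x, w a x))) - (case (Z b x, w b x) of (z, w) \<Rightarrow> F z w, s (snd (Z b x, w b x))))
        \<le> L * norm ((Z a x, w a x) - (Z b x, w b x))"
        by (rule rf(3)[OF inb(3)[OF a] inb(3)[OF b]]) (use x in auto)
    qed
    also have "norm ((Z a 0, w a 0) - (Z b 0, w b 0)) = norm (a - b)"
      by (simp add: Z0[OF a] Z0[OF b] w0[OF a] w0[OF b] norm_prod_def)
    finally have "Lh * norm ((Z a t, w a t) - (Z b t, w b t)) \<le> Lh * (exp (L * t) * norm (a - b))"
      using rl(2) by (intro mult_left_mono) auto
    moreover have "norm (e a t - e b t) \<le> Lh * norm ((Z a t, w a t) - (Z b t, w b t))"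
      using rl(3)[OF inb(2)[OF a t] inb(2)[OF b t]] by (simp add: e_def)
    ultimately show ?thesis by simp
  qed
  define m where "m = \<delta> / (4 * norm v)"
  have m: "m > 0" using \<delta> v by (simp add: m_def)
  have mv: "m * norm v = \<delta> / 4" using v by (simp add: m_def)
  define \<rho> where "\<rho> = min (m * norm v) (m * \<bar>c v\<bar> / (4 * Kc))"
  have \<rho>: "\<rho> > 0" using m v cv Kc by (simp add: \<rho>_def)
  \<comment> \<open>A ball around a small multiple of \<open>v\<close> on which \<open>c\<close> stays above three quarters of its value at the centre.\<close>
  define B where "B = cball (m *\<^sub>R v) \<rho>"
  have nB: "norm x \<le> 2 * (m * norm v)" "norm x < \<delta>" "\<bar>c x\<bar> \<ge> 3 / 4 * (m * \<bar>c v\<bar>)" if "x \<in> B" for x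
  proof -
    have x: "norm (m *\<^sub>R v - x) \<le> \<rho>" using that by (simp add: B_def dist_norm)
    have "norm x \<le> norm (m *\<^sub>R v) + norm (m *\<^sub>R v - x)"
      using norm_triangle_ineq4[of "m *\<^sub>R v" "m *\<^sub>R v - x"] by simp
    also have "\<dots> \<le> m * norm v + m * norm v" using x m by (intro add_mono) (auto simp: \<rho>_def)
    finally show n: "norm x \<le> 2 * (m * norm v)" by simp
    then show "norm x < \<delta>" using mv \<delta> by simp
    have "norm (c (m *\<^sub>R v - x)) \<le> \<rho> * Kc" using Kc x by (intro order_trans[OF Kc(2)] mult_right_mono) auto
    also have "\<dots> \<le> (m * \<bar>c v\<bar> / (4 * Kc)) * Kc" using Kc by (intro mult_right_mono) (auto simp: \<rho>_def)
    also have "\<dots> = m * \<bar>c v\<bar> / 4" using Kc by simp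
    finally have "\<bar>m * c v - c x\<bar> \<le> m * \<bar>c v\<bar> / 4"
      using c by (simp add: bounded_linear.linear linear_diff linear_scale)
    moreover have "\<bar>m * c v\<bar> = m * \<bar>c v\<bar>" using m by (simp add: abs_mult)
    ultimately show "\<bar>c x\<bar> \<ge> 3 / 4 * (m * \<bar>c v\<bar>)" by linarith
  qed
  define e0 where "e0 = m * \<bar>c v\<bar> / 4"
  have e0: "e0 > 0" using m cv by (simp add: e0_def)
  define En where "En n = {a \<in> B. \<forall>t\<ge>real n. \<bar>e a t\<bar> \<le> e0}" for n :: nat
  have closedE: "closed (En n)" for n
  proof -
    have "closed {a \<in> B. \<bar>e a t\<bar> \<le> e0}" if t: "0 \<le> t" for t
    proof -
      have "(Lh * exp (L * t))-lipschitz_on B (\<lambda>a. e a t)"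
        using econt nB(2) t rl(2) by (intro lipschitz_onI) (auto simp: dist_norm)
      then have "continuous_on B (\<lambda>a. e a t)" by (rule lipschitz_on_continuous_on)
      then have "closed (B \<inter> (\<lambda>a. e a t) -` cball 0 e0)"
        by (rule continuous_closed_preimage) (auto simp: B_def)
      moreover have "B \<inter> (\<lambda>a. e a t) -` cball 0 e0 = {a \<in> B. \<bar>e a t\<bar> \<le> e0}" by auto
      ultimately show ?thesis by simp
    qed
    then have "closed (\<Inter>t\<in>{real n..}. {a \<in> B. \<bar>e a t\<bar> \<le> e0})" by (intro closed_INT) auto
    moreover have "En n = (\<Inter>t\<in>{real n..}. {a \<in> B. \<bar>e a t\<bar> \<le> e0})" by (auto simp: En_def)
    ultimately show ?thesis by simp
  qed
  have cover: "\<exists>n. a \<in> En n" if a: "a \<in> B" for a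
  proof -
    have "\<forall>\<^sub>F t in at_top. dist (e a t) 0 < e0"
      unfolding e_def by (rule tendstoD[OF lim[OF nB(2)[OF a]] e0])
    then obtain T where T: "\<And>t. t \<ge> T \<Longrightarrow> \<bar>e a t\<bar> < e0" unfolding eventually_at_top_linorder by auto
    obtain n where "T \<le> real n" using real_arch_simple by blast
    then have "\<bar>e a t\<bar> \<le> e0" if "t \<ge> real n" for t using T[of t] that by linarith
    then show ?thesis using a by (auto simp: En_def)
  qed
  \<comment> \<open>By Baire's theorem the error is uniformly small after some time on a nonempty open set of initial states.\<close>
  have "\<exists>n. \<not> B \<subseteq> closure (B - En n)"
  proof (rule ccontr)
    assume "\<not> (\<exists>n. \<not> B \<subseteq> closure (B - En n))"
    then have dense: "B \<subseteq> closure (B - En n)" for n by blast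
    have dense': "B \<subseteq> closure (\<Inter> (range (\<lambda>n. B - En n)))"
    proof (rule Baire)
      show "closed B" by (simp add: B_def)
      fix T assume "T \<in> range (\<lambda>n. B - En n)"
      then obtain n where T: "T = B - En n" by blast
      have "openin (top_of_set B) (B \<inter> - En n)" using closedE by (intro openin_open_Int open_Compl)
      then show "openin (top_of_set B) T \<and> B \<subseteq> closure T" using dense[of n] unfolding T by (simp add: Diff_eq)
    qed simp
    have empty: "\<Inter> (range (\<lambda>n. B - En n)) = {}" using cover by blast
    have "m *\<^sub>R v \<in> B" using \<rho> by (simp add: B_def)
    then show False using dense' unfolding empty closure_empty by blast
  qed
  then obtain n x where x: "x \<in> B" "x \<notin> closure (B - En n)" by blast
  define Q where "Q = - closure (B - En n) \<inter> ball (m *\<^sub>R v) \<rho>"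
  have "open Q" unfolding Q_def by (intro open_Int open_Compl closed_closure open_ball)
  have "x \<in> - closure (B - En n) \<inter> closure (ball (m *\<^sub>R v) \<rho>)" using x \<rho> by (simp add: B_def)
  then have "Q \<noteq> {}"
    unfolding Q_def using open_Int_closure_eq_empty[of "- closure (B - En n)" "ball (m *\<^sub>R v) \<rho>"]
    by (metis closed_closure empty_iff open_Compl)
  have QE: "a \<in> En n" "a \<in> B" if "a \<in> Q" for a
  proof -
    show "a \<in> B" using that by (auto simp: Q_def B_def)
    then show "a \<in> En n" using that closure_subset[of "B - En n"] by (auto simp: Q_def)
  qed
  \<comment> \<open>The nonwandering property returns a trajectory to that set after an arbitrarily long time.\<close>
  obtain p where p: "p \<in> Q" using \<open>Q \<noteq> {}\<close> by blast
  have "p \<in> W" using wW[OF nB(2)[OF QE(2)[OF p]], of 0] w0[OF nB(2)[OF QE(2)[OF p]]] by simp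
  have "m * \<bar>c v\<bar> / 8 > 0" using m cv by simp
  then obtain T where T: "T > 0" "\<And>t. t \<ge> T \<Longrightarrow> exp (- \<mu> * t) * (C' * \<delta>) < m * \<bar>c v\<bar> / 8"
    by (rule exp_decay_eventually[OF \<mu>]) blast
  have "max T (real n) > 0" using T by simp
  then obtain \<tau> where \<tau>: "\<tau> > max T (real n)" "flow_image s W \<tau> Q \<inter> Q \<noteq> {}"
    using nonw[OF \<open>p \<in> W\<close>] \<open>open Q\<close> p unfolding nonwandering_def by blast
  then obtain a z where az: "a \<in> Q" "ode_solution s W {0..\<tau>} a z" "z \<tau> \<in> Q"
    unfolding flow_image_def by auto
  note a\<delta> = nB(2)[OF QE(2)[OF az(1)]]
  have \<tau>0: "0 \<le> \<tau>" using \<tau> T by simp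
  have "z \<tau> = w a \<tau>" by (rule ode_unique[OF lipW az(2) wsol[OF a\<delta>]]) (use \<tau>0 in auto)
  then have wQ: "w a \<tau> \<in> B" using QE(2)[OF az(3)] by simp
  have "\<bar>e a \<tau>\<bar> \<le> e0" using QE(1)[OF az(1)] \<tau> by (simp add: En_def)
  moreover have "C' * (q * norm (w a \<tau>)) \<le> m * \<bar>c v\<bar> / 4"
  proof -
    have "C' * (q * norm (w a \<tau>)) \<le> C' * (q * (2 * (m * norm v)))"
      using C' q nB(1)[OF wQ] by (intro mult_left_mono) auto
    also have "\<dots> = m * (C' * q * (2 * norm v))" by simp
    also have "\<dots> \<le> m * (\<bar>c v\<bar> / 4)" using m qc by (intro mult_left_mono) auto
    finally show ?thesis by simp
  qed
  moreover have "C' * (exp (- \<mu> * \<tau>) * norm a) \<le> m * \<bar>c v\<bar> / 8"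
  proof -
    have "C' * (exp (- \<mu> * \<tau>) * norm a) \<le> C' * (exp (- \<mu> * \<tau>) * \<delta>)"
      using C' a\<delta> by (intro mult_left_mono) auto
    also have "\<dots> < m * \<bar>c v\<bar> / 8" using T(2)[of \<tau>] \<tau> by (simp add: mult_ac)
    finally show ?thesis by simp
  qed
  ultimately have "3 / 4 * (m * \<bar>c v\<bar>) \<le> m * \<bar>c v\<bar> / 4 + m * \<bar>c v\<bar> / 4 + m * \<bar>c v\<bar> / 8"
    using est[OF a\<delta> \<tau>0] nB(3)[OF wQ] unfolding e0_def distrib_left by linarith
  moreover have "0 < m * \<bar>c v\<bar>" using m cv by simp
  ultimately show False by linarith
qed

section \<open>Minimality of the order\<close>

text \<open>
  A real inner product space of dimension less than \<open>CARD('p)\<close>, possibly zero, as a complemented proper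
  subspace of a coordinate space; the map \<open>\<iota>\<close> is bounded below by compactness of a sphere.
\<close>

lemma small_space_embedding:
  assumes fd: "finite_dimensional TYPE('z::real_inner)" and small: "dim (UNIV :: 'z::real_inner set) < CARD('p::finite)"
  obtains \<iota> :: "'z::real_inner \<Rightarrow> real ^ 'p::finite" and \<rho> where "bounded_linear \<iota>" "bounded_linear \<rho>" "\<And>z. \<rho> (\<iota> z) = z" "\<not> surj \<iota>"
proof -
  obtain B0 :: "'z set" where B0: "finite B0" "span B0 = UNIV" using fd unfolding finite_dimensional_def by blast
  obtain B :: "'z set" where B: "independent B" "UNIV \<subseteq> span B" "card B = dim (UNIV :: 'z set)"
    by (rule basis_exists[of "UNIV :: 'z set"]) blast
  have fB: "finite B" using independent_span_bound[OF B0(1) B(1)] B0(2) by simp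
  have "card B \<le> card (UNIV :: 'p set)" using small B(3) by simp
  from card_le_inj[OF fB finite this] obtain e :: "'z \<Rightarrow> 'p" where e: "inj_on e B" by blast
  have "card (e ` B) < CARD('p)" using small B(3) e by (simp add: card_image)
  then have "e ` B \<noteq> UNIV" by auto
  then obtain j where j: "j \<notin> e ` B" by blast
  obtain \<iota> :: "'z \<Rightarrow> real ^ 'p" where \<iota>: "linear \<iota>" "\<And>b. b \<in> B \<Longrightarrow> \<iota> b = axis (e b) 1"
    using linear_independent_extend[OF B(1), of "\<lambda>b. axis (e b) 1"] by blast
  define \<rho> where "\<rho> v = (\<Sum>b\<in>B. v $ e b *\<^sub>R b)" for v :: "real ^ 'p"
  have \<rho>: "bounded_linear \<rho>"
    unfolding \<rho>_def
    by (intro bounded_linear_sum bounded_linear_scaleR_const bounded_linear_vec_nth)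
  have inv: "\<rho> (\<iota> z) = z" for z
  proof (rule linear_eq_on_span[of "\<lambda>z. \<rho> (\<iota> z)" "\<lambda>z. z" B z])
    show "linear (\<lambda>z. \<rho> (\<iota> z))"
      using linear_compose[OF \<iota>(1) bounded_linear.linear[OF \<rho>]] by (simp add: o_def)
    show "linear (\<lambda>z :: 'z. z)" by (rule linear_ident)
    show "z \<in> span B" using B(2) by auto
    fix b assume b: "b \<in> B"
    have "\<rho> (\<iota> b) = (\<Sum>b'\<in>B. if b' = b then b' else 0)"
      unfolding \<rho>_def \<iota>(2)[OF b]
      by (rule sum.cong) (use e b in \<open>auto simp: axis_def inj_on_def\<close>)
    then show "\<rho> (\<iota> b) = b" using fB b by simp
  qed
  have "\<iota> z $ j = 0" for z
  proof (rule linear_eq_on_span[of "\<lambda>z. \<iota> z $ j" "\<lambda>z. 0" B z])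
    show "linear (\<lambda>z. \<iota> z $ j)"
      using linear_compose[OF \<iota>(1) bounded_linear.linear[OF bounded_linear_vec_nth]] by (simp add: o_def)
    show "linear (\<lambda>z :: 'z. 0 :: real)" by (rule linear_zero)
    show "z \<in> span B" using B(2) by auto
    show "\<iota> b $ j = 0" if "b \<in> B" for b using j that by (auto simp: \<iota>(2) axis_def)
  qed
  then have nsurj: "\<not> surj \<iota>" by (metis axis_nth surjD zero_neq_one)
  have "\<exists>K. \<forall>z. norm (\<iota> z) \<le> norm z * K"
  proof (cases "\<exists>z. \<iota> z \<noteq> 0")
    case False
    then show ?thesis by (intro exI[of _ 0]) simp
  next
    case True
    then obtain z0 where z0: "\<iota> z0 \<noteq> 0" by blast
    define T where "T = range \<iota> \<inter> sphere 0 1"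
    have inT: "\<iota> (z /\<^sub>R norm (\<iota> z)) \<in> T" if "\<iota> z \<noteq> 0" for z
    proof -
      have "norm (\<iota> (z /\<^sub>R norm (\<iota> z))) = 1" using that by (simp add: linear_scale[OF \<iota>(1)])
      then show ?thesis by (simp only: T_def Int_iff rangeI mem_sphere_0)
    qed
    have "subspace (range \<iota>)" using \<iota>(1) by (rule linear_subspace_image) simp
    then have "closed (range \<iota>)" by (rule closed_subspace)
    then have "compact T" unfolding T_def by (rule closed_Int_compact) simp
    moreover have "T \<noteq> {}" using inT[OF z0] by blast
    moreover have "continuous_on T (\<lambda>v. norm (\<rho> v))"
      by (intro continuous_intros bounded_linear.continuous_on[OF \<rho>])
    ultimately obtain u where u: "u \<in> T" "\<And>v. v \<in> T \<Longrightarrow> norm (\<rho> u) \<le> norm (\<rho> v)"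
      using continuous_attains_inf[of T "\<lambda>v. norm (\<rho> v)"] by blast
    have "\<rho> u \<noteq> 0"
    proof
      assume "\<rho> u = 0"
      moreover obtain z where "u = \<iota> z" using u(1) by (auto simp: T_def)
      ultimately show False using u(1) inv[of z] linear_0[OF \<iota>(1)] by (simp add: T_def)
    qed
    then have pos: "norm (\<rho> u) > 0" by simp
    have "norm (\<iota> z) \<le> norm z * (1 / norm (\<rho> u))" for z
    proof (cases "\<iota> z = 0")
      case False
      from u(2)[OF inT[OF False]] have "norm (\<rho> u) \<le> norm z / norm (\<iota> z)" by (simp add: inv divide_inverse mult.commute)
      then show ?thesis using pos False by (simp add: field_simps)
    qed (use pos in simp)
    then show ?thesis by blast
  qed
  then obtain K where K: "\<And>z. norm (\<iota> z) \<le> norm z * K" by blast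
  have "bounded_linear \<iota>"
    by (rule bounded_linear_intro[of \<iota> K]) (use \<iota>(1) K in \<open>auto simp: linear_add linear_scale\<close>)
  then show ?thesis using \<rho> inv nsurj by (rule that)
qed

definition join :: "real ^ 'n \<Rightarrow> real ^ 'p \<Rightarrow> real ^ ('n + 'p)" where
  "join a b = (\<chi> i. case i of Inl k \<Rightarrow> a $ k | Inr k \<Rightarrow> b $ k)"

definition pr1 :: "real ^ ('n::finite + 'p::finite) \<Rightarrow> real ^ 'n" where "pr1 y = (\<chi> i. y $ Inl i)"
definition pr2 :: "real ^ ('n::finite + 'p::finite) \<Rightarrow> real ^ 'p" where "pr2 y = (\<chi> i. y $ Inr i)"

lemma pr_join [simp]: "pr1 (join a b) = a" "pr2 (join a b) = b"
  by (simp_all add: pr1_def pr2_def join_def vec_eq_iff)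

lemma join_eq_iff: "join a b = join a' b' \<longleftrightarrow> a = a' \<and> b = b'"
  by (metis pr_join)

lemma join_arith:
  "join a b + join a' b' = join (a + a') (b + b')" "join a b - join a' b' = join (a - a') (b - b')"
  "r *\<^sub>R join a b = join (r *\<^sub>R a) (r *\<^sub>R b)" "join 0 0 = 0"
  by (auto simp: join_def vec_eq_iff split: sum.split)

lemma linear_join_pr: "linear (\<lambda>p. join (fst p) (snd p))" "linear pr1" "linear pr2"
  by (auto intro!: linearI simp: join_arith pr1_def pr2_def vec_eq_iff)

lemma hblock_join: "hblock M N *v join a b = M *v a + N *v b"
  for M :: "real ^ 'n ^ 'm" and N :: "real ^ 'p ^ 'm"
  by (simp add: vec_eq_iff hblock_def join_def matrix_vector_mult_def UNIV_Plus_UNIV[symmetric] sum.Plus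
      del: UNIV_Plus_UNIV)

lemma vblock_mult: "vblock M N *v y = join (M *v y) (N *v y)"
  for M :: "real ^ 'k ^ 'm" and N :: "real ^ 'k ^ 'l"
  by (auto simp: vec_eq_iff vblock_def join_def matrix_vector_mult_def split: sum.split)

lemma detectable_real:
  fixes A :: "real ^ 'n ^ 'n" and P :: "real ^ 'p ^ 'n" and C :: "real ^ 'n ^ 1" and Q :: "real ^ 'p ^ 1"
  assumes "detectable (hblock C Q) (vblock (hblock A P) (hblock 0 S))"
    and "A *v a + P *v b = r *\<^sub>R a - t *\<^sub>R a'" "A *v a' + P *v b' = r *\<^sub>R a' + t *\<^sub>R a"
    and "S *v b = r *\<^sub>R b - t *\<^sub>R b'" "S *v b' = r *\<^sub>R b' + t *\<^sub>R b"
    and "C *v a + Q *v b = 0" "C *v a' + Q *v b' = 0" "0 \<le> r"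
  shows "b = 0 \<and> b' = 0"
proof (rule ccontr)
  assume nz: "\<not> (b = 0 \<and> b' = 0)"
  obtain v where v: "Re_vec v = join a b" "Im_vec v = join a' b'" by (rule obtain_complex_vec)
  have "v \<noteq> 0" using nz v by (metis Re_Im_vec_simps(1,2) join_arith(4) join_eq_iff)
  moreover have "complex_matrix (vblock (hblock A P) (hblock 0 S)) *v v = Complex r t *s v"
    using assms(2-5) by (simp add: complex_vec_eq_iff v vblock_mult hblock_join join_arith)
  moreover have "complex_matrix (hblock C Q) *v v = 0"
    using assms(6,7) by (simp add: complex_vec_eq_iff v hblock_join)
  ultimately show False using assms(1,8) unfolding detectable_def by (metis complex.sel(1))
qed

lemma jacobian_strict_derivative:
  fixes F :: "real ^ 'n \<Rightarrow> real ^ 'm"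
  assumes "strict_derivative F D a"
  shows "jacobian F (at a) = matrix D" "jacobian F (at a) *v x = D x"
proof -
  show *: "jacobian F (at a) = matrix D"
    unfolding jacobian_def frechet_derivative_at[OF strict_derivative_has_derivative[OF assms], symmetric] ..
  show "jacobian F (at a) *v x = D x"
    unfolding * using strict_derivative_linear[OF assms] by (simp add: bounded_linear.linear matrix_works)
qed

context plant_exosystem
begin

text \<open>
  In the linear steady state with exosystem state \<open>v\<close> let \<open>x v\<close> and \<open>\<xi> v\<close> be the states of plant and
  controller. Since the error is zero there, \<open>\<xi>\<close> intertwines \<open>S\<close> with the linearised controller, so its
  kernel is invariant under \<open>S\<close>. In an eigenvector from this kernel the controller is at rest and the plant
  is driven by the exosystem without visible error, which contradicts detectability. Hence \<open>\<xi>\<close> is injective.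
\<close>

theorem minimal_controller_order:
  fixes Xc :: "'z::real_inner set"
  assumes contr: "controller U Ye Xc \<eta> \<theta>" and solves: "solves_regulator_problem f h s X W Xc \<eta> \<theta>"
  shows "CARD('p) \<le> dim (UNIV :: 'z set)"
proof (rule ccontr)
  assume "\<not> CARD('p) \<le> dim (UNIV :: 'z set)"
  then have small: "dim (UNIV :: 'z set) < CARD('p)" by simp
  have fd: "finite_dimensional TYPE('z)" using contr by (simp add: controller_def)
  obtain \<iota> :: "'z \<Rightarrow> real ^ 'p" and \<rho> where \<iota>: "bounded_linear \<iota>" and \<rho>: "bounded_linear \<rho>"
    and inv: "\<And>z. \<rho> (\<iota> z) = z" and nsurj: "\<not> surj \<iota>"
    by (rule small_space_embedding[OF fd small]) blast
  have c: "open Xc" "0 \<in> Xc" "C2_on (\<lambda>(\<xi>, e). \<eta> \<xi> e) (Xc \<times> Ye)" "\<eta> 0 0 = 0" "C2_on \<theta> Xc" "\<theta> 0 = 0"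
    "open (Xc \<times> Ye)"
    using contr Ye by (auto simp: controller_def open_Times)
  obtain \<theta>' where \<theta>': "strict_derivative \<theta> \<theta>' 0" by (rule C2_on_strict_derivative[OF c(5,1,2)])
  have "(0, 0) \<in> Xc \<times> Ye" using c(2) Ye(2) by simp
  from C2_on_strict_derivative[OF c(3,7) this]
  obtain \<eta>' where \<eta>': "strict_derivative (\<lambda>(\<xi>, e). \<eta> \<xi> e) \<eta>' (0, 0)" .
  define F where "F z w = (f (fst z) (\<theta> (snd z)) w, \<eta> (snd z) (h (fst z) (\<theta> (snd z)) w))"
    for z :: "(real ^ 'n) \<times> 'z" and w
  define hc where "hc z w = h (fst z) (\<theta> (snd z)) w" for z :: "(real ^ 'n) \<times> 'z" and w
  define D0 where "D0 z = (f' (fst z, \<theta>' (snd z), 0), \<eta>' (snd z, h' (fst z, \<theta>' (snd z), 0)))" for z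
  define Dw where "Dw w = (f' (0, 0, w), \<eta>' (0, h' (0, 0, w)))" for w
  define hz where "hz z = h' (fst z, \<theta>' (snd z), 0)" for z
  define hw where "hw w = h' (0, 0, w)" for w
  have linf: "linear f'" and linh: "linear h'" and lint: "linear \<theta>'" and line: "linear \<eta>'"
    using f' h' \<theta>' \<eta>' strict_derivative_linear bounded_linear.linear by blast+
  have hsum: "h' (x, \<theta>' \<xi>, w) = hz (x, \<xi>) + hw w" for x \<xi> w
    unfolding hz_def hw_def by (simp add: linear_add[OF linh, symmetric])
  have Dsum: "(f' (x, \<theta>' \<xi>, w), \<eta>' (\<xi>, h' (x, \<theta>' \<xi>, w))) = D0 (x, \<xi>) + Dw w" for x \<xi> w
    unfolding D0_def Dw_def
    by (simp add: linear_add[OF linf, symmetric] linear_add[OF line, symmetric] linear_add[OF linh, symmetric])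
  have cl: "strict_derivative (closed_loop f h s \<eta> \<theta>)
      (\<lambda>(x, \<xi>, w). (f' (x, \<theta>' \<xi>, w), \<eta>' (\<xi>, h' (x, \<theta>' \<xi>, w)), S *v w)) (0, 0, 0)"
    "strict_derivative (loop_error h \<theta>) (\<lambda>(x, \<xi>, w). h' (x, \<theta>' \<xi>, w)) (0, 0, 0)"
    using closed_loop_strict_derivative[of f f' 0 \<theta> 0 0 h h' \<theta>' \<eta> \<eta>' s "(*v) S"] f' h' \<theta>' \<eta>' s' c(6) h0
    by simp_all
  define as where "as p = (fst (fst p), snd (fst p), snd p)" for p :: "((real ^ 'n) \<times> 'z) \<times> (real ^ 'p)"
  have as: "strict_derivative as as (0, 0)"
    unfolding as_def by (intro strict_derivative_bounded_linear bounded_linear_intros)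
  have as0: "as (0, 0) = (0, 0, 0)" by (simp add: as_def)
  have sdF: "strict_derivative (\<lambda>(z, w). F z w) (\<lambda>(z, w). D0 z + Dw w) (0, 0)"
  proof -
    have "bounded_linear (\<lambda>p :: (real ^ 'n) \<times> 'z \<times> (real ^ 'p). (fst p, fst (snd p)))" by (intro bounded_linear_intros)
    from strict_derivative_linear_compose[OF strict_derivative_compose[OF as cl(1)[folded as0]] this]
    have "strict_derivative (\<lambda>p. F (fst p) (snd p))
       (\<lambda>p. (f' (fst (fst p), \<theta>' (snd (fst p)), snd p), \<eta>' (snd (fst p), h' (fst (fst p), \<theta>' (snd (fst p)), snd p)))) (0, 0)"
      by (simp add: F_def as_def closed_loop_def)
    then show ?thesis unfolding Dsum by (simp add: case_prod_unfold)
  qed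
  have sdh: "strict_derivative (\<lambda>(z, w). hc z w) (\<lambda>(z, w). hz z + hw w) (0, 0)"
    using strict_derivative_compose[OF as cl(2)[folded as0]]
    by (simp add: hc_def as_def loop_error_def hsum case_prod_unfold)
  have F0: "F 0 0 = 0" and hc0: "hc 0 0 = 0"
    by (simp_all add: F_def hc_def c(4,6) f0 h0 zero_prod_def)
  have embz: "bounded_linear (\<lambda>z :: (real ^ 'n) \<times> 'z. (z, 0 :: real ^ 'p))"
    and embw: "bounded_linear (\<lambda>w :: real ^ 'p. (0 :: (real ^ 'n) \<times> 'z, w))"
    by (intro bounded_linear_intros)+
  have D00: "D0 0 = 0" and Dw0: "Dw 0 = 0" and hz0: "hz 0 = 0" and hw0: "hw 0 = 0"
    using linear_0[OF linf] linear_0[OF linh] linear_0[OF line] linear_0[OF lint]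
    by (simp_all add: D0_def Dw_def hz_def hw_def zero_prod_def)
  have bl: "bounded_linear D0" "bounded_linear Dw" "bounded_linear hz" "bounded_linear hw"
    using bounded_linear_compose[OF strict_derivative_linear[OF sdF] embz]
      bounded_linear_compose[OF strict_derivative_linear[OF sdF] embw]
      bounded_linear_compose[OF strict_derivative_linear[OF sdh] embz]
      bounded_linear_compose[OF strict_derivative_linear[OF sdh] embw]
    by (simp_all add: D00 Dw0 hz0 hw0)
  \<comment> \<open>Plant and controller states are embedded in one coordinate space; the added directions are made stable by \<open>- (y - \<kappa> (lam y))\<close>.\<close>
  define \<kappa> where "\<kappa> z = join (fst z) (\<iota> (snd z))" for z :: "(real ^ 'n) \<times> 'z"
  define lam where "lam y = (pr1 y, \<rho> (pr2 y))" for y :: "real ^ ('n + 'p)"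
  have \<kappa>: "bounded_linear \<kappa>"
  proof -
    have "bounded_linear (\<lambda>z :: (real ^ 'n) \<times> 'z. (fst z, \<iota> (snd z)))"
      by (intro bounded_linear_Pair bounded_linear_fst bounded_linear_compose[OF \<iota>] bounded_linear_snd)
    from bounded_linear_compose[OF linear_join_pr(1)[unfolded linear_conv_bounded_linear] this]
    show ?thesis by (simp add: \<kappa>_def[abs_def])
  qed
  have lam: "bounded_linear lam"
    unfolding lam_def
    by (intro bounded_linear_Pair bounded_linear_compose[OF \<rho>] linear_join_pr(2,3)[unfolded linear_conv_bounded_linear])
  have inv': "lam (\<kappa> z) = z" for z by (simp add: lam_def \<kappa>_def inv)
  define Jf where "Jf y = \<kappa> (D0 (lam y)) - (y - \<kappa> (lam y))" for y
  have blJ: "bounded_linear Jf"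
    unfolding Jf_def
    by (intro bounded_linear_sub bounded_linear_ident bounded_linear_compose[OF \<kappa>] bounded_linear_compose[OF bl(1)] lam)
  define Jm where "Jm = matrix Jf"
  have Jm: "Jm *v y = Jf y" for y unfolding Jm_def using blJ by (simp add: bounded_linear.linear matrix_works)
  have J\<kappa>: "Jm *v (\<kappa> z) = \<kappa> (D0 z)" for z unfolding Jm Jf_def inv' by simp
  have lamJ: "lam (Jm *v y) = D0 (lam y)" for y
    unfolding Jm Jf_def using lam by (simp add: bounded_linear.linear linear_diff inv')
  have hJ: "hurwitz Jm"
  proof (rule hurwitz_of_exp_stable[of "\<lambda>z. F z 0" D0 "X \<times> Xc" \<kappa> lam Jm])
    show "strict_derivative (\<lambda>z. F z 0) D0 0"
      using strict_derivative_compose[OF strict_derivative_bounded_linear[OF embz, of 0] sdF] by (simp add: Dw0)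
    have "(\<lambda>z. F z 0) = unforced_loop f h \<eta> \<theta>"
      by (simp add: F_def unforced_loop_def fun_eq_iff)
    then show "locally_exp_stable_origin (\<lambda>z. F z 0) (X \<times> Xc)"
      using solves by (simp add: solves_regulator_problem_loop)
    show "open (X \<times> Xc)" using X c(1) by (simp add: open_Times)
    show "Jm *v y = \<kappa> (D0 (lam y)) - (y - \<kappa> (lam y))" for y by (simp add: Jm Jf_def)
  qed (use \<kappa> lam inv' in auto)
  define Em where "Em = matrix (\<lambda>w. \<kappa> (Dw w))"
  have Em: "Em *v w = \<kappa> (Dw w)" for w
    unfolding Em_def using bounded_linear_compose[OF \<kappa> bl(2)] by (simp add: bounded_linear.linear matrix_works)
  obtain Pm where "Pm ** S - Jm ** Pm = Em"
    by (rule sylvester_solution[OF hJ, of S Em]) (use exosystem_spectrum_imaginary in auto)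
  then have "Pm ** S = Jm ** Pm + Em" by (simp add: algebra_simps)
  then have Pm: "Pm *v (S *v w) = Jm *v (Pm *v w) + \<kappa> (Dw w)" for w
    by (metis Em matrix_vector_mul_assoc matrix_vector_mult_add_rdistrib)
  obtain N where N: "open N" "0 \<in> N"
    and Nsol: "\<And>a. a \<in> N \<Longrightarrow> \<exists>z. ode_solution (closed_loop f h s \<eta> \<theta>) (X \<times> Xc \<times> W) {0..} a z \<and>
      ((\<lambda>t. loop_error h \<theta> (z t)) \<longlongrightarrow> 0) at_top"
  proof -
    from solves obtain N where N: "open N" "0 \<in> N"
      and sol: "\<forall>a\<in>N. \<exists>z. ode_solution (closed_loop f h s \<eta> \<theta>) (X \<times> Xc \<times> W) {0..} a z \<and>
        (\<forall>z'. ode_solution (closed_loop f h s \<eta> \<theta>) (X \<times> Xc \<times> W) {0..} a z' \<longrightarrow> (\<forall>t\<ge>0. z' t = z t)) \<and>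
        ((\<lambda>t. loop_error h \<theta> (z t)) \<longlongrightarrow> 0) at_top"
      unfolding solves_regulator_problem_loop by (elim conjE exE) (rule that)
    show ?thesis
      by (rule that[OF N], drule bspec[OF sol], elim exE conjE, intro exI conjI)
  qed
  obtain \<delta>0 where \<delta>0: "\<delta>0 > 0" "ball 0 \<delta>0 \<subseteq> N" by (rule openE[OF N])
  have sol: "\<exists>z w. z 0 = 0 \<and> w 0 = a \<and>
      (\<forall>t\<ge>0. (z has_vector_derivative F (z t) (w t)) (at t within {0..}) \<and>
        (w has_vector_derivative s (w t)) (at t within {0..}) \<and> w t \<in> W) \<and>
      ((\<lambda>t. hc (z t) (w t)) \<longlongrightarrow> 0) at_top" if a: "norm a < \<delta>0" for a
  proof -
    have "norm (0 :: real ^ 'n, 0 :: 'z, a) < \<delta>0" using a by (simp add: norm_prod_def)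
    then have "(0, 0, a) \<in> N" using \<delta>0(2) by (auto simp: dist_norm)
    from Nsol[OF this] obtain y
      where y: "ode_solution (closed_loop f h s \<eta> \<theta>) (X \<times> Xc \<times> W) {0..} (0, 0, a) y"
      and lim: "((\<lambda>t. loop_error h \<theta> (y t)) \<longlongrightarrow> 0) at_top" by blast
    define z where "z t = (fst (y t), fst (snd (y t)))" for t
    define w where "w t = snd (snd (y t))" for t
    have y0: "y 0 = (0, 0, a)" using y by (simp add: ode_solution_def)
    have "(z has_vector_derivative F (z t) (w t)) (at t within {0..}) \<and>
        (w has_vector_derivative s (w t)) (at t within {0..}) \<and> w t \<in> W" if t: "0 \<le> t" for t
    proof -
      have dy: "(y has_vector_derivative closed_loop f h s \<eta> \<theta> (y t)) (at t within {0..})"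
        and dom: "y t \<in> X \<times> Xc \<times> W" using y t by (simp_all add: ode_solution_def)
      have "bounded_linear (\<lambda>p :: (real ^ 'n) \<times> 'z \<times> (real ^ 'p). (fst p, fst (snd p)))"
        "bounded_linear (\<lambda>p :: (real ^ 'n) \<times> 'z \<times> (real ^ 'p). snd (snd p))" by (intro bounded_linear_intros)+
      from this[THEN bounded_linear.has_vector_derivative, OF dy]
      show ?thesis using dom unfolding z_def w_def F_def by (auto simp: closed_loop_def case_prod_unfold)
    qed
    moreover have "((\<lambda>t. hc (z t) (w t)) \<longlongrightarrow> 0) at_top"
      using lim by (simp add: hc_def z_def w_def loop_error_def case_prod_unfold)
    moreover have "z 0 = 0" "w 0 = a" by (simp_all add: z_def w_def y0 zero_prod_def)
    ultimately show ?thesis by blast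
  qed
  have out: "hz (lam (Pm *v v)) + hw v = 0" for v
    by (rule steady_output_vanishes[OF sdF F0 s' s0 s_C2 sdh hc0 bl(3,4) W stable nonw _ \<kappa> lam inv' J\<kappa> hJ Pm \<delta>0(1) sol])
       (use exosystem_spectrum_imaginary in auto)
  define x where "x v = fst (lam (Pm *v v))" for v
  define \<xi> where "\<xi> v = snd (lam (Pm *v v))" for v
  have bx: "bounded_linear x" and b\<xi>: "bounded_linear \<xi>"
    unfolding x_def \<xi>_def
    by (intro bounded_linear_compose[OF bounded_linear_fst] bounded_linear_compose[OF bounded_linear_snd]
        bounded_linear_compose[OF lam] matrix_vector_mul_bounded_linear)+
  have h'0: "h' (x v, \<theta>' (\<xi> v), v) = 0" for v
    unfolding hsum x_def \<xi>_def prod.collapse by (rule out)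
  have "lam (Pm *v (S *v v)) = D0 (lam (Pm *v v)) + Dw v" for v
    unfolding Pm using lam by (simp add: bounded_linear.linear linear_add lamJ inv')
  then have "(x (S *v v), \<xi> (S *v v)) = D0 (x v, \<xi> v) + Dw v" for v
    unfolding x_def \<xi>_def prod.collapse .
  then have "(x (S *v v), \<xi> (S *v v)) = (f' (x v, \<theta>' (\<xi> v), v), \<eta>' (\<xi> v, 0))" for v
    unfolding Dsum[symmetric] h'0 .
  then have xS: "x (S *v v) = f' (x v, \<theta>' (\<xi> v), v)" and \<xi>S: "\<xi> (S *v v) = \<eta>' (\<xi> v, 0)" for v
    by simp_all
  \<comment> \<open>Exosystem directions that leave no trace in the controller state; there are some because the controller state has too few dimensions.\<close>
  define K where "K = {v. \<xi> v = 0}"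
  have K: "subspace K"
    unfolding K_def subspace_def
    using b\<xi> by (auto simp: bounded_linear.linear linear_0 linear_add linear_scale)
  have KS: "S *v v \<in> K" if "v \<in> K" for v
    using that \<xi>S[of v] linear_0[OF line] by (simp add: K_def zero_prod_def)
  have lin\<iota>\<xi>: "linear (\<lambda>v. \<iota> (\<xi> v))"
    using bounded_linear_compose[OF \<iota> b\<xi>] by (rule bounded_linear.linear)
  have "range (\<lambda>v. \<iota> (\<xi> v)) \<subseteq> range \<iota>" by blast
  then have "\<not> surj (\<lambda>v. \<iota> (\<xi> v))" using nsurj by blast
  then have "\<not> inj (\<lambda>v. \<iota> (\<xi> v))" using linear_injective_imp_surjective[OF lin\<iota>\<xi> _ refl] by blast
  then obtain v where "v \<noteq> 0" "\<iota> (\<xi> v) = 0" using linear_injective_0[OF lin\<iota>\<xi>] by blast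
  moreover have "\<rho> 0 = 0" using \<rho> by (simp add: bounded_linear.linear linear_0)
  ultimately have "v \<noteq> 0" "v \<in> K" using inv[of "\<xi> v"] by (auto simp: K_def)
  then have nK: "\<not> K \<subseteq> {0}" by blast
  have zero: "subspace {0 :: real ^ 'p}" "\<And>v. v \<in> {0} \<Longrightarrow> S *v v \<in> {0}" by simp_all
  obtain a b l where ab: "a \<in> K" "b \<in> K" "a \<notin> {0} \<or> b \<notin> {0}"
    "S *v a - (Re l *\<^sub>R a - Im l *\<^sub>R b) \<in> {0}" "S *v b - (Re l *\<^sub>R b + Im l *\<^sub>R a) \<in> {0}"
    "complex_eigenvalue (complex_matrix S) l"
    by (rule quotient_eigenvector[OF K KS zero nK])
  have Sab: "S *v a = Re l *\<^sub>R a - Im l *\<^sub>R b" "S *v b = Re l *\<^sub>R b + Im l *\<^sub>R a" using ab(4,5) by simp_all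
  have \<xi>ab: "\<theta>' (\<xi> a) = 0" "\<theta>' (\<xi> b) = 0" using ab(1,2) linear_0[OF lint] by (simp_all add: K_def)
  have "a = 0 \<and> b = 0"
  proof (rule detect[OF _ _ Sab])
    show "f' (x a, 0, a) = Re l *\<^sub>R x a - Im l *\<^sub>R x b"
      using xS[of a] bx unfolding \<xi>ab Sab by (simp add: bounded_linear.linear linear_diff linear_scale)
    show "f' (x b, 0, b) = Re l *\<^sub>R x b + Im l *\<^sub>R x a"
      using xS[of b] bx unfolding \<xi>ab Sab by (simp add: bounded_linear.linear linear_add linear_scale)
    show "h' (x a, 0, a) = 0" "h' (x b, 0, b) = 0" using h'0[of a] h'0[of b] unfolding \<xi>ab by simp_all
    show "0 \<le> Re l" using exosystem_spectrum_imaginary[OF ab(6)] by simp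
  qed
  then show False using ab(3) by simp
qed

end

section \<open>Regulation by a copy of the exosystem\<close>

theorem corollary4p3:
  fixes f :: "real ^ 'n \<Rightarrow> real \<Rightarrow> real ^ 'p \<Rightarrow> real ^ 'n"
    and g h :: "real ^ 'n \<Rightarrow> real \<Rightarrow> real ^ 'p \<Rightarrow> real"
    and s :: "real ^ 'p \<Rightarrow> real ^ 'p"
    and q :: "real ^ 'p \<Rightarrow> real"
    and X :: "(real ^ 'n) set" and U Y Ye :: "real set" and W Wo :: "(real ^ 'p) set"
    and A :: "real ^ 'n ^ 'n" and P :: "real ^ 'p ^ 'n"
    and C :: "real ^ 'n ^ 1" and Q :: "real ^ 'p ^ 1" and S :: "real ^ 'p ^ 'p"
    and \<pi> :: "real ^ 'p \<Rightarrow> real ^ 'n" and \<gamma> :: "real ^ 'p \<Rightarrow> real"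
  assumes sets: "open X" "0 \<in> X" "open U" "0 \<in> U" "open Y" "0 \<in> Y" "open W" "0 \<in> W"
      "open Ye" "Y \<subseteq> Ye"
    and f: "C2_on (\<lambda>(x, u, w). f x u w) (X \<times> U \<times> W)" "f 0 0 0 = 0"
    and g: "C2_on (\<lambda>(x, u, w). g x u w) (X \<times> U \<times> W)" "g 0 0 0 = 0"
      "\<forall>x\<in>X. \<forall>u\<in>U. \<forall>w\<in>W. g x u w \<in> Y"
    and s: "C2_on s W" "s 0 = 0"
    and q: "C2_on q W" "q 0 = 0" "\<forall>w\<in>W. q w \<in> Y"
    and h: "h = (\<lambda>x u w. g x u w - q w)" "\<forall>x\<in>X. \<forall>u\<in>U. \<forall>w\<in>W. h x u w \<in> Ye"
    and exosystem: "lyapunov_stable_origin s W" "\<forall>w\<in>W. nonwandering s W w"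
    and linearization:
      "A = jacobian (\<lambda>x. f x 0 0) (at 0)"
      "P = jacobian (\<lambda>w. f 0 0 w) (at 0)"
      "C = jacobian (\<lambda>x. vec (h x 0 0)) (at 0)"
      "Q = jacobian (\<lambda>w. vec (h 0 0 w)) (at 0)"
      "S = jacobian s (at 0)"
    and "stable_matrix A"
    and "detectable (hblock C Q) (vblock (hblock A P) (hblock 0 S))"
    and Wo: "open Wo" "0 \<in> Wo" "Wo \<subseteq> W"
    and \<pi>: "C2_on \<pi> Wo" "\<pi> 0 = 0" "\<forall>w\<in>Wo. \<pi> w \<in> X"
    and \<gamma>: "C2_on \<gamma> Wo" "\<gamma> 0 = 0" "\<forall>w\<in>Wo. \<gamma> w \<in> U"
    and regulator_equations:
      "\<forall>w\<in>Wo. jacobian \<pi> (at w) *v s w = f (\<pi> w) (\<gamma> w) w"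
      "\<forall>w\<in>Wo. h (\<pi> w) (\<gamma> w) w = 0"
  shows "(\<exists>Bc :: real ^ 'p.
            controller U Ye Wo (\<lambda>\<xi> e. s \<xi> + e *\<^sub>R Bc) \<gamma> \<and>
            solves_regulator_problem f h s X W Wo (\<lambda>\<xi> e. s \<xi> + e *\<^sub>R Bc) \<gamma>) \<and>
         (\<forall>(Xc :: 'z::real_inner set) \<eta> \<theta>.
            controller U Ye Xc \<eta> \<theta> \<and> solves_regulator_problem f h s X W Xc \<eta> \<theta> \<longrightarrow>
            controller_order Wo \<le> controller_order Xc)"
proof -
  have Wg: "open (X \<times> U \<times> W)" "(0, 0, 0) \<in> X \<times> U \<times> W" using sets by (auto intro!: open_Times)
  have h_strict: "\<exists>D. strict_derivative (\<lambda>(x, u, w). h x u w) D (x, u, w)"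
    if "x \<in> X" "u \<in> U" and w: "w \<in> W" for x u w
  proof -
    have "(x, u, w) \<in> X \<times> U \<times> W" using that by simp
    from C2_on_strict_derivative[OF g(1) Wg(1) this]
    obtain G where G: "strict_derivative (\<lambda>(x, u, w). g x u w) G (x, u, w)" .
    obtain Q' where Q': "strict_derivative q Q' w" by (rule C2_on_strict_derivative[OF q(1) sets(7) w])
    have p: "strict_derivative (\<lambda>p. snd (snd p)) (\<lambda>p. snd (snd p)) (x, u, w)"
      by (intro strict_derivative_bounded_linear bounded_linear_intros)
    have "strict_derivative (\<lambda>p. q (snd (snd p))) (\<lambda>p. Q' (snd (snd p))) (x, u, w)"
      using strict_derivative_compose[OF p, of q Q'] Q' by simp
    from strict_derivative_diff[OF G this]
    have "strict_derivative (\<lambda>(x, u, w). h x u w) (\<lambda>p. G p - Q' (snd (snd p))) (x, u, w)"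
      unfolding h(1) by (simp add: case_prod_unfold)
    then show ?thesis by blast
  qed
  obtain f' where f': "strict_derivative (\<lambda>(x, u, w). f x u w) f' (0, 0, 0)"
    by (rule C2_on_strict_derivative[OF f(1) Wg])
  obtain h' where h': "strict_derivative (\<lambda>(x, u, w). h x u w) h' (0, 0, 0)"
    using h_strict[OF sets(2,4,8)] by blast
  obtain s' where "strict_derivative s s' 0" by (rule C2_on_strict_derivative[OF s(1) sets(7,8)])
  moreover have "(*v) S = s'"
    unfolding linearization(5) by (rule ext) (rule jacobian_strict_derivative(2)[OF calculation])
  ultimately have sS: "strict_derivative s ((*v) S) 0" by simp
  have ex: "strict_derivative (\<lambda>x. (x, 0, 0)) (\<lambda>x. (x, 0, 0)) (0 :: real ^ 'n)"
    by (intro strict_derivative_bounded_linear bounded_linear_intros)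
  have ew: "strict_derivative (\<lambda>w. (0, 0, w)) (\<lambda>w. (0, 0, w)) (0 :: real ^ 'p)"
    by (intro strict_derivative_bounded_linear bounded_linear_intros)
  have fx: "strict_derivative (\<lambda>x. f x 0 0) (\<lambda>x. f' (x, 0, 0)) 0"
    using strict_derivative_compose[OF ex, of "\<lambda>(x, u, w). f x u w" f'] f' by simp
  have fw: "strict_derivative (\<lambda>w. f 0 0 w) (\<lambda>w. f' (0, 0, w)) 0"
    using strict_derivative_compose[OF ew, of "\<lambda>(x, u, w). f x u w" f'] f' by simp
  have vec: "bounded_linear (vec :: real \<Rightarrow> real ^ 1)"
    by (intro linear_linear[THEN iffD2] linearI) (simp_all add: vec_eq_iff)
  have hx: "strict_derivative (\<lambda>x. vec (h x 0 0) :: real ^ 1) (\<lambda>x. vec (h' (x, 0, 0))) 0"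
    using strict_derivative_linear_compose[OF strict_derivative_compose[OF ex, of "\<lambda>(x, u, w). h x u w" h'] vec] h' by simp
  have hw: "strict_derivative (\<lambda>w. vec (h 0 0 w) :: real ^ 1) (\<lambda>w. vec (h' (0, 0, w))) 0"
    using strict_derivative_linear_compose[OF strict_derivative_compose[OF ew, of "\<lambda>(x, u, w). h x u w" h'] vec] h' by simp
  note A = jacobian_strict_derivative[OF fx, folded linearization(1)]
    and P = jacobian_strict_derivative[OF fw, folded linearization(2)]
    and C = jacobian_strict_derivative[OF hx, folded linearization(3)]
    and Q = jacobian_strict_derivative[OF hw, folded linearization(4)]
  have linf: "linear f'" and linh: "linear h'"
    using f' h' strict_derivative_linear bounded_linear.linear by blast+
  have fsum: "f' (a, 0, b) = A *v a + P *v b" and hsum: "vec (h' (a, 0, b)) = C *v a + Q *v b" for a b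
    unfolding A(2) P(2) C(2) Q(2)
    by (simp_all add: linear_add[OF linf, symmetric] vec_add[symmetric] linear_add[OF linh, symmetric])
  interpret feedforward f h s X U Ye W f' h' S Wo \<pi> \<gamma>
  proof
    show "hurwitz (matrix (\<lambda>x. f' (x, 0, 0)))"
      using \<open>stable_matrix A\<close> unfolding A(1)[symmetric]
      by (auto simp: hurwitz_def stable_matrix_def complex_eigenvalue_def)
    show "0 \<in> Ye" using sets by blast
    show "h 0 0 0 = 0" by (simp add: h(1) g(2) q(2))
    show "\<exists>D. strict_derivative (\<lambda>(x, u, w). f x u w) D (x, u, w)" if "x \<in> X" "u \<in> U" "w \<in> W" for x u w
    proof -
      have "(x, u, w) \<in> X \<times> U \<times> W" using that by simp
      then show ?thesis by (rule C2_on_strict_derivative[OF f(1) Wg(1)]) blast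
    qed
    fix a a' :: "real ^ 'n" and b b' :: "real ^ 'p" and r t :: real
    assume 1: "f' (a, 0, b) = r *\<^sub>R a - t *\<^sub>R a'" "f' (a', 0, b') = r *\<^sub>R a' + t *\<^sub>R a"
      "S *v b = r *\<^sub>R b - t *\<^sub>R b'" "S *v b' = r *\<^sub>R b' + t *\<^sub>R b"
      "h' (a, 0, b) = 0" "h' (a', 0, b') = 0" "0 \<le> r"
    show "b = 0 \<and> b' = 0"
    proof (rule detectable_real[OF \<open>detectable _ _\<close> _ _ 1(3,4) _ _ 1(7)])
      show "C *v a + Q *v b = 0" "C *v a' + Q *v b' = 0"
        unfolding hsum[symmetric] 1(5,6) by (simp_all add: vec_eq_iff)
    qed (use 1(1,2) in \<open>simp_all add: fsum\<close>)
  qed (use sets f s h_strict f' h' sS h exosystem Wo \<pi> \<gamma> regulator_equations in auto)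
  obtain Bc where "solves_regulator_problem f h s X W Wo (\<lambda>\<xi> e. s \<xi> + e *\<^sub>R Bc) \<gamma>"
    using feedback_solves_regulator_problem by blast
  moreover have "controller_order Wo \<le> controller_order Xc"
    if "controller U Ye Xc \<eta> \<theta> \<and> solves_regulator_problem f h s X W Xc \<eta> \<theta>"
    for Xc :: "'z::real_inner set" and \<eta> \<theta>
    using minimal_controller_order[of Xc \<eta> \<theta>] that by (simp add: controller_order_def dim_UNIV)
  ultimately show ?thesis using feedback_controller by blast
qed

end
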